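(* Let $0<\alpha\leqslant 1$, $0<T<\infty$, $J>1$ an integer, $\tau:=T/J$, $0<\theta_0\leqslant1$, let $\mathcal R_{\theta_0}:Z\to[X^*,Y]_{\theta_0}$ be a bounded linear operator, $y_d\in Y$ and $\nu>0$. The problem $$\min_{U\in U_{\mathrm{ad}}}J_{\alpha,\tau}(U):=\tfrac12\,\|(\mathcal S_{\alpha,\tau}\mathcal R_{\theta_0}U)(T-)-y_d\|_Y^2+\tfrac\nu2\,\|U\|_{L^2(0,T;Z)}^2$$ admits a unique solution $U\in U_{\mathrm{ad}}$, and the following first-order optimality condition holds: $$Y_\tau=\mathcal S_{\alpha,\tau}\mathcal R_{\theta_0}U,\qquad P=\mathcal S_{\alpha,\tau}^*\big((Y_\tau(T-)-y_d)\widehat\delta_T\big),$$ $$\operatorname{Re}\int_0^T\big(\mathcal R_{\theta_0}^*P(t)+\nu U(t),\,V(t)-U(t)\big)_Z\,\mathrm dt\geqslant0\quad\text{for all }V\in U_{\mathrm{ad}},$$ where $\widehat\delta_T(t):=0$ if $0<t<T-\tau$ and $\widehat\delta_T(t):=\tau^{-1}$ if $T-\tau<t<T$.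
   Context: All vector spaces are over $\mathbb C$; $(\cdot,\cdot)_{H}$ is the inner product of a Hilbert space $H$; $\mathcal L(B_1,B_2)$ is the space of bounded linear operators, $\mathcal L(B)=\mathcal L(B,B)$. $X,Y$ are separable Hilbert spaces, $X$ continuously embedded and dense in $Y$. $X^*$ is the dual of $X$, with pairing $\langle\cdot,\cdot\rangle_X$ (linear in the first, conjugate-linear in the second argument), and $Y$ is regarded as a subspace of $X^*$ via $\langle v,w\rangle_X:=(v,w)_Y$ for $v\in Y$, $w\in X$. For $0<\theta<\pi$, $\Sigma_\theta:=\{re^{i\gamma}:r>0,-\theta<\gamma<\theta\}$. $\rho(B)$ is the resolvent set and $R(z,B)=(z-B)^{-1}$. $\mathcal A,\mathcal A^*:X\to Y$ are bounded linear operators (also viewed as operators in $Y$ with domain $X$) for which there are constants $\pi/2<\omega_0<\pi$ and $c_0,c_1,\mathcal M_0>0$ such that: $\rho(\mathcal A)\supset\Sigma_{\omega_0}\cup\{0\}$ and $\rho(\mathcal A^* )\supset\Sigma_{\omega_0}\cup\{0\}$; $\|R(z,\mathcal A)\|_{\mathcal L(Y)}\leqslant\mathcal M_0/(1+|z|)$ and $\|R(z,\mathcal A^* )\|_{\mathcal L(Y)}\leqslant\mathcal M_0/(1+|z|)$ for $z\in\Sigma_{\omega_0}$; $(\mathcal Av,w)_Y=(v,\mathcal A^*w)_Y$ for $v,w\in X$; $c_0\|v\|_X\leqslant\|\mathcal Av\|_Y\leqslant c_1\|v\|_X$ and $c_0\|v\|_X\leqslant\|\mathcal A^*v\|_Y\leqslant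 c_1\|v\|_X$ for $v\in X$; $\operatorname{Re}(\mathcal Av,v)_Y\leqslant0$ for $v\in X$. They are extended to bounded operators $Y\to X^*$ by $\langle\mathcal Av,w\rangle_X:=(v,\mathcal A^*w)_Y$ and $\langle\mathcal A^*v,w\rangle_X:=(v,\mathcal Aw)_Y$ ($v\in Y,w\in X$). $[X^*,Y]_\theta$, $[X,Y]_\theta$ ($0\leqslant\theta\leqslant1$) are the complex interpolation spaces ($\theta=0$ gives $X^*$, resp. $X$; $\theta=1$ gives $Y$); $[X^*,Y]_\theta$ is the dual of $[X,Y]_\theta$, with pairing $\langle\cdot,\cdot\rangle_{[X,Y]_\theta}$ extending the one above. Fractional calculus on $(0,T)$: for $0<\gamma<1$ and integrable $v$, $(\mathrm D_{0+}^{-\gamma}v)(t):=\frac1{\Gamma(\gamma)}\int_0^t(t-s)^{\gamma-1}v(s)\,\mathrm ds$, $(\mathrm D_{T-}^{-\gamma}v)(t):=\frac1{\Gamma(\gamma)}\int_t^T(s-t)^{\gamma-1}v(s)\,\mathrm ds$; $\mathrm D_{0+}^0,\mathrm D_{T-}^0$ are the identity; for $0<\gamma\leqslant1$, $\mathrm D_{0+}^\gamma:=\mathrm D\,\mathrm D_{0+}^{\gamma-1}$ and $\mathrm D_{T-}^\gamma:=-\mathrm D\,\mathrm D_{T-}^{\gamma-1}$, with $\mathrm D$ the distributional first derivative in time. Discretization: $t_j:=j\tau$, $0\leqslant j\leqslant J$. For a Banach space $B$, $W_\tau(B)$ is the set of $V\in L^\infty(0,T;B)$ that are constant on each $(t_{j-1},t_j)$,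 $1\leqslant j\leqslant J$; $v(t\pm)$ denotes one-sided limits. For $g\in L^1(0,T;X^* )$, $\mathcal S_{\alpha,\tau}g\in W_\tau(Y)$ and $\mathcal S_{\alpha,\tau}^*g\in W_\tau(Y)$ are defined as follows. If $0<\alpha<1$: for all $V\in W_\tau(X)$, $$\int_0^T\langle(\mathrm D_{0+}^\alpha-\mathcal A)\mathcal S_{\alpha,\tau}g,V\rangle_X\,\mathrm dt=\int_0^T\langle g,V\rangle_X\,\mathrm dt,\qquad \int_0^T\langle(\mathrm D_{T-}^\alpha-\mathcal A^* )\mathcal S_{\alpha,\tau}^*g,V\rangle_X\,\mathrm dt=\int_0^T\langle g,V\rangle_X\,\mathrm dt.$$ If $\alpha=1$: writing $W=\mathcal S_{1,\tau}g$ and $W^*=\mathcal S_{1,\tau}^*g$, for all $V\in W_\tau(X)$, $$(W(0+),V(0+))_Y+\sum_{j=1}^{J-1}(W(t_j+)-W(t_j-),V(t_j+))_Y-\int_0^T\langle\mathcal AW,V\rangle_X\,\mathrm dt=\int_0^T\langle g,V\rangle_X\,\mathrm dt,$$ $$(W^*(T-),V(T-))_Y+\sum_{j=1}^{J-1}(W^*(t_j-)-W^*(t_j+),V(t_j-))_Y-\int_0^T\langle\mathcal A^*W^*,V\rangle_X\,\mathrm dt=\int_0^T\langle g,V\rangle_X\,\mathrm dt.$$ (For $g\in L^1(0,T;Y)$ one has $\mathcal S_{\alpha,\tau}^*g\in W_\tau(X)$.) $Z$ is a Hilbert space, and $U_{\mathrm{ad}}\subset L^\infty(0,T;Z)$ is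 a nonempty, convex, bounded and closed subset of $L^2(0,T;Z)$. $\mathcal R_{\theta_0}^*:[X,Y]_{\theta_0}\to Z$ is defined by $(\mathcal R_{\theta_0}^*v,w)_Z:=\overline{\langle\mathcal R_{\theta_0}w,v\rangle_{[X,Y]_{\theta_0}}}$ for $v\in[X,Y]_{\theta_0}$, $w\in Z$. *)

theory Defs
  imports "HOL-Analysis.Analysis"
begin

section \<open>Complex Hilbert spaces\<close>

class scaleC =
  fixes scaleC :: "complex \<Rightarrow> 'a \<Rightarrow> 'a" (infixr "*\<^sub>C" 75)

class complex_normed = real_normed_vector + scaleC +
  assumes scaleC_add_right: "c *\<^sub>C (x + y) = c *\<^sub>C x + c *\<^sub>C y"
    and scaleC_add_left: "(c + d) *\<^sub>C x = c *\<^sub>C x + d *\<^sub>C x"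
    and scaleC_scaleC: "c *\<^sub>C (d *\<^sub>C x) = (c * d) *\<^sub>C x"
    and scaleR_scaleC: "r *\<^sub>R x = complex_of_real r *\<^sub>C x"
    and norm_scaleC: "norm (c *\<^sub>C x) = cmod c * norm x"

text \<open>
  \<open>cinner\<close> is linear in the first argument. The underlying real Hilbert space carries the
  real part of the complex inner product, so the library's norm is
  \<open>norm x = sqrt (Re (cinner x x))\<close>.
\<close>

class complex_hilbert = complex_normed + real_inner + complete_space +
  fixes cinner :: "'a \<Rightarrow> 'a \<Rightarrow> complex"
  assumes cinner_add_left: "cinner (x + y) z = cinner x z + cinner y z"
    and cinner_scaleC_left: "cinner (c *\<^sub>C x) y = c * cinner x y"
    and cinner_commute: "cinner y x = cnj (cinner x y)"
    and inner_eq_Re_cinner: "inner x y = Re (cinner x y)"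
begin
subclass banach ..
end

definition bounded_clinear :: "('a::complex_normed \<Rightarrow> 'b::complex_normed) \<Rightarrow> bool" where
  "bounded_clinear f \<longleftrightarrow> bounded_linear f \<and> (\<forall>c x. f (c *\<^sub>C x) = c *\<^sub>C f x)"

lemma cinner_add_right: "cinner x (y + z) = cinner x y + cinner x (z::'a::complex_hilbert)"
  by (metis cinner_add_left cinner_commute complex_cnj_add)

lemma cinner_scaleC_right: "cinner x (c *\<^sub>C y) = cnj c * cinner x (y::'a::complex_hilbert)"
  by (metis cinner_scaleC_left cinner_commute complex_cnj_mult)

lemma cmod_cinner_le: "cmod (cinner x y) \<le> norm x * norm (y::'a::complex_hilbert)"
proof (cases "cinner x y = 0")
  case False
  define c where "c = cnj (sgn (cinner x y))"
  have c: "cmod c = 1"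
    using False by (simp add: c_def norm_sgn)
  have "cinner x y = complex_of_real (cmod (cinner x y)) * sgn (cinner x y)"
    by (simp add: sgn_eq)
  moreover have "cnj (sgn (cinner x y)) * sgn (cinner x y) = 1"
    using False by (simp add: mult.commute complex_norm_square[symmetric] norm_sgn)
  ultimately have "c * cinner x y = complex_of_real (cmod (cinner x y))"
    unfolding c_def by (metis mult.left_commute mult.right_neutral)
  then have "cmod (cinner x y) = inner (c *\<^sub>C x) y"
    by (simp add: inner_eq_Re_cinner cinner_scaleC_left)
  also have "\<dots> \<le> norm (c *\<^sub>C x) * norm y"
    by (rule norm_cauchy_schwarz)
  finally show ?thesis
    by (simp add: norm_scaleC c)
qed simp


section \<open>The dual space\<close>

text \<open>
  The pairing of \<open>X\<^sup>*\<close> with \<open>X\<close> is conjugate-linear in its second argument, so the elements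
  of \<open>X\<^sup>*\<close> are the bounded conjugate-linear functionals; the norm is the operator norm.
\<close>

typedef (overloaded) ('a::complex_normed) antidual =
  "{f :: 'a \<Rightarrow>\<^sub>L complex. \<forall>c x. blinfun_apply f (c *\<^sub>C x) = cnj c * blinfun_apply f x}"
  by (rule exI[of _ 0]) simp

setup_lifting type_definition_antidual

instantiation antidual :: (complex_normed) complex_normed
begin

lift_definition zero_antidual :: "'a antidual" is 0 by simp
lift_definition plus_antidual :: "'a antidual \<Rightarrow> 'a antidual \<Rightarrow> 'a antidual" is "(+)"
  by (simp add: blinfun.bilinear_simps algebra_simps)
lift_definition minus_antidual :: "'a antidual \<Rightarrow> 'a antidual \<Rightarrow> 'a antidual" is "(-)"
  by (simp add: blinfun.bilinear_simps algebra_simps)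
lift_definition uminus_antidual :: "'a antidual \<Rightarrow> 'a antidual" is uminus
  by (simp add: blinfun.bilinear_simps)
lift_definition scaleR_antidual :: "real \<Rightarrow> 'a antidual \<Rightarrow> 'a antidual" is scaleR
  by (simp add: blinfun.bilinear_simps)
lift_definition scaleC_antidual :: "complex \<Rightarrow> 'a antidual \<Rightarrow> 'a antidual" is
  "\<lambda>c f. blinfun_mult_right c o\<^sub>L f"
  by (simp add: mult.left_commute)
lift_definition norm_antidual :: "'a antidual \<Rightarrow> real" is norm .
definition dist_antidual :: "'a antidual \<Rightarrow> 'a antidual \<Rightarrow> real" where
  "dist_antidual f g = norm (f - g)"
definition sgn_antidual :: "'a antidual \<Rightarrow> 'a antidual" where
  "sgn_antidual f = inverse (norm f) *\<^sub>R f"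
definition uniformity_antidual :: "('a antidual \<times> 'a antidual) filter" where
  "uniformity_antidual = (INF e\<in>{0<..}. principal {(f, g). dist f g < e})"
definition open_antidual :: "'a antidual set \<Rightarrow> bool" where
  "open_antidual S \<longleftrightarrow> (\<forall>f\<in>S. \<forall>\<^sub>F (f', g) in uniformity. f' = f \<longrightarrow> g \<in> S)"

instance
proof
  fix f g h :: "'a antidual" and r s :: real and c d :: complex
  show "f + g + h = f + (g + h)" by transfer simp
  show "f + g = g + f" by transfer simp
  show "0 + f = f" by transfer simp
  show "- f + f = 0" by transfer simp
  show "f - g = f + - g" by transfer simp
  show "r *\<^sub>R (f + g) = r *\<^sub>R f + r *\<^sub>R g" by transfer (simp add: scaleR_add_right)
  show "(r + s) *\<^sub>R f = r *\<^sub>R f + s *\<^sub>R f" by transfer (simp add: scaleR_add_left)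
  show "r *\<^sub>R s *\<^sub>R f = (r * s) *\<^sub>R f" by transfer simp
  show "1 *\<^sub>R f = f" by transfer simp
  show "dist f g = norm (f - g)" by (simp add: dist_antidual_def)
  show "sgn f = inverse (norm f) *\<^sub>R f" by (simp add: sgn_antidual_def)
  show "uniformity = (INF e\<in>{0<..}. principal {(f, g::'a antidual). dist f g < e})"
    by (simp add: uniformity_antidual_def)
  show "open U \<longleftrightarrow> (\<forall>f\<in>U. \<forall>\<^sub>F (f', g) in uniformity. f' = f \<longrightarrow> g \<in> U)" for U :: "'a antidual set"
    by (simp add: open_antidual_def)
  show "norm f = 0 \<longleftrightarrow> f = 0" by transfer simp
  show "norm (f + g) \<le> norm f + norm g" by transfer (rule norm_triangle_ineq)
  show "norm (r *\<^sub>R f) = \<bar>r\<bar> * norm f" by transfer simp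
  show "c *\<^sub>C (f + g) = c *\<^sub>C f + c *\<^sub>C g"
    by transfer (auto intro!: blinfun_eqI simp: blinfun.bilinear_simps algebra_simps)
  show "(c + d) *\<^sub>C f = c *\<^sub>C f + d *\<^sub>C f"
    by transfer (auto intro!: blinfun_eqI simp: blinfun.bilinear_simps algebra_simps)
  show "c *\<^sub>C d *\<^sub>C f = (c * d) *\<^sub>C f"
    by transfer (auto intro!: blinfun_eqI simp: blinfun.bilinear_simps algebra_simps)
  show "r *\<^sub>R f = complex_of_real r *\<^sub>C f"
    by transfer (auto intro!: blinfun_eqI simp: blinfun.bilinear_simps scaleR_conv_of_real)
  show "norm (c *\<^sub>C f) = cmod c * norm f"
  proof transfer
    fix c :: complex and f :: "'a \<Rightarrow>\<^sub>L complex"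
    have le: "norm (blinfun_mult_right c o\<^sub>L g) \<le> cmod c * norm g"
      for c and g :: "'a \<Rightarrow>\<^sub>L complex"
      by (rule norm_blinfun_bound) (simp_all add: norm_mult norm_blinfun mult.assoc mult_left_mono)
    show "norm (blinfun_mult_right c o\<^sub>L f) = cmod c * norm f"
    proof (cases "c = 0")
      case True
      then show ?thesis using le[of c f] by simp
    next
      case False
      have "blinfun_mult_right (inverse c) o\<^sub>L (blinfun_mult_right c o\<^sub>L f) = f"
        using False by (auto intro!: blinfun_eqI simp: field_simps)
      with le[of "inverse c" "blinfun_mult_right c o\<^sub>L f"] False
      have "cmod c * norm f \<le> norm (blinfun_mult_right c o\<^sub>L f)"
        by (simp add: norm_divide field_simps)
      with le[of c f] show ?thesis by simp
    qed
  qed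
qed

end

lift_definition pairing :: "'a::complex_normed antidual \<Rightarrow> 'a \<Rightarrow> complex" is blinfun_apply .

text \<open>
  For bounded linear \<open>B : X \<rightarrow> Y\<close> and \<open>v \<in> Y\<close>, \<open>dual_op B v\<close> is the functional
  \<open>w \<mapsto> (v, B w)\<^sub>Y\<close> on \<open>X\<close>. With \<open>B\<close> the embedding \<open>\<iota> : X \<rightarrow> Y\<close> it is the identification of \<open>Y\<close>
  with a subspace of \<open>X\<^sup>*\<close>; the extension \<open>Y \<rightarrow> X\<^sup>*\<close> of \<open>\<A>\<close> is \<open>dual_op \<A>\<^sup>*\<close>, and that of
  \<open>\<A>\<^sup>*\<close> is \<open>dual_op \<A>\<close>.
\<close>

definition dual_op ::
    "('x::complex_normed \<Rightarrow> 'y::complex_hilbert) \<Rightarrow> 'y \<Rightarrow> 'x antidual" where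
  "dual_op B v = Abs_antidual (Blinfun (\<lambda>w. cinner v (B w)))"

lemma pairing_dual_op:
  assumes "bounded_clinear B"
  shows "pairing (dual_op B v) w = cinner v (B w)"
proof -
  have B: "bounded_linear B" and BC: "\<And>c x. B (c *\<^sub>C x) = c *\<^sub>C B x"
    using assms by (auto simp: bounded_clinear_def)
  obtain K where K: "\<And>x. norm (B x) \<le> norm x * K"
    using bounded_linear.bounded[OF B] by blast
  have bl: "bounded_linear (\<lambda>w. cinner v (B w))"
  proof (rule bounded_linear_intro[where K = "norm v * K"])
    fix x y r
    show "cinner v (B (x + y)) = cinner v (B x) + cinner v (B y)"
      by (simp add: linear_simps[OF B] cinner_add_right)
    show "cinner v (B (r *\<^sub>R x)) = r *\<^sub>R cinner v (B x)"
      by (simp add: scaleR_scaleC BC cinner_scaleC_right scaleR_conv_of_real)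
    have "norm v * norm (B x) \<le> norm v * (norm x * K)"
      using K[of x] by (intro mult_left_mono) auto
    then show "norm (cinner v (B x)) \<le> norm x * (norm v * K)"
      using cmod_cinner_le[of v "B x"] by (simp add: algebra_simps)
  qed
  then have "Blinfun (\<lambda>w. cinner v (B w)) \<in>
      {f. \<forall>c x. blinfun_apply f (c *\<^sub>C x) = cnj c * blinfun_apply f x}"
    by (simp add: bounded_linear_Blinfun_apply BC cinner_scaleC_right)
  then show ?thesis
    by (simp add: dual_op_def pairing.rep_eq Abs_antidual_inverse bounded_linear_Blinfun_apply[OF bl])
qed


section \<open>Unbounded operators: resolvent set and resolvent\<close>

text \<open>
  Here \<open>A : X \<rightarrow> Y\<close> is regarded as an operator in \<open>Y\<close> whose domain is the image of the
  embedding \<open>\<iota> : X \<rightarrow> Y\<close>.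
\<close>

definition resolvent ::
    "('x \<Rightarrow> 'y::complex_hilbert) \<Rightarrow> ('x \<Rightarrow> 'y) \<Rightarrow> complex \<Rightarrow> 'y \<Rightarrow> 'y" where
  "resolvent \<iota> A z y = \<iota> (inv (\<lambda>x. z *\<^sub>C \<iota> x - A x) y)"

definition resolvent_set :: "('x \<Rightarrow> 'y::complex_hilbert) \<Rightarrow> ('x \<Rightarrow> 'y) \<Rightarrow> complex set" where
  "resolvent_set \<iota> A = {z. bij (\<lambda>x. z *\<^sub>C \<iota> x - A x) \<and> bounded_clinear (resolvent \<iota> A z)}"

definition sector :: "real \<Rightarrow> complex set" where
  "sector \<theta> = {complex_of_real r * cis \<gamma> | r \<gamma>. r > 0 \<and> -\<theta> < \<gamma> \<and> \<gamma> < \<theta>}"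


section \<open>Complex interpolation\<close>

text \<open>
  A couple \<open>(X\<^sub>0, X\<^sub>1)\<close> is given by injections \<open>i0\<close>, \<open>i1\<close> into a common space. In the two
  couples needed below, \<open>(X, Y)\<close> and \<open>(X\<^sup>*, Y)\<close>, one of the spaces continuously contains the
  other one, and the common space is taken to be the larger one; this is \<open>X\<^sub>0 + X\<^sub>1\<close> with an
  equivalent norm. \<open>f0\<close> and \<open>f1\<close> are the boundary values of \<open>f\<close> as functions into \<open>X\<^sub>0\<close>
  and \<open>X\<^sub>1\<close>. Differentiability at \<open>z\<close> with a complex-linear derivative \<open>h \<mapsto> h d\<close> is holomorphy.
\<close>

definition interp_fun ::
    "('a::complex_normed \<Rightarrow> 'e::complex_normed) \<Rightarrow> ('b::complex_normed \<Rightarrow> 'e) \<Rightarrow>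
     (complex \<Rightarrow> 'e) \<Rightarrow> (real \<Rightarrow> 'a) \<Rightarrow> (real \<Rightarrow> 'b) \<Rightarrow> bool" where
  "interp_fun i0 i1 f f0 f1 \<longleftrightarrow>
     continuous_on {z. 0 \<le> Re z \<and> Re z \<le> 1} f \<and>
     bounded (f ` {z. 0 \<le> Re z \<and> Re z \<le> 1}) \<and>
     (\<forall>z. 0 < Re z \<and> Re z < 1 \<longrightarrow> (\<exists>d. (f has_derivative (\<lambda>h. h *\<^sub>C d)) (at z))) \<and>
     continuous_on UNIV f0 \<and> bounded (range f0) \<and> (\<forall>t. f (Complex 0 t) = i0 (f0 t)) \<and>
     continuous_on UNIV f1 \<and> bounded (range f1) \<and> (\<forall>t. f (Complex 1 t) = i1 (f1 t))"

definition interp_space ::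
    "('a::complex_normed \<Rightarrow> 'e::complex_normed) \<Rightarrow> ('b::complex_normed \<Rightarrow> 'e) \<Rightarrow>
     real \<Rightarrow> 'e set" where
  "interp_space i0 i1 \<theta> =
     (if \<theta> = 0 then range i0
      else if \<theta> = 1 then range i1
      else {f (complex_of_real \<theta>) | f f0 f1. interp_fun i0 i1 f f0 f1})"

definition interp_norm ::
    "('a::complex_normed \<Rightarrow> 'e::complex_normed) \<Rightarrow> ('b::complex_normed \<Rightarrow> 'e) \<Rightarrow>
     real \<Rightarrow> 'e \<Rightarrow> real" where
  "interp_norm i0 i1 \<theta> u =
     (if \<theta> = 0 then norm (inv i0 u)
      else if \<theta> = 1 then norm (inv i1 u)
      else Inf {max (SUP t. norm (f0 t)) (SUP t. norm (f1 t)) | f f0 f1.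
                interp_fun i0 i1 f f0 f1 \<and> f (complex_of_real \<theta>) = u})"

abbreviation interp_XY :: "('x::complex_hilbert \<Rightarrow> 'y::complex_hilbert) \<Rightarrow> real \<Rightarrow> 'y set" where
  "interp_XY \<iota> \<theta> \<equiv> interp_space \<iota> (\<lambda>y. y) \<theta>"

abbreviation interp_XY_norm ::
    "('x::complex_hilbert \<Rightarrow> 'y::complex_hilbert) \<Rightarrow> real \<Rightarrow> 'y \<Rightarrow> real" where
  "interp_XY_norm \<iota> \<theta> \<equiv> interp_norm \<iota> (\<lambda>y. y) \<theta>"

abbreviation interp_XdY ::
    "('x::complex_hilbert \<Rightarrow> 'y::complex_hilbert) \<Rightarrow> real \<Rightarrow> 'x antidual set" where
  "interp_XdY \<iota> \<theta> \<equiv> interp_space (\<lambda>u. u) (dual_op \<iota>) \<theta>"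

abbreviation interp_XdY_norm ::
    "('x::complex_hilbert \<Rightarrow> 'y::complex_hilbert) \<Rightarrow> real \<Rightarrow> 'x antidual \<Rightarrow> real" where
  "interp_XdY_norm \<iota> \<theta> \<equiv> interp_norm (\<lambda>u. u) (dual_op \<iota>) \<theta>"

text \<open>
  The pairing of \<open>u \<in> [X\<^sup>*, Y]\<^sub>\<theta>\<close> with \<open>v \<in> [X, Y]\<^sub>\<theta>\<close>: the continuous extension of
  \<open>pairing u\<close> from the dense subspace \<open>X\<close> of \<open>[X, Y]\<^sub>\<theta>\<close>.
\<close>

definition interp_pairing ::
    "('x::complex_hilbert \<Rightarrow> 'y::complex_hilbert) \<Rightarrow> real \<Rightarrow> 'x antidual \<Rightarrow> 'y \<Rightarrow> complex" where
  "interp_pairing \<iota> \<theta> u v =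
     (THE c. \<forall>x. (\<forall>n. \<iota> (x n) - v \<in> interp_XY \<iota> \<theta>) \<and>
                 (\<lambda>n. interp_XY_norm \<iota> \<theta> (\<iota> (x n) - v)) \<longlonglongrightarrow> 0 \<longrightarrow>
                 (\<lambda>n. pairing u (x n)) \<longlonglongrightarrow> c)"

definition interp_adjoint ::
    "('x::complex_hilbert \<Rightarrow> 'y::complex_hilbert) \<Rightarrow> real \<Rightarrow>
     ('z::complex_hilbert \<Rightarrow> 'x antidual) \<Rightarrow> 'y \<Rightarrow> 'z" where
  "interp_adjoint \<iota> \<theta> R v = (THE z. \<forall>w. cinner z w = cnj (interp_pairing \<iota> \<theta> (R w) v))"

definition bounded_clinear_into_interp ::
    "('x::complex_hilbert \<Rightarrow> 'y::complex_hilbert) \<Rightarrow> real \<Rightarrow>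
     ('z::complex_hilbert \<Rightarrow> 'x antidual) \<Rightarrow> bool" where
  "bounded_clinear_into_interp \<iota> \<theta> R \<longleftrightarrow>
     (\<forall>z w. R (z + w) = R z + R w) \<and> (\<forall>c z. R (c *\<^sub>C z) = c *\<^sub>C R z) \<and>
     range R \<subseteq> interp_XdY \<iota> \<theta> \<and>
     (\<exists>C. \<forall>z. interp_XdY_norm \<iota> \<theta> (R z) \<le> C * norm z)"


section \<open>Functions on the time interval\<close>

abbreviation time :: "real \<Rightarrow> real measure" where
  "time T \<equiv> lebesgue_on {0<..<T}"

text \<open>
  \<open>Z\<close> need not be separable, so strong (Bochner) measurability is required rather than Borel
  measurability.
\<close>

definition strongly_measurable :: "'m measure \<Rightarrow> ('m \<Rightarrow> 'a::topological_space) \<Rightarrow> bool" where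
  "strongly_measurable M f \<longleftrightarrow>
     (\<exists>s. (\<forall>n. simple_function M (s n)) \<and> (AE t in M. (\<lambda>n. s n t) \<longlonglongrightarrow> f t))"

text \<open>
  Elements of \<open>L\<^sup>2\<close> and \<open>L\<^sup>\<infinity>\<close> are represented by functions. A subset of \<open>L\<^sup>2\<close> that is closed in
  the sense below contains with each function all those equal to it almost everywhere, and
  hence is a set of equivalence classes.
\<close>

definition L2 :: "real \<Rightarrow> (real \<Rightarrow> 'a::real_normed_vector) set" where
  "L2 T = {U. strongly_measurable (time T) U \<and> integrable (time T) (\<lambda>t. (norm (U t))\<^sup>2)}"

definition L2_norm :: "real \<Rightarrow> (real \<Rightarrow> 'a::real_normed_vector) \<Rightarrow> real" where
  "L2_norm T U = sqrt (LINT t|time T. (norm (U t))\<^sup>2)"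

definition Linf :: "real \<Rightarrow> (real \<Rightarrow> 'a::real_normed_vector) set" where
  "Linf T = {U. strongly_measurable (time T) U \<and> (\<exists>C. AE t in time T. norm (U t) \<le> C)}"

definition fun_convex :: "('t \<Rightarrow> 'a::real_vector) set \<Rightarrow> bool" where
  "fun_convex K \<longleftrightarrow>
     (\<forall>U\<in>K. \<forall>V\<in>K. \<forall>s. 0 \<le> s \<and> s \<le> 1 \<longrightarrow> (\<lambda>t. (1 - s) *\<^sub>R U t + s *\<^sub>R V t) \<in> K)"

definition L2_bounded :: "real \<Rightarrow> (real \<Rightarrow> 'a::real_normed_vector) set \<Rightarrow> bool" where
  "L2_bounded T K \<longleftrightarrow> (\<exists>C. \<forall>U\<in>K. L2_norm T U \<le> C)"

definition L2_closed :: "real \<Rightarrow> (real \<Rightarrow> 'a::real_normed_vector) set \<Rightarrow> bool" where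
  "L2_closed T K \<longleftrightarrow>
     (\<forall>U V. (\<forall>n. U n \<in> K) \<and> V \<in> L2 T \<and> (\<lambda>n. L2_norm T (\<lambda>t. U n t - V t)) \<longlonglongrightarrow> 0 \<longrightarrow> V \<in> K)"


section \<open>Fractional calculus\<close>

definition frac_int_left ::
    "real \<Rightarrow> (real \<Rightarrow> 'a::{banach,second_countable_topology}) \<Rightarrow> real \<Rightarrow> 'a" where
  "frac_int_left \<gamma> v t =
     (if \<gamma> = 0 then v t
      else (1 / Gamma \<gamma>) *\<^sub>R (LINT s|lebesgue_on {0<..<t}. (t - s) powr (\<gamma> - 1) *\<^sub>R v s))"

definition frac_int_right ::
    "real \<Rightarrow> real \<Rightarrow> (real \<Rightarrow> 'a::{banach,second_countable_topology}) \<Rightarrow> real \<Rightarrow> 'a" where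
  "frac_int_right T \<gamma> v t =
     (if \<gamma> = 0 then v t
      else (1 / Gamma \<gamma>) *\<^sub>R (LINT s|lebesgue_on {t<..<T}. (s - t) powr (\<gamma> - 1) *\<^sub>R v s))"

definition test_fun :: "real \<Rightarrow> (real \<Rightarrow> real) \<Rightarrow> bool" where
  "test_fun T \<phi> \<longleftrightarrow>
     (\<forall>k t. (deriv ^^ k) \<phi> field_differentiable at t) \<and>
     (\<exists>K. compact K \<and> K \<subseteq> {0<..<T} \<and> (\<forall>t. t \<notin> K \<longrightarrow> \<phi> t = 0))"

definition is_weak_deriv ::
    "real \<Rightarrow> (real \<Rightarrow> 'a::{banach,second_countable_topology}) \<Rightarrow> (real \<Rightarrow> 'a) \<Rightarrow> bool" where
  "is_weak_deriv T f h \<longleftrightarrow> integrable (time T) h \<and>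
     (\<forall>\<phi>. test_fun T \<phi> \<longrightarrow>
        (LINT t|time T. deriv \<phi> t *\<^sub>R f t) = - (LINT t|time T. \<phi> t *\<^sub>R h t))"

text \<open>
  The distributional derivative on \<open>(0, T)\<close> when it is an \<open>L\<^sup>1\<close> function, which is the only case
  used; it is determined up to a null set.
\<close>

definition weak_deriv ::
    "real \<Rightarrow> (real \<Rightarrow> 'a::{banach,second_countable_topology}) \<Rightarrow> real \<Rightarrow> 'a" where
  "weak_deriv T f = (SOME h. is_weak_deriv T f h)"

definition frac_deriv_left ::
    "real \<Rightarrow> real \<Rightarrow> (real \<Rightarrow> 'a::{banach,second_countable_topology}) \<Rightarrow> real \<Rightarrow> 'a" where
  "frac_deriv_left T \<gamma> v = weak_deriv T (frac_int_left (1 - \<gamma>) v)"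

definition frac_deriv_right ::
    "real \<Rightarrow> real \<Rightarrow> (real \<Rightarrow> 'a::{banach,second_countable_topology}) \<Rightarrow> real \<Rightarrow> 'a" where
  "frac_deriv_right T \<gamma> v = (\<lambda>t. - weak_deriv T (frac_int_right T (1 - \<gamma>) v) t)"


section \<open>Discretization\<close>

definition node :: "real \<Rightarrow> nat \<Rightarrow> nat \<Rightarrow> real" where
  "node T J j = real j * (T / real J)"

definition W_space :: "real \<Rightarrow> nat \<Rightarrow> (real \<Rightarrow> 'a) set" where
  "W_space T J =
     {V. \<forall>j\<in>{1..J}. \<exists>b. \<forall>t. node T J (j - 1) < t \<and> t < node T J j \<longrightarrow> V t = b}"

definition lim_left :: "(real \<Rightarrow> 'a::t2_space) \<Rightarrow> real \<Rightarrow> 'a" where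
  "lim_left v t = Lim (at_left t) v"

definition lim_right :: "(real \<Rightarrow> 'a::t2_space) \<Rightarrow> real \<Rightarrow> 'a" where
  "lim_right v t = Lim (at_right t) v"

text \<open>
  The defining variational equations. The first operator argument of \<open>is_sol\<close> is \<open>\<A>\<^sup>*\<close>
  (through which \<open>\<A>\<close> is extended to \<open>Y\<close>), that of \<open>is_adj_sol\<close> is \<open>\<A>\<close>.
\<close>

definition is_sol ::
    "('x::complex_hilbert \<Rightarrow> 'y::{complex_hilbert,second_countable_topology}) \<Rightarrow>
     ('x \<Rightarrow> 'y) \<Rightarrow> real \<Rightarrow> real \<Rightarrow> nat \<Rightarrow> (real \<Rightarrow> 'x antidual) \<Rightarrow> (real \<Rightarrow> 'y) \<Rightarrow> bool" where
  "is_sol \<iota> As \<alpha> T J g W \<longleftrightarrow> W \<in> W_space T J \<and>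
     (\<forall>V\<in>W_space T J.
        (if \<alpha> < 1 then
           (LINT t|time T. pairing (dual_op \<iota> (frac_deriv_left T \<alpha> W t) - dual_op As (W t)) (V t))
         else
           cinner (lim_right W 0) (\<iota> (lim_right V 0)) +
           (\<Sum>j=1..J-1. cinner (lim_right W (node T J j) - lim_left W (node T J j))
                              (\<iota> (lim_right V (node T J j)))) -
           (LINT t|time T. pairing (dual_op As (W t)) (V t)))
        = (LINT t|time T. pairing (g t) (V t)))"

definition is_adj_sol ::
    "('x::complex_hilbert \<Rightarrow> 'y::{complex_hilbert,second_countable_topology}) \<Rightarrow>
     ('x \<Rightarrow> 'y) \<Rightarrow> real \<Rightarrow> real \<Rightarrow> nat \<Rightarrow> (real \<Rightarrow> 'x antidual) \<Rightarrow> (real \<Rightarrow> 'y) \<Rightarrow> bool" where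
  "is_adj_sol \<iota> A \<alpha> T J g W \<longleftrightarrow> W \<in> W_space T J \<and>
     (\<forall>V\<in>W_space T J.
        (if \<alpha> < 1 then
           (LINT t|time T. pairing (dual_op \<iota> (frac_deriv_right T \<alpha> W t) - dual_op A (W t)) (V t))
         else
           cinner (lim_left W T) (\<iota> (lim_left V T)) +
           (\<Sum>j=1..J-1. cinner (lim_left W (node T J j) - lim_right W (node T J j))
                              (\<iota> (lim_left V (node T J j)))) -
           (LINT t|time T. pairing (dual_op A (W t)) (V t)))
        = (LINT t|time T. pairing (g t) (V t)))"

text \<open>
  The solutions are unique as elements of \<open>L\<^sup>\<infinity>(0, T; Y)\<close>; as functions their values at the nodes
  and outside of \<open>(0, T)\<close> are arbitrary, hence \<open>SOME\<close> rather than \<open>THE\<close>.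
\<close>

definition sol ::
    "('x::complex_hilbert \<Rightarrow> 'y::{complex_hilbert,second_countable_topology}) \<Rightarrow>
     ('x \<Rightarrow> 'y) \<Rightarrow> real \<Rightarrow> real \<Rightarrow> nat \<Rightarrow> (real \<Rightarrow> 'x antidual) \<Rightarrow> real \<Rightarrow> 'y" where
  "sol \<iota> As \<alpha> T J g = (SOME W. is_sol \<iota> As \<alpha> T J g W)"

definition adj_sol ::
    "('x::complex_hilbert \<Rightarrow> 'y::{complex_hilbert,second_countable_topology}) \<Rightarrow>
     ('x \<Rightarrow> 'y) \<Rightarrow> real \<Rightarrow> real \<Rightarrow> nat \<Rightarrow> (real \<Rightarrow> 'x antidual) \<Rightarrow> real \<Rightarrow> 'y" where
  "adj_sol \<iota> A \<alpha> T J g = (SOME W. is_adj_sol \<iota> A \<alpha> T J g W)"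

definition delta_hat :: "real \<Rightarrow> nat \<Rightarrow> real \<Rightarrow> real" where
  "delta_hat T J t = (if T - T / real J < t \<and> t < T then inverse (T / real J) else 0)"

definition cost ::
    "('x::complex_hilbert \<Rightarrow> 'y::{complex_hilbert,second_countable_topology}) \<Rightarrow>
     ('x \<Rightarrow> 'y) \<Rightarrow> real \<Rightarrow> real \<Rightarrow> nat \<Rightarrow> ('z::complex_hilbert \<Rightarrow> 'x antidual) \<Rightarrow>
     'y \<Rightarrow> real \<Rightarrow> (real \<Rightarrow> 'z) \<Rightarrow> real" where
  "cost \<iota> As \<alpha> T J R yd \<nu> U =
     (norm (lim_left (sol \<iota> As \<alpha> T J (\<lambda>t. R (U t))) T - yd))\<^sup>2 / 2 +
     \<nu> / 2 * (L2_norm T U)\<^sup>2"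

end

theory Submission
  imports Defs "HOL-Complex_Analysis.Conformal_Mappings"
begin

text \<open>
  The discretized state is an affine function of the control, and so the cost functional is
  quadratic along segments, with second variation at least \<open>\<nu> \<parallel>V - U\<parallel>\<^sup>2\<close>. This alone gives the
  theorem, once three things are known: that the discrete state equation is uniquely solvable with
  a solution depending continuously on the control in \<open>L\<^sup>2\<close>, that the first variation can be
  written with the adjoint state, and that \<open>L\<^sup>2\<close> is complete. By strong convexity a minimizing
  sequence is Cauchy (\<open>minimizing_sequence_Cauchy\<close>), its limit is the unique minimizer, and
  the derivative along each segment that starts there is nonnegative (\<open>optimal_control\<close>).

  The discrete equations. Testing with functions that live on a single cell decouples them, and
  the integral of the fractional derivative over a cell is the increment of the fractional
  integral, a continuous function known in closed form. Since the derivative is a distributional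
  one, this rests on the fundamental lemma of the calculus of variations, applied to explicit
  smooth bumps (\<open>weak_deriv_integral\<close>). The result is a lower triangular system with real
  coefficients and positive diagonal (\<open>is_sol_iff\<close>). Each of its steps asks for \<open>w \<in> Y\<close> with
  \<open>(w, (\<kappa> - \<tau> \<A>\<^sup>*) v)\<^sub>Y = f v\<close> for all \<open>v \<in> X\<close>; as \<open>\<kappa> / \<tau> > 0\<close> lies in the resolvent set of
  \<open>\<A>\<^sup>*\<close>, this is the Riesz representation of a bounded functional on \<open>Y\<close>. Reversing time transposes
  the matrix, and so the adjoint scheme is upper triangular with the same coefficients; for data
  in \<open>Y\<close> it is solved within \<open>X\<close> (\<open>adj_sol_values\<close>). Pairing the two systems gives the
  identity \<open>(D\<^sub>J, y)\<^sub>Y = \<integral> \<langle>R (V - U), P\<rangle> dt\<close>, where \<open>D\<close> is the difference of the states of \<open>V\<close> and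
  \<open>U\<close>, and \<open>P\<close> is the adjoint state for \<open>y\<close> (\<open>duality_identity\<close>, \<open>variation_adjoint\<close>).

  The interpolation spaces. That the control operator maps \<open>Z\<close> boundedly into \<open>X\<^sup>*\<close>, and that the
  pairing of \<open>[X\<^sup>*, Y]\<^sub>\<theta>\<close> with \<open>[X, Y]\<^sub>\<theta>\<close> is well defined on \<open>X\<close>, both follow from the estimate
  \<open>\<bar>\<langle>u, x\<rangle>\<bar> \<le> C \<parallel>u\<parallel> \<parallel>x\<parallel>\<close> in the interpolation norms (\<open>pairing_interp_bound\<close>). It is the maximum
  principle for the pairing of the two holomorphic extensions, one of them regularized by the
  operators \<open>n (n - \<A>\<^sup>*)\<^sup>-\<^sup>1 : Y \<rightarrow> X\<close>.
\<close>

section \<open>Strongly convex minimization and the Riesz representation\<close>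

text \<open>
  If two nearly minimal points were far apart, their midpoint would lie below the infimum.
\<close>

lemma minimizing_sequence_Cauchy:
  fixes F :: "'k \<Rightarrow> real" and d :: "'k \<Rightarrow> 'k \<Rightarrow> real"
  assumes "K \<noteq> {}" and bdd: "bdd_below (F ` K)" and "c > 0"
    and mid: "\<And>u v. u \<in> K \<Longrightarrow> v \<in> K \<Longrightarrow> \<exists>w\<in>K. F w \<le> (F u + F v) / 2 - c * (d u v)\<^sup>2"
  obtains u where "\<And>n. u n \<in> K" "(\<lambda>n. F (u n)) \<longlonglongrightarrow> Inf (F ` K)"
    "\<And>e. e > 0 \<Longrightarrow> \<exists>N. \<forall>m\<ge>N. \<forall>n\<ge>N. d (u m) (u n) < e"
proof -
  let ?I = "Inf (F ` K)"
  have "\<exists>v\<in>K. F v < ?I + 1 / Suc n" for n :: nat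
    using cInf_lessD[of "F ` K" "?I + 1 / Suc n"] \<open>K \<noteq> {}\<close> by (auto simp: image_iff)
  then obtain u where u: "\<And>n. u n \<in> K" "\<And>n. F (u n) < ?I + 1 / Suc n"
    by metis
  have low: "?I \<le> F v" if "v \<in> K" for v
    using that bdd by (auto intro: cInf_lower)
  have lim: "(\<lambda>n. F (u n)) \<longlonglongrightarrow> ?I"
  proof (rule tendsto_sandwich)
    show "\<forall>\<^sub>F n in sequentially. ?I \<le> F (u n)"
      using low u(1) by auto
    show "\<forall>\<^sub>F n in sequentially. F (u n) \<le> ?I + 1 / Suc n"
      using u(2) less_imp_le by (auto intro!: always_eventually)
    show "(\<lambda>n. ?I + 1 / real (Suc n)) \<longlonglongrightarrow> ?I"
      using tendsto_add[OF tendsto_const LIMSEQ_inverse_real_of_nat, of ?I] by (simp add: field_simps)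
  qed simp
  have "\<exists>N. \<forall>m\<ge>N. \<forall>n\<ge>N. d (u m) (u n) < e" if "e > 0" for e
  proof -
    have "c * e\<^sup>2 > 0" using \<open>c > 0\<close> that by simp
    with lim have "\<forall>\<^sub>F n in sequentially. F (u n) < ?I + c * e\<^sup>2"
      by (intro order_tendstoD) auto
    then obtain N where N: "\<And>n. n \<ge> N \<Longrightarrow> F (u n) < ?I + c * e\<^sup>2"
      by (auto simp: eventually_sequentially)
    have "d (u m) (u n) < e" if "m \<ge> N" "n \<ge> N" for m n
    proof -
      obtain w where "w \<in> K" "F w \<le> (F (u m) + F (u n)) / 2 - c * (d (u m) (u n))\<^sup>2"
        using mid u(1) by blast
      with low[of w] N[OF that(1)] N[OF that(2)] have "c * (d (u m) (u n))\<^sup>2 < c * e\<^sup>2"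
        by argo
      then have "(d (u m) (u n))\<^sup>2 < e\<^sup>2" using \<open>c > 0\<close> by simp
      then show ?thesis using \<open>e > 0\<close> by (intro power2_less_imp_less[of _ e]) auto
    qed
    then show ?thesis by blast
  qed
  with that u(1) lim show ?thesis by blast
qed

text \<open>
  The representing vector is the minimizer of \<open>\<parallel>x\<parallel>\<^sup>2 / 2 - f x\<close>; it is the limit of a
  minimizing sequence by the parallelogram law.
\<close>

lemma riesz_real:
  fixes f :: "'a::{real_inner,complete_space} \<Rightarrow> real"
  assumes "bounded_linear f"
  shows "\<exists>y. \<forall>x. f x = inner x y"
proof -
  interpret bounded_linear f by fact
  obtain B where B: "\<And>x. \<bar>f x\<bar> \<le> norm x * B" using bounded by (auto simp: real_norm_def)
  define F where "F x = (norm x)\<^sup>2 / 2 - f x" for x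
  have "- (B\<^sup>2 / 2) \<le> F x" for x
    using B[of x] zero_le_power2[of "norm x - B"] by (simp add: F_def power2_eq_square algebra_simps)
  then have bdd: "bdd_below (range F)" by (auto simp: bdd_below_def)
  have mid: "\<exists>w\<in>UNIV. F w \<le> (F u + F v) / 2 - 1/8 * (dist u v)\<^sup>2" for u v
  proof (intro bexI)
    show "F ((1/2) *\<^sub>R (u + v)) \<le> (F u + F v) / 2 - 1/8 * (dist u v)\<^sup>2"
      unfolding F_def scaleR add dist_norm power2_norm_eq_inner
      by (simp add: inner_commute algebra_simps inner_simps field_simps)
  qed simp
  obtain u where u: "(\<lambda>n. F (u n)) \<longlonglongrightarrow> Inf (range F)"
    "\<And>e. e > 0 \<Longrightarrow> \<exists>N. \<forall>m\<ge>N. \<forall>n\<ge>N. dist (u m) (u n) < e"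
    by (rule minimizing_sequence_Cauchy[OF _ bdd _ mid]) auto
  then have "Cauchy u" by (simp add: Cauchy_def)
  then obtain y where y: "u \<longlonglongrightarrow> y" by (auto simp: Cauchy_convergent_iff convergent_def)
  have "(\<lambda>n. F (u n)) \<longlonglongrightarrow> F y"
    unfolding F_def by (intro tendsto_intros tendsto y) auto
  with u(1) have "F y = Inf (range F)" by (rule LIMSEQ_unique[rotated])
  then have min: "F y \<le> F x" for x using bdd by (auto intro: cInf_lower)
  have "f x = inner x y" for x
  proof -
    define a where "a = inner x y - f x"
    have *: "0 \<le> t * a + t\<^sup>2 * (norm x)\<^sup>2 / 2" for t
      using min[of "y + t *\<^sub>R x"] unfolding F_def a_def scaleR add power2_norm_eq_inner
      by (simp add: inner_commute algebra_simps inner_simps power2_eq_square)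
    define N where "N = (norm x)\<^sup>2 + 1"
    have "N > 0" by (simp add: N_def add_nonneg_pos)
    have "0 \<le> - a\<^sup>2 / N + a\<^sup>2 * (norm x)\<^sup>2 / (2 * N\<^sup>2)"
      using *[of "- a / N"] by (simp add: power2_eq_square)
    also have "\<dots> \<le> - a\<^sup>2 / N + a\<^sup>2 * N / (2 * N\<^sup>2)"
      by (intro add_left_mono divide_right_mono mult_left_mono) (auto simp: N_def)
    also have "\<dots> = - a\<^sup>2 / (2 * N)"
      using \<open>N > 0\<close> by (simp add: field_simps power2_eq_square)
    finally have "a\<^sup>2 \<le> 0" using \<open>N > 0\<close> by (simp add: field_simps)
    then show ?thesis by (simp add: a_def)
  qed
  then show ?thesis by blast
qed

lemma scaleC_simps [simp]:
  fixes x :: "'a::complex_normed"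
  shows "0 *\<^sub>C x = 0" "c *\<^sub>C (0::'a) = 0" "1 *\<^sub>C x = x"
proof -
  show "0 *\<^sub>C x = 0" using scaleR_scaleC[of 0 x] by simp
  show "1 *\<^sub>C x = x" using scaleR_scaleC[of 1 x] by simp
  have "norm (c *\<^sub>C (0::'a)) = 0" by (simp add: norm_scaleC)
  then show "c *\<^sub>C (0::'a) = 0" by simp
qed

lemma scaleC_minus_right: "c *\<^sub>C (- x) = - (c *\<^sub>C (x::'a::complex_normed))"
  by (metis add.right_inverse add_eq_0_iff scaleC_add_right scaleC_simps(2))

lemma scaleC_diff_right: "c *\<^sub>C (x - y) = c *\<^sub>C x - c *\<^sub>C (y::'a::complex_normed)"
  by (metis add_uminus_conv_diff scaleC_add_right scaleC_minus_right)

lemma bounded_bilinear_cinner: "bounded_bilinear (cinner :: 'a::complex_hilbert \<Rightarrow> 'a \<Rightarrow> complex)"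
proof
  show "\<exists>K. \<forall>a b::'a. norm (cinner a b) \<le> norm a * norm b * K"
    by (intro exI[of _ 1]) (simp add: cmod_cinner_le)
qed (simp_all add: cinner_add_left cinner_add_right scaleR_scaleC cinner_scaleC_left
      cinner_scaleC_right scaleR_conv_of_real)

interpretation cinner: bounded_bilinear "cinner :: 'a::complex_hilbert \<Rightarrow> 'a \<Rightarrow> complex"
  by (rule bounded_bilinear_cinner)

lemma cinner_self: "cinner x x = complex_of_real ((norm x)\<^sup>2)" for x :: "'a::complex_hilbert"
proof -
  have "Im (cinner x x) = 0" using cinner_commute[of x x] by (simp add: complex_eq_iff)
  then show ?thesis
    by (simp add: complex_eq_iff power2_norm_eq_inner inner_eq_Re_cinner)
qed

lemma cinner_eqI:
  fixes x y :: "'a::complex_hilbert"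
  assumes "\<And>v. cinner x v = cinner y v"
  shows "x = y"
proof -
  have "cinner (x - y) (x - y) = 0" using assms[of "x - y"] by (simp add: cinner.diff_left)
  then show ?thesis by (simp add: cinner_self)
qed

lemma riesz_antilinear:
  fixes f :: "'a::complex_hilbert \<Rightarrow> complex"
  assumes add: "\<And>x y. f (x + y) = f x + f y" and scale: "\<And>c x. f (c *\<^sub>C x) = cnj c * f x"
    and bound: "\<And>x. cmod (f x) \<le> B * norm x"
  shows "\<exists>y. \<forall>x. f x = cinner y x"
proof -
  have "bounded_linear (\<lambda>x. Re (f x))"
  proof (rule bounded_linear_intro[where K = B])
    show "norm (Re (f x)) \<le> norm x * B" for x
      using bound[of x] abs_Re_le_cmod[of "f x"] by (simp add: mult.commute)
  qed (simp_all add: add scaleR_scaleC scale)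
  from riesz_real[OF this] obtain y where y: "\<And>x. Re (f x) = inner x y" by blast
  have "f x = cinner y x" for x
  proof (rule complex_eqI)
    show "Re (f x) = Re (cinner y x)" for x
      by (metis y inner_commute inner_eq_Re_cinner)
    \<comment> \<open>the imaginary part of an antilinear functional at \<open>x\<close> is its real part at \<open>\<i> x\<close>\<close>
    from this[of "\<i> *\<^sub>C x"] show "Im (f x) = Im (cinner y x)"
      by (simp add: scale cinner_scaleC_right)
  qed
  then show ?thesis by blast
qed

section \<open>The maximum principle on the strip\<close>

text \<open>
  The factor \<open>exp (e (z\<^sup>2 - 1))\<close> has modulus at most one on the strip and decays as
  \<open>\<bar>Im z\<bar> \<rightarrow> \<infinity>\<close>, so that the maximum modulus principle on a long rectangle applies; then let
  \<open>e \<rightarrow> 0\<close>.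
\<close>

lemma strip_maximum_principle:
  fixes f :: "complex \<Rightarrow> complex"
  assumes cont: "continuous_on {z. 0 \<le> Re z \<and> Re z \<le> 1} f"
    and bdd: "bounded (f ` {z. 0 \<le> Re z \<and> Re z \<le> 1})"
    and hol: "f holomorphic_on {z. 0 < Re z \<and> Re z < 1}"
    and left: "\<And>t. cmod (f (Complex 0 t)) \<le> M" and right: "\<And>t. cmod (f (Complex 1 t)) \<le> M"
    and z: "0 \<le> Re z" "Re z \<le> 1"
  shows "cmod (f z) \<le> M"
proof (rule field_le_epsilon)
  fix \<delta> :: real assume "\<delta> > 0"
  define M' where "M' = M + \<delta>"
  have "M \<ge> 0" using left[of 0] norm_ge_zero order_trans by blast
  with \<open>\<delta> > 0\<close> have "M' > 0" by (simp add: M'_def)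
  obtain B where "B > 0" and B: "\<And>w. 0 \<le> Re w \<Longrightarrow> Re w \<le> 1 \<Longrightarrow> cmod (f w) \<le> B"
    using bdd by (auto simp: bounded_pos)
  have "cmod (f z) * exp (e * (Re (z\<^sup>2) - 1)) \<le> M'" if "e > 0" for e
  proof -
    define h where "h w = f w * exp (of_real e * (w\<^sup>2 - 1))" for w
    define R where "R = max \<bar>Im z\<bar> (B / (M' * e) + 1)"
    have "R \<ge> 1" using \<open>B > 0\<close> \<open>M' > 0\<close> that by (simp add: R_def le_max_iff_disj)
    have "B / (M' * e) \<le> R" by (simp add: R_def)
    also have "\<dots> \<le> R\<^sup>2" using \<open>R \<ge> 1\<close> by (simp add: power2_eq_square)
    finally have "B \<le> M' * (e * R\<^sup>2)" using \<open>M' > 0\<close> that by (simp add: field_simps)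
    also have "\<dots> \<le> M' * exp (e * R\<^sup>2)"
      using \<open>M' > 0\<close> exp_ge_add_one_self[of "e * R\<^sup>2"] by (intro mult_left_mono) linarith+
    finally have BR: "B * exp (- (e * R\<^sup>2)) \<le> M'"
      by (simp add: exp_minus field_simps)
    let ?S = "cbox (Complex 0 (- R)) (Complex 1 R)"
    have norm_h: "cmod (h w) = cmod (f w) * exp (e * (Re (w\<^sup>2) - 1))" for w
      by (simp add: h_def norm_mult)
    have decay: "e * (Re (w\<^sup>2) - 1) \<le> - (e * (Im w)\<^sup>2)" if "0 \<le> Re w" "Re w \<le> 1" for w
    proof -
      have "(Re w)\<^sup>2 \<le> 1" using that by (simp add: power_le_one)
      then have "Re (w\<^sup>2) - 1 \<le> - (Im w)\<^sup>2" by (simp add: power2_eq_square)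
      then have "e * (Re (w\<^sup>2) - 1) \<le> e * (- (Im w)\<^sup>2)"
        using \<open>e > 0\<close> by (intro mult_left_mono) auto
      then show ?thesis by simp
    qed
    have "cmod (h z) \<le> M'"
    proof (rule maximum_modulus_frontier[where f = h and S = ?S])
      show "h holomorphic_on interior ?S"
        unfolding h_def interior_cbox
        by (intro holomorphic_intros holomorphic_on_subset[OF hol]) (auto simp: in_box_complex_iff)
      show "continuous_on (closure ?S) h"
        unfolding h_def closure_cbox
        by (intro continuous_intros continuous_on_subset[OF cont]) (auto simp: in_cbox_complex_iff)
      show "z \<in> ?S" using z by (auto simp: in_cbox_complex_iff R_def)
      show "cmod (h w) \<le> M'" if "w \<in> frontier ?S" for w
      proof -
        from that have w: "0 \<le> Re w" "Re w \<le> 1"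
          "Re w = 0 \<or> Re w = 1 \<or> \<bar>Im w\<bar> = R"
          unfolding frontier_cbox by (auto simp: in_cbox_complex_iff in_box_complex_iff)
        note d = decay[OF w(1,2)]
        show ?thesis
        proof (cases "\<bar>Im w\<bar> = R")
          case True
          then have "(Im w)\<^sup>2 = R\<^sup>2" by (metis power2_abs)
          with d have "exp (e * (Re (w\<^sup>2) - 1)) \<le> exp (- (e * R\<^sup>2))" by simp
          then have "cmod (h w) \<le> B * exp (- (e * R\<^sup>2))"
            unfolding norm_h using B[OF w(1,2)] \<open>B > 0\<close> by (intro mult_mono) auto
          with BR show ?thesis by simp
        next
          case False
          with w(3) have "w = Complex 0 (Im w) \<or> w = Complex 1 (Im w)" by (auto simp: complex_eq_iff)
          with left right have "cmod (f w) \<le> M" by metis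
          moreover have "exp (e * (Re (w\<^sup>2) - 1)) \<le> 1"
            using d \<open>e > 0\<close> by (simp add: order.trans[of _ "- (e * (Im w)\<^sup>2)"])
          ultimately have "cmod (h w) \<le> M * 1"
            unfolding norm_h using \<open>M \<ge> 0\<close> by (intro mult_mono) auto
          then show ?thesis using \<open>\<delta> > 0\<close> by (simp add: M'_def)
        qed
      qed
    qed simp
    then show ?thesis by (simp add: norm_h)
  qed
  then have "\<forall>\<^sub>F e in at_right 0. cmod (f z) * exp (e * (Re (z\<^sup>2) - 1)) \<le> M'"
    by (simp add: eventually_at_right_less eventually_mono[OF eventually_at_right_less])
  moreover have "((\<lambda>e. cmod (f z) * exp (e * (Re (z\<^sup>2) - 1)))
      \<longlongrightarrow> cmod (f z) * exp (0 * (Re (z\<^sup>2) - 1))) (at_right 0)"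
    by (intro tendsto_intros)
  ultimately have "cmod (f z) * exp (0 * (Re (z\<^sup>2) - 1)) \<le> M'"
    by (intro tendsto_upperbound) auto
  then show "cmod (f z) \<le> M + \<delta>" by (simp add: M'_def)
qed

section \<open>Regularization by resolvents\<close>

lemma pairing_add_left: "pairing (u + v) x = pairing u x + pairing v x"
  by transfer (simp add: blinfun.bilinear_simps)

lemma pairing_scaleC_left: "pairing (c *\<^sub>C u) x = c * pairing u x"
  by transfer simp

lemma pairing_add_right: "pairing u (x + y) = pairing u x + pairing u y"
  by transfer (simp add: blinfun.bilinear_simps)

lemma pairing_scaleC_right: "pairing u (c *\<^sub>C x) = cnj c * pairing u x"
  by transfer simp

lemma pairing_bound: "cmod (pairing u x) \<le> norm u * norm x"
  by transfer (rule norm_blinfun)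

interpretation pairing: bounded_bilinear pairing
proof
  show "\<exists>K. \<forall>a b. norm (pairing a b) \<le> norm a * norm b * K"
    by (intro exI[of _ 1]) (simp add: pairing_bound)
qed (simp_all add: pairing_add_left pairing_add_right scaleR_scaleC pairing_scaleC_left
      pairing_scaleC_right scaleR_conv_of_real)

lemma bounded_clinearD:
  assumes "bounded_clinear f"
  shows "bounded_linear f" "f (c *\<^sub>C x) = c *\<^sub>C f x"
  using assms by (auto simp: bounded_clinear_def)

text \<open>
  The part of the hypotheses on \<open>\<A>\<close> and \<open>\<A>\<^sup>*\<close> that concerns the positive half-line; it is
  shared by the two operators.
\<close>

locale positive_resolvent =
  fixes \<iota> B :: "'x::complex_hilbert \<Rightarrow> 'y::complex_hilbert" and c\<^sub>0 c\<^sub>1 M :: real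
  assumes \<iota>: "bounded_clinear \<iota>" and B: "bounded_clinear B"
    and pos: "c\<^sub>0 > 0" "c\<^sub>1 > 0" "M > 0"
    and lower: "\<And>v. c\<^sub>0 * norm v \<le> norm (B v)" and upper: "\<And>v. norm (B v) \<le> c\<^sub>1 * norm v"
    and bij: "\<And>r. r > 0 \<Longrightarrow> bij (\<lambda>x. complex_of_real r *\<^sub>C \<iota> x - B x)"
    and resolvent_bound:
      "\<And>r y. r > 0 \<Longrightarrow> norm (resolvent \<iota> B (complex_of_real r) y) \<le> M / (1 + r) * norm y"
begin

sublocale \<iota>: bounded_linear \<iota> by (rule bounded_clinearD[OF \<iota>])
sublocale B: bounded_linear B by (rule bounded_clinearD[OF B])

text \<open>The resolvent with values in \<open>X\<close>, not yet embedded into \<open>Y\<close>.\<close>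

definition res :: "real \<Rightarrow> 'y \<Rightarrow> 'x" where
  "res r = inv (\<lambda>x. complex_of_real r *\<^sub>C \<iota> x - B x)"

lemma res_right: "r > 0 \<Longrightarrow> r *\<^sub>R \<iota> (res r y) - B (res r y) = y"
  unfolding res_def scaleR_scaleC by (rule surj_f_inv_f) (simp add: bij bij_is_surj)

lemma res_eqI: "r > 0 \<Longrightarrow> r *\<^sub>R \<iota> x - B x = y \<Longrightarrow> res r y = x"
  unfolding res_def scaleR_scaleC by (rule inv_f_eq) (simp_all add: bij bij_is_inj)

lemma norm_\<iota>_res: "r > 0 \<Longrightarrow> norm (\<iota> (res r y)) \<le> M / (1 + r) * norm y"
  using resolvent_bound[of r y] by (simp add: res_def resolvent_def)

lemma norm_\<iota>_res':
  assumes "r > 0" shows "r * norm (\<iota> (res r y)) \<le> M * norm y"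
proof -
  have "r * norm (\<iota> (res r y)) \<le> r * (M / (1 + r) * norm y)"
    using norm_\<iota>_res[OF assms] assms by (intro mult_left_mono) auto
  also have "\<dots> = (r / (1 + r)) * (M * norm y)" by simp
  also have "\<dots> \<le> 1 * (M * norm y)"
    using assms pos by (intro mult_right_mono) auto
  finally show ?thesis by simp
qed

text \<open>\<open>B\<close> is bounded below on \<open>X\<close>, and \<open>B \<circ> res r = r \<iota> \<circ> res r - 1\<close> is bounded on \<open>Y\<close>.\<close>

lemma norm_res:
  assumes "r > 0"
  shows "norm (res r y) \<le> norm y * ((M + 1) / c\<^sub>0)"
proof -
  have "c\<^sub>0 * norm (res r y) \<le> norm (r *\<^sub>R \<iota> (res r y) - y)"
    using lower[of "res r y"] by (subst (3) res_right[OF assms, of y, symmetric]) simp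
  also have "\<dots> \<le> norm (r *\<^sub>R \<iota> (res r y)) + norm y" by (rule norm_triangle_ineq4)
  also have "\<dots> \<le> M * norm y + norm y"
    using norm_\<iota>_res'[OF assms, of y] assms by simp
  finally show ?thesis using pos by (simp add: field_simps)
qed

lemma bounded_clinear_res:
  assumes "r > 0"
  shows "bounded_clinear (res r)"
  unfolding bounded_clinear_def
proof (intro conjI allI bounded_linear_intro[where K = "(M + 1) / c\<^sub>0"])
  show sc: "res r (c *\<^sub>C y) = c *\<^sub>C res r y" for c y
  proof (rule res_eqI[OF assms])
    have "r *\<^sub>R \<iota> (c *\<^sub>C res r y) - B (c *\<^sub>C res r y) = c *\<^sub>C (r *\<^sub>R \<iota> (res r y) - B (res r y))"
      by (simp add: bounded_clinearD[OF \<iota>] bounded_clinearD[OF B] scaleC_diff_right scaleR_scaleC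
          scaleC_scaleC mult.commute)
    then show "r *\<^sub>R \<iota> (c *\<^sub>C res r y) - B (c *\<^sub>C res r y) = c *\<^sub>C y"
      by (simp add: res_right[OF assms])
  qed
  show "res r (x + y) = res r x + res r y" for x y
    using res_right[OF assms, of x] res_right[OF assms, of y]
    by (intro res_eqI[OF assms]) (simp add: \<iota>.add B.add algebra_simps)
  show "res r (s *\<^sub>R x) = s *\<^sub>R res r x" for s x
    by (simp add: scaleR_scaleC sc)
  show "norm (res r y) \<le> norm y * ((M + 1) / c\<^sub>0)" for y by (rule norm_res[OF assms])
qed

text \<open>Apply \<open>\<iota>\<close> to \<open>res r (r \<iota> x - B x) = x\<close> and compare with \<open>(r \<iota> - B) (res r (\<iota> x)) = \<iota> x\<close>.\<close>

lemma B_res: "r > 0 \<Longrightarrow> B (res r (\<iota> x)) = \<iota> (res r (B x))"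
proof -
  assume r: "r > 0"
  interpret res: bounded_linear "res r" using bounded_clinear_res[OF r] by (rule bounded_clinearD)
  have "r *\<^sub>R res r (\<iota> x) - res r (B x) = x"
    using res_eqI[OF r refl, of x] by (simp add: res.diff res.scaleR)
  then have "r *\<^sub>R \<iota> (res r (\<iota> x)) - \<iota> (res r (B x)) = \<iota> x"
    by (metis \<iota>.diff \<iota>.scaleR)
  with res_right[OF r, of "\<iota> x"] have "B (res r (\<iota> x)) - \<iota> (res r (B x)) = 0"
    by (simp add: algebra_simps)
  then show ?thesis by simp
qed

text \<open>
  Regularizing operators \<open>Y \<rightarrow> X\<close> that are uniformly bounded on \<open>X\<close> and on \<open>Y\<close> and converge
  to the identity on \<open>X\<close>.
\<close>

definition reg :: "nat \<Rightarrow> 'y \<Rightarrow> 'x" where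
  "reg n y = real (Suc n) *\<^sub>R res (real (Suc n)) y"

lemma bounded_clinear_reg: "bounded_clinear (reg n)"
proof -
  have r: "bounded_clinear (res (real (Suc n)))" by (rule bounded_clinear_res) simp
  have "bounded_linear (reg n)"
    unfolding reg_def[abs_def]
    by (rule bounded_linear_compose[OF bounded_linear_scaleR_right bounded_clinearD(1)[OF r]])
  moreover have "reg n (c *\<^sub>C x) = c *\<^sub>C reg n x" for c x
    by (simp only: reg_def bounded_clinearD[OF r] scaleR_scaleC scaleC_scaleC mult.commute)
  ultimately show ?thesis by (simp add: bounded_clinear_def)
qed

lemma norm_\<iota>_reg: "norm (\<iota> (reg n y)) \<le> M * norm y"
  using norm_\<iota>_res'[of "real (Suc n)" y] by (simp add: reg_def \<iota>.scaleR)

lemma B_reg: "B (reg n (\<iota> x)) = \<iota> (reg n (B x))"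
  by (simp add: reg_def B.scaleR \<iota>.scaleR B_res)

lemma norm_reg_\<iota>: "norm (reg n (\<iota> x)) \<le> M * c\<^sub>1 / c\<^sub>0 * norm x"
proof -
  have "c\<^sub>0 * norm (reg n (\<iota> x)) \<le> M * norm (B x)"
    using lower[of "reg n (\<iota> x)"] norm_\<iota>_reg[of n "B x"] by (simp add: B_reg)
  also have "\<dots> \<le> M * (c\<^sub>1 * norm x)" using upper pos by (intro mult_left_mono) auto
  finally show ?thesis using pos by (simp add: field_simps)
qed

end

text \<open>
  On \<open>X\<close> the convergence has a rate, because \<open>r res r - 1 = res r \<circ> B\<close> there; density and the
  uniform bounds give convergence in \<open>Y\<close>, and applying this to \<open>B x\<close> gives convergence in \<open>X\<close>.
\<close>

locale dense_positive_resolvent = positive_resolvent +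
  assumes dense: "closure (range \<iota>) = UNIV"
begin

lemma \<iota>_reg_tendsto: "(\<lambda>n. \<iota> (reg n y)) \<longlonglongrightarrow> y"
proof (rule LIMSEQ_I)
  fix e :: real assume "e > 0"
  define e' where "e' = e / (2 * (M + 1))"
  have "e' > 0" using \<open>e > 0\<close> pos by (simp add: e'_def)
  have "y \<in> closure (range \<iota>)" using dense by simp
  then obtain w where w: "norm (\<iota> w - y) < e'"
    using \<open>e' > 0\<close> by (auto simp: closure_approachable dist_norm)
  have rate: "norm (\<iota> (reg n (\<iota> w)) - \<iota> w) \<le> M / real (Suc n) * norm (B w)" for n
  proof -
    have "\<iota> (reg n (\<iota> w)) - \<iota> w = \<iota> (res (real (Suc n)) (B w))"
      using res_right[of "real (Suc n)" "\<iota> w"] B_res[of "real (Suc n)" w]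
      by (simp add: reg_def \<iota>.scaleR \<iota>.add algebra_simps)
    moreover have "M / (1 + real (Suc n)) * norm (B w) \<le> M / real (Suc n) * norm (B w)"
      using pos by (intro mult_right_mono divide_left_mono) auto
    ultimately show ?thesis using norm_\<iota>_res[of "real (Suc n)" "B w"] by simp
  qed
  have "(\<lambda>n. M * norm (B w) * inverse (real (Suc n))) \<longlonglongrightarrow> M * norm (B w) * 0"
    by (intro tendsto_intros LIMSEQ_inverse_real_of_nat)
  then have "\<forall>\<^sub>F n in sequentially. M * norm (B w) * inverse (real (Suc n)) < e / 2"
    using \<open>e > 0\<close> by (intro order_tendstoD) auto
  then obtain n0 where n0: "\<And>n. n \<ge> n0 \<Longrightarrow> M * norm (B w) * inverse (real (Suc n)) < e / 2"
    by (auto simp: eventually_sequentially)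
  have "norm (\<iota> (reg n y) - y) < e" if "n \<ge> n0" for n
  proof -
    interpret reg: bounded_linear "reg n" by (rule bounded_clinearD[OF bounded_clinear_reg])
    have "\<iota> (reg n y) - y = (\<iota> (reg n (\<iota> w)) - \<iota> w) + (\<iota> w - y) - \<iota> (reg n (\<iota> w - y))"
      by (simp add: reg.diff \<iota>.diff)
    also have "norm \<dots> \<le> norm (\<iota> (reg n (\<iota> w)) - \<iota> w) + norm (\<iota> w - y) + norm (\<iota> (reg n (\<iota> w - y)))"
      by norm
    also have "\<dots> \<le> M / real (Suc n) * norm (B w) + norm (\<iota> w - y) + M * norm (\<iota> w - y)"
      by (intro add_mono rate norm_\<iota>_reg order_refl)
    also have "\<dots> = M * norm (B w) * inverse (real (Suc n)) + (M + 1) * norm (\<iota> w - y)"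
      by (simp add: field_simps)
    also have "\<dots> < e / 2 + (M + 1) * e'"
      using n0[OF that] w pos by (intro add_strict_mono mult_strict_left_mono) auto
    also have "\<dots> = e" using pos by (simp add: e'_def field_simps)
    finally show ?thesis .
  qed
  then show "\<exists>no. \<forall>n\<ge>no. norm (\<iota> (reg n y) - y) < e" by blast
qed

lemma reg_tendsto: "(\<lambda>n. reg n (\<iota> x)) \<longlonglongrightarrow> x"
proof -
  have "(\<lambda>n. inverse c\<^sub>0 * norm (\<iota> (reg n (B x)) - B x)) \<longlonglongrightarrow> inverse c\<^sub>0 * norm (B x - B x)"
    by (intro tendsto_intros \<iota>_reg_tendsto)
  then have lim: "(\<lambda>n. inverse c\<^sub>0 * norm (\<iota> (reg n (B x)) - B x)) \<longlonglongrightarrow> 0" by simp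
  have "norm (reg n (\<iota> x) - x) \<le> inverse c\<^sub>0 * norm (\<iota> (reg n (B x)) - B x)" for n
    using lower[of "reg n (\<iota> x) - x"] pos by (simp add: B.diff B_reg field_simps)
  then have "(\<lambda>n. reg n (\<iota> x) - x) \<longlonglongrightarrow> 0"
    by (intro Lim_null_comparison[OF _ lim] always_eventually) auto
  then show ?thesis by (simp add: LIM_zero_iff)
qed

section \<open>Duality of the interpolation spaces\<close>

text \<open>
  The pairing of \<open>f z \<in> X\<^sup>*\<close> with \<open>g z \<in> Y\<close> makes no sense inside the strip; that of \<open>f z\<close> with
  the regularization of \<open>g (cnj z)\<close> does, is holomorphic since the pairing is conjugate-linear
  in its second argument, and has boundary values that are bounded uniformly in \<open>n\<close>.
\<close>

lemma interp_fun_pairing_bound: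
  assumes f: "interp_fun (\<lambda>u. u) (dual_op \<iota>) f f0 f1" and g: "interp_fun \<iota> (\<lambda>y. y) g g0 g1"
    and gx: "g (complex_of_real \<theta>) = \<iota> x" and \<theta>: "0 < \<theta>" "\<theta> < 1"
    and F: "\<And>t. norm (f0 t) \<le> F" "\<And>t. norm (f1 t) \<le> F"
    and G: "\<And>t. norm (g0 t) \<le> G" "\<And>t. norm (g1 t) \<le> G"
  shows "cmod (pairing (f (complex_of_real \<theta>)) x) \<le> (M * c\<^sub>1 / c\<^sub>0 + M) * F * G"
proof -
  let ?S = "{z. 0 \<le> Re z \<and> Re z \<le> 1}"
  let ?C = "M * c\<^sub>1 / c\<^sub>0 + M"
  have F0: "F \<ge> 0" and G0: "G \<ge> 0" using F(1)[of 0] G(1)[of 0] norm_ge_zero order_trans by blast+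
  have C: "M * c\<^sub>1 / c\<^sub>0 \<le> ?C" "M \<le> ?C" using pos by auto
  have cnj_S: "cnj ` ?S \<subseteq> ?S" by auto
  have bound: "cmod (pairing (f (complex_of_real \<theta>)) (reg n (\<iota> x))) \<le> ?C * F * G" for n
  proof -
    interpret reg: bounded_linear "reg n" by (rule bounded_clinearD[OF bounded_clinear_reg])
    define \<psi> where "\<psi> z = pairing (f z) (reg n (g (cnj z)))" for z
    obtain bf where bf: "\<And>z. z \<in> ?S \<Longrightarrow> norm (f z) \<le> bf"
      using f by (auto simp: interp_fun_def bounded_iff)
    obtain bg where bg: "\<And>z. z \<in> ?S \<Longrightarrow> norm (g z) \<le> bg"
      using g by (auto simp: interp_fun_def bounded_iff)
    obtain K where K: "\<And>y. norm (reg n y) \<le> norm y * K" "K \<ge> 0"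
      using reg.nonneg_bounded by blast
    have "cmod (\<psi> (complex_of_real \<theta>)) \<le> ?C * F * G"
    proof (rule strip_maximum_principle[where f = \<psi>])
      show "continuous_on ?S \<psi>"
        unfolding \<psi>_def using f g cnj_S
        by (intro pairing.continuous_on reg.continuous_on
            continuous_on_compose2[where s = ?S and g = g and f = cnj] continuous_intros)
          (auto simp: interp_fun_def)
      have "cmod (\<psi> z) \<le> bf * (bg * K)" if "z \<in> ?S" for z
      proof -
        have "norm (reg n (g (cnj z))) \<le> bg * K"
          using K(1)[of "g (cnj z)"] mult_right_mono[OF bg[of "cnj z"] K(2)] that by force
        with bf[OF that] have "norm (f z) * norm (reg n (g (cnj z))) \<le> bf * (bg * K)"
          by (intro mult_mono) (auto intro: order_trans[OF norm_ge_zero])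
        with pairing_bound[of "f z" "reg n (g (cnj z))"] show ?thesis by (simp add: \<psi>_def)
      qed
      then show "bounded (\<psi> ` ?S)" by (auto simp: bounded_iff)
      show "\<psi> holomorphic_on {z. 0 < Re z \<and> Re z < 1}"
      proof (rule holomorphic_onI)
        fix z :: complex assume "z \<in> {z. 0 < Re z \<and> Re z < 1}"
        then have z: "0 < Re z" "Re z < 1" by auto
        obtain d where d: "(f has_derivative (\<lambda>h. h *\<^sub>C d)) (at z)"
          using f z by (auto simp: interp_fun_def)
        obtain d' where d': "(g has_derivative (\<lambda>h. h *\<^sub>C d')) (at (cnj z))"
          using g z unfolding interp_fun_def by (metis cnj.simps(1))
        have "((\<lambda>z. g (cnj z)) has_derivative (\<lambda>h. cnj h *\<^sub>C d')) (at z)"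
          using has_derivative_compose[OF bounded_linear_imp_has_derivative[OF bounded_linear_cnj] d'] .
        then have "((\<lambda>z. reg n (g (cnj z))) has_derivative (\<lambda>h. reg n (cnj h *\<^sub>C d'))) (at z)"
          by (rule reg.has_derivative)
        from pairing.FDERIV[OF d this]
        have "(\<psi> has_derivative
            (\<lambda>h. pairing (f z) (reg n (cnj h *\<^sub>C d')) + pairing (h *\<^sub>C d) (reg n (g (cnj z))))) (at z)"
          unfolding \<psi>_def .
        moreover have "(\<lambda>h. pairing (f z) (reg n (cnj h *\<^sub>C d')) + pairing (h *\<^sub>C d) (reg n (g (cnj z))))
            = (*) (pairing (f z) (reg n d') + pairing d (reg n (g (cnj z))))"
          by (auto simp: bounded_clinearD[OF bounded_clinear_reg] pairing_scaleC_left
              pairing_scaleC_right algebra_simps)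
        ultimately have "(\<psi> has_field_derivative
            (pairing (f z) (reg n d') + pairing d (reg n (g (cnj z))))) (at z)"
          by (simp add: has_field_derivative_def)
        then show "\<psi> field_differentiable at z within {z. 0 < Re z \<and> Re z < 1}"
          using field_differentiable_at_within field_differentiable_def by blast
      qed
      show "cmod (\<psi> (Complex 0 t)) \<le> ?C * F * G" for t
      proof -
        have "\<psi> (Complex 0 t) = pairing (f0 t) (reg n (\<iota> (g0 (- t))))"
          using f g by (simp add: \<psi>_def interp_fun_def complex_cnj)
        also have "cmod \<dots> \<le> norm (f0 t) * norm (reg n (\<iota> (g0 (- t))))" by (rule pairing_bound)
        also have "\<dots> \<le> F * (M * c\<^sub>1 / c\<^sub>0 * norm (g0 (- t)))"
          using F F0 by (intro mult_mono norm_reg_\<iota>) auto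
        also have "\<dots> \<le> F * (?C * G)"
          using C G F0 G0 pos by (intro mult_mono mult_left_mono) auto
        finally show ?thesis by (simp add: mult_ac)
      qed
      show "cmod (\<psi> (Complex 1 t)) \<le> ?C * F * G" for t
      proof -
        have "\<psi> (Complex 1 t) = cinner (f1 t) (\<iota> (reg n (g1 (- t))))"
          using f g by (simp add: \<psi>_def interp_fun_def complex_cnj pairing_dual_op[OF \<iota>])
        also have "cmod \<dots> \<le> norm (f1 t) * norm (\<iota> (reg n (g1 (- t))))" by (rule cmod_cinner_le)
        also have "\<dots> \<le> F * (M * norm (g1 (- t)))"
          using F F0 by (intro mult_mono norm_\<iota>_reg) auto
        also have "\<dots> \<le> F * (?C * G)"
          using C G F0 G0 pos by (intro mult_mono mult_left_mono) auto
        finally show ?thesis by (simp add: mult_ac)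
      qed
    qed (use \<theta> in auto)
    then show ?thesis by (simp add: \<psi>_def gx)
  qed
  have "(\<lambda>n. cmod (pairing (f (complex_of_real \<theta>)) (reg n (\<iota> x))))
      \<longlonglongrightarrow> cmod (pairing (f (complex_of_real \<theta>)) x)"
    by (intro tendsto_norm pairing.tendsto tendsto_const reg_tendsto)
  then show ?thesis
    by (rule LIMSEQ_le_const2) (use bound in auto)
qed

end

lemma interp_space_one [simp]: "interp_space i0 i1 1 = range i1"
  by (simp add: interp_space_def)

lemma norm_le_SUP_norm:
  fixes k :: "real \<Rightarrow> 'e::real_normed_vector"
  assumes "bounded (range k)"
  shows "norm (k t) \<le> (SUP t. norm (k t))"
proof (rule cSUP_upper[OF UNIV_I])
  show "bdd_above (range (\<lambda>t. norm (k t)))"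
    using assms by (auto simp: bounded_iff bdd_above_def)
qed

text \<open>
  For \<open>0 < \<theta> < 1\<close> the norm is an infimum over the extensions to the strip. At \<open>\<theta> = 1\<close> it is the
  norm of the right end point, and each estimate needs a separate argument there.
\<close>

lemma interp_norm_lessE:
  assumes u: "u \<in> interp_space i0 i1 \<theta>" and \<theta>: "0 < \<theta>" "\<theta> < 1" and N: "interp_norm i0 i1 \<theta> u < N"
  obtains f f0 f1 where "interp_fun i0 i1 f f0 f1" "f (complex_of_real \<theta>) = u"
    "\<And>t. norm (f0 t) \<le> N" "\<And>t. norm (f1 t) \<le> N"
proof -
  let ?S = "{max (SUP t. norm (f0 t)) (SUP t. norm (f1 t)) | f f0 f1.
                interp_fun i0 i1 f f0 f1 \<and> f (complex_of_real \<theta>) = u}"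
  have "?S \<noteq> {}" using u \<theta> by (auto simp: interp_space_def)
  moreover have "Inf ?S < N" using N \<theta> by (simp add: interp_norm_def)
  ultimately have "\<exists>s\<in>?S. s < N" by (rule cInf_lessD)
  then obtain s where s: "s \<in> ?S" "s < N" by (rule bexE)
  from s(1) obtain f f0 f1 where f: "interp_fun i0 i1 f f0 f1" "f (complex_of_real \<theta>) = u"
    and max: "s = max (SUP t. norm (f0 t)) (SUP t. norm (f1 t))"
    unfolding mem_Collect_eq by (elim exE conjE) (rule that)
  from s(2) have less: "max (SUP t. norm (f0 t)) (SUP t. norm (f1 t)) < N" by (simp only: max)
  from less have less: "(SUP t. norm (f0 t)) < N" "(SUP t. norm (f1 t)) < N" by simp_all
  have "bounded (range f0)" "bounded (range f1)" using f(1) by (auto simp: interp_fun_def)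
  then have "norm (f0 t) \<le> N" "norm (f1 t) \<le> N" for t
    using norm_le_SUP_norm[of f0 t] norm_le_SUP_norm[of f1 t] less by linarith+
  with f show ?thesis by (rule that)
qed

lemma SUP_boundary_nonneg:
  assumes "interp_fun i0 i1 g g0 g1"
  shows "0 \<le> max (SUP t. norm (g0 t)) (SUP t. norm (g1 t))"
proof -
  have "norm (g0 0) \<le> (SUP t. norm (g0 t))"
    using assms by (intro norm_le_SUP_norm) (simp add: interp_fun_def)
  then show ?thesis using norm_ge_zero[of "g0 0"] by linarith
qed

lemma interp_norm_nonneg:
  assumes "u \<in> interp_space i0 i1 \<theta>" "0 < \<theta>" "\<theta> \<le> 1"
  shows "0 \<le> interp_norm i0 i1 \<theta> u"
proof (cases "\<theta> = 1")
  case False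
  let ?S = "{max (SUP t. norm (f0 t)) (SUP t. norm (f1 t)) | f f0 f1.
                interp_fun i0 i1 f f0 f1 \<and> f (complex_of_real \<theta>) = u}"
  have "?S \<noteq> {}" using assms False by (auto simp: interp_space_def)
  then have "0 \<le> Inf ?S" by (rule cInf_greatest) (use SUP_boundary_nonneg in blast)
  with False assms show ?thesis by (simp add: interp_norm_def)
qed (simp add: interp_norm_def)

lemma interp_norm_le:
  assumes f: "interp_fun i0 i1 f f0 f1" and \<theta>: "0 < \<theta>" "\<theta> < 1"
    and N: "\<And>t. norm (f0 t) \<le> N" "\<And>t. norm (f1 t) \<le> N"
  shows "interp_norm i0 i1 \<theta> (f (complex_of_real \<theta>)) \<le> N"
proof -
  let ?S = "{max (SUP t. norm (g0 t)) (SUP t. norm (g1 t)) | g g0 g1.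
                interp_fun i0 i1 g g0 g1 \<and> g (complex_of_real \<theta>) = f (complex_of_real \<theta>)}"
  have "bdd_below ?S" using SUP_boundary_nonneg by (fastforce simp: bdd_below_def)
  moreover have "max (SUP t. norm (f0 t)) (SUP t. norm (f1 t)) \<in> ?S" using f by blast
  ultimately have "Inf ?S \<le> max (SUP t. norm (f0 t)) (SUP t. norm (f1 t))" by (rule cInf_lower[rotated])
  also have "\<dots> \<le> N" using N by (auto intro!: cSUP_least)
  finally show ?thesis using \<theta> by (simp add: interp_norm_def)
qed

context dense_positive_resolvent
begin

lemma inj_dual_op: "inj (dual_op \<iota>)"
proof (rule injI)
  fix u v assume "dual_op \<iota> u = dual_op \<iota> v"
  then have eq: "cinner u (\<iota> x) = cinner v (\<iota> x)" for x
    using pairing_dual_op[OF \<iota>, of u x] pairing_dual_op[OF \<iota>, of v x] by simp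
  have "closure (range \<iota>) \<subseteq> {w. cinner u w = cinner v w}"
    using eq by (intro closure_minimal closed_Collect_eq cinner.continuous_on continuous_intros) auto
  then show "u = v" using dense by (intro cinner_eqI) auto
qed

lemma pairing_interp_bound:
  assumes u: "u \<in> interp_XdY \<iota> \<theta>" and x: "\<iota> x \<in> interp_XY \<iota> \<theta>" and \<theta>: "0 < \<theta>" "\<theta> \<le> 1"
  shows "cmod (pairing u x)
    \<le> (M * c\<^sub>1 / c\<^sub>0 + M + 1) * interp_XdY_norm \<iota> \<theta> u * interp_XY_norm \<iota> \<theta> (\<iota> x)"
proof (cases "\<theta> = 1")
  case True
  with u obtain v where v: "u = dual_op \<iota> v" by auto
  have "cmod (pairing u x) = cmod (cinner v (\<iota> x))" by (simp add: v pairing_dual_op[OF \<iota>])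
  also have "\<dots> \<le> 1 * (norm v * norm (\<iota> x))" by (simp add: cmod_cinner_le)
  also have "\<dots> \<le> (M * c\<^sub>1 / c\<^sub>0 + M + 1) * (norm v * norm (\<iota> x))"
    using pos by (intro mult_right_mono) auto
  also have "\<dots> = (M * c\<^sub>1 / c\<^sub>0 + M + 1) * interp_XdY_norm \<iota> \<theta> u * interp_XY_norm \<iota> \<theta> (\<iota> x)"
    using True by (simp add: interp_norm_def v inv_f_f[OF inj_dual_op] inv_f_f[of "\<lambda>y. y"])
  finally show ?thesis .
next
  case False
  with \<theta> have \<theta>': "0 < \<theta>" "\<theta> < 1" by auto
  let ?C = "M * c\<^sub>1 / c\<^sub>0 + M + 1"
  let ?a = "interp_XdY_norm \<iota> \<theta> u" and ?b = "interp_XY_norm \<iota> \<theta> (\<iota> x)"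
  have le: "cmod (pairing u x) \<le> ?C * (?a + e) * (?b + e)" if "e > 0" for e
  proof -
    have "?a < ?a + e" "?b < ?b + e" using that by auto
    obtain f f0 f1 where f: "interp_fun (\<lambda>u. u) (dual_op \<iota>) f f0 f1" "f (complex_of_real \<theta>) = u"
      "\<And>t. norm (f0 t) \<le> ?a + e" "\<And>t. norm (f1 t) \<le> ?a + e"
      using interp_norm_lessE[OF u \<theta>' \<open>?a < ?a + e\<close>] by metis
    obtain g g0 g1 where g: "interp_fun \<iota> (\<lambda>y. y) g g0 g1" "g (complex_of_real \<theta>) = \<iota> x"
      "\<And>t. norm (g0 t) \<le> ?b + e" "\<And>t. norm (g1 t) \<le> ?b + e"
      using interp_norm_lessE[OF x \<theta>' \<open>?b < ?b + e\<close>] by metis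
    have "?a + e \<ge> 0" "?b + e \<ge> 0"
      using f(3)[of 0] g(3)[of 0] norm_ge_zero order_trans by blast+
    then have "(M * c\<^sub>1 / c\<^sub>0 + M) * (?a + e) * (?b + e) \<le> ?C * (?a + e) * (?b + e)"
      by (intro mult_right_mono) auto
    with interp_fun_pairing_bound[OF f(1) g(1,2) \<theta>' f(3,4) g(3,4)] f(2) show ?thesis by simp
  qed
  have "((\<lambda>e. ?C * (?a + e) * (?b + e)) \<longlongrightarrow> ?C * (?a + 0) * (?b + 0)) (at_right 0)"
    by (intro tendsto_intros)
  moreover have "\<forall>\<^sub>F e in at_right 0. cmod (pairing u x) \<le> ?C * (?a + e) * (?b + e)"
    using le by (intro eventually_mono[OF eventually_at_right_less])
  ultimately have "cmod (pairing u x) \<le> ?C * (?a + 0) * (?b + 0)"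
    by (rule tendsto_lowerbound) simp
  then show ?thesis by simp
qed

lemma \<iota>_interp:
  assumes \<theta>: "0 < \<theta>" "\<theta> \<le> 1"
  shows "\<iota> x \<in> interp_XY \<iota> \<theta>" and "interp_XY_norm \<iota> \<theta> (\<iota> x) \<le> (1 + onorm \<iota>) * norm x"
proof -
  have o: "norm (\<iota> x) \<le> onorm \<iota> * norm x" by (rule onorm) (rule \<iota>.bounded_linear_axioms)
  have o0: "0 \<le> onorm \<iota>" by (rule onorm_pos_le) (rule \<iota>.bounded_linear_axioms)
  \<comment> \<open>a constant function is an extension\<close>
  have f: "interp_fun \<iota> (\<lambda>y. y) (\<lambda>z. \<iota> x) (\<lambda>t. x) (\<lambda>t. \<iota> x)"
    unfolding interp_fun_def by (auto intro!: exI[of _ "0::'b"] simp: bounded_iff)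
  have N: "norm x \<le> (1 + onorm \<iota>) * norm x" "norm (\<iota> x) \<le> (1 + onorm \<iota>) * norm x"
    using o mult_nonneg_nonneg[OF o0 norm_ge_zero[of x]] norm_ge_zero[of x]
    unfolding distrib_right by linarith+
  show "\<iota> x \<in> interp_XY \<iota> \<theta>"
  proof (cases "\<theta> = 1")
    case False
    have "\<exists>f f0 f1. \<iota> x = f (complex_of_real \<theta>) \<and> interp_fun \<iota> (\<lambda>y. y) f f0 f1"
      by (rule exI[of _ "\<lambda>z. \<iota> x"]) (use f in blast)
    with False \<theta> show ?thesis by (simp add: interp_space_def)
  qed simp
  show "interp_XY_norm \<iota> \<theta> (\<iota> x) \<le> (1 + onorm \<iota>) * norm x"
  proof (cases "\<theta> = 1")
    case True
    then show ?thesis using N(2) by (simp add: interp_norm_def inv_f_f[of "\<lambda>y. y"])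
  next
    case False
    with interp_norm_le[OF f, of \<theta>] N \<theta> show ?thesis by auto
  qed
qed

text \<open>
  By the bound of the pairing, convergence in \<open>[X, Y]\<^sub>\<theta>\<close> of a sequence in \<open>X\<close> to an element of \<open>X\<close>
  implies convergence of the pairings, so the continuous extension agrees with the pairing on \<open>X\<close>.
\<close>

lemma interp_pairing_\<iota>:
  assumes u: "u \<in> interp_XdY \<iota> \<theta>" and \<theta>: "0 < \<theta>" "\<theta> \<le> 1"
  shows "interp_pairing \<iota> \<theta> u (\<iota> p) = pairing u p"
  unfolding interp_pairing_def
proof (rule the_equality)
  let ?C = "(M * c\<^sub>1 / c\<^sub>0 + M + 1) * interp_XdY_norm \<iota> \<theta> u"
  show "\<forall>x. (\<forall>n. \<iota> (x n) - \<iota> p \<in> interp_XY \<iota> \<theta>) \<and>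
      (\<lambda>n. interp_XY_norm \<iota> \<theta> (\<iota> (x n) - \<iota> p)) \<longlonglongrightarrow> 0 \<longrightarrow> (\<lambda>n. pairing u (x n)) \<longlonglongrightarrow> pairing u p"
  proof (intro allI impI, elim conjE)
    fix x assume x: "\<forall>n. \<iota> (x n) - \<iota> p \<in> interp_XY \<iota> \<theta>"
      and lim: "(\<lambda>n. interp_XY_norm \<iota> \<theta> (\<iota> (x n) - \<iota> p)) \<longlonglongrightarrow> 0"
    have "cmod (pairing u (x n) - pairing u p) \<le> ?C * interp_XY_norm \<iota> \<theta> (\<iota> (x n) - \<iota> p)" for n
      using pairing_interp_bound[OF u _ \<theta>, of "x n - p"] x by (simp add: \<iota>.diff pairing.diff_right)
    moreover have "(\<lambda>n. ?C * interp_XY_norm \<iota> \<theta> (\<iota> (x n) - \<iota> p)) \<longlonglongrightarrow> 0"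
      using tendsto_mult_right_zero[OF lim] .
    ultimately have "(\<lambda>n. pairing u (x n) - pairing u p) \<longlonglongrightarrow> 0"
      by (intro Lim_null_comparison[OF _ \<open>(\<lambda>n. ?C * _ n) \<longlonglongrightarrow> 0\<close>] always_eventually) auto
    then show "(\<lambda>n. pairing u (x n)) \<longlonglongrightarrow> pairing u p" by (simp add: LIM_zero_iff)
  qed
next
  \<comment> \<open>the constant sequence \<open>p\<close> is admitted and determines the limit\<close>
  fix c
  assume *: "\<forall>x. (\<forall>n. \<iota> (x n) - \<iota> p \<in> interp_XY \<iota> \<theta>) \<and>
      (\<lambda>n. interp_XY_norm \<iota> \<theta> (\<iota> (x n) - \<iota> p)) \<longlonglongrightarrow> 0 \<longrightarrow> (\<lambda>n. pairing u (x n)) \<longlonglongrightarrow> c"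
  have "(0::'b) \<in> interp_XY \<iota> \<theta>" using \<iota>_interp(1)[OF \<theta>, of 0] by (simp add: \<iota>.zero)
  then have "interp_XY_norm \<iota> \<theta> (0::'b) = 0"
    using \<iota>_interp(2)[OF \<theta>, of 0] interp_norm_nonneg[OF \<open>0 \<in> interp_XY \<iota> \<theta>\<close> \<theta>]
    by (simp add: \<iota>.zero)
  with \<open>0 \<in> interp_XY \<iota> \<theta>\<close> have "(\<lambda>n. pairing u p) \<longlonglongrightarrow> c"
    using *[rule_format, of "\<lambda>n. p"] by simp
  then show "c = pairing u p" by (simp add: LIMSEQ_const_iff)
qed

lemma into_interp_bounded:
  assumes R: "bounded_clinear_into_interp \<iota> \<theta> R" and \<theta>: "0 < \<theta>" "\<theta> \<le> 1"
  obtains C where "C \<ge> 0" "\<And>z x. cmod (pairing (R z) x) \<le> C * norm z * norm x"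
proof -
  let ?C = "M * c\<^sub>1 / c\<^sub>0 + M + 1" and ?K = "1 + onorm \<iota>"
  have range: "R z \<in> interp_XdY \<iota> \<theta>" for z
    using R by (auto simp: bounded_clinear_into_interp_def)
  have "\<exists>C. \<forall>z. interp_XdY_norm \<iota> \<theta> (R z) \<le> C * norm z"
    using R by (simp add: bounded_clinear_into_interp_def)
  then obtain C where C: "\<forall>z. interp_XdY_norm \<iota> \<theta> (R z) \<le> C * norm z" by (rule exE)
  have C0: "?C \<ge> 0" using pos by (intro add_nonneg_nonneg) auto
  have K0: "?K \<ge> 0" using onorm_pos_le[OF \<iota>.bounded_linear_axioms] by simp
  have "cmod (pairing (R z) x) \<le> (?C * \<bar>C\<bar> * ?K) * norm z * norm x" for z x
  proof -
    have a: "interp_XdY_norm \<iota> \<theta> (R z) \<le> \<bar>C\<bar> * norm z"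
      using C[rule_format, of z] mult_right_mono[OF abs_ge_self norm_ge_zero, of C z] by linarith
    have "cmod (pairing (R z) x)
      \<le> ?C * interp_XdY_norm \<iota> \<theta> (R z) * interp_XY_norm \<iota> \<theta> (\<iota> x)"
      by (rule pairing_interp_bound[OF range \<iota>_interp(1)[OF \<theta>] \<theta>])
    also have "\<dots> \<le> ?C * (\<bar>C\<bar> * norm z) * (?K * norm x)"
      using a \<iota>_interp(2)[OF \<theta>, of x] C0 interp_norm_nonneg[OF \<iota>_interp(1)[OF \<theta>] \<theta>]
      by (intro mult_mono mult_left_mono) auto
    finally show ?thesis by (simp add: mult_ac)
  qed
  moreover have "?C * \<bar>C\<bar> * ?K \<ge> 0" using C0 K0 by simp
  ultimately show ?thesis using that by blast
qed

text \<open>The Riesz theorem in \<open>Z\<close> provides the vector that the definition describes.\<close>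

lemma interp_adjoint_\<iota>:
  assumes R: "bounded_clinear_into_interp \<iota> \<theta> R" and \<theta>: "0 < \<theta>" "\<theta> \<le> 1"
  shows "cinner (interp_adjoint \<iota> \<theta> R (\<iota> p)) w = cnj (pairing (R w) p)"
proof -
  obtain C where C: "\<And>z x. cmod (pairing (R z) x) \<le> C * norm z * norm x"
    by (rule into_interp_bounded[OF R \<theta>]) (rule that)
  have "R w \<in> interp_XdY \<iota> \<theta>" for w
    using R by (auto simp: bounded_clinear_into_interp_def)
  then have eq: "interp_pairing \<iota> \<theta> (R w) (\<iota> p) = pairing (R w) p" for w
    by (rule interp_pairing_\<iota>[OF _ \<theta>])
  have "\<exists>z. \<forall>w. cnj (pairing (R w) p) = cinner z w"
  proof (rule riesz_antilinear)
    show "cmod (cnj (pairing (R w) p)) \<le> C * norm p * norm w" for w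
      using C[of w p] by (simp add: mult_ac)
  qed (use R in \<open>simp_all add: bounded_clinear_into_interp_def pairing_add_left pairing_scaleC_left\<close>)
  then obtain z where "\<forall>w. cnj (pairing (R w) p) = cinner z w" by (rule exE)
  then have z: "\<forall>w. cinner z w = cnj (pairing (R w) p)" by simp
  have "interp_adjoint \<iota> \<theta> R (\<iota> p) = z"
    unfolding interp_adjoint_def eq
  proof (rule the_equality)
    show "z' = z" if "\<forall>w. cinner z' w = cnj (pairing (R w) p)" for z'
      using that z by (intro cinner_eqI) simp
  qed (rule z)
  with z show ?thesis by simp
qed

end

section \<open>Strong measurability and completeness of \<open>L\<^sup>2\<close>\<close>

text \<open>
  Redefine the sequence and the limit on the exceptional null set \<open>N\<close>; completeness makes the part
  of the preimage inside \<open>N\<close> measurable.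
\<close>

lemma (in complete_measure) borel_measurable_AE_limit:
  fixes f :: "nat \<Rightarrow> 'a \<Rightarrow> 'b::metric_space"
  assumes f: "\<And>i. f i \<in> borel_measurable M" and lim: "AE x in M. (\<lambda>i. f i x) \<longlonglongrightarrow> g x"
  shows "g \<in> borel_measurable M"
proof -
  obtain N where N: "N \<in> null_sets M" "\<And>x. x \<in> space M \<Longrightarrow> x \<notin> N \<Longrightarrow> (\<lambda>i. f i x) \<longlonglongrightarrow> g x"
    using lim by (auto elim!: AE_E3)
  have NM [measurable]: "N \<in> sets M" using N(1) by auto
  define c :: 'b where "c = undefined"
  have f' [measurable]: "(\<lambda>x. if x \<in> N then c else f i x) \<in> borel_measurable M" for i
    using f[of i] by measurable
  have g': "(\<lambda>x. if x \<in> N then c else g x) \<in> borel_measurable M"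
    by (rule borel_measurable_LIMSEQ_metric[OF f']) (use N(2) in auto)
  show ?thesis
  proof (rule measurableI)
    fix A :: "'b set" assume A: "A \<in> sets borel"
    have "g -` A \<inter> space M = (((\<lambda>x. if x \<in> N then c else g x) -` A \<inter> space M) - N)
        \<union> (g -` A \<inter> N \<inter> space M)"
      by auto
    moreover have "g -` A \<inter> N \<inter> space M \<in> null_sets M" by (rule complete2[OF _ N(1)]) auto
    ultimately show "g -` A \<inter> space M \<in> sets M"
      using measurable_sets[OF g' A] NM by (auto simp: null_sets_def)
  qed simp
qed

text \<open>
  In a complete measure space no measurability has to be checked: either both functions are
  measurable or both integrals are zero by convention.
\<close>

lemma (in complete_measure) integral_AE_eq:
  fixes f g :: "'a \<Rightarrow> 'b::{banach,second_countable_topology}"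
  assumes "AE x in M. f x = g x"
  shows "integrable M f \<longleftrightarrow> integrable M g" and "(LINT x|M. f x) = (LINT x|M. g x)"
proof -
  have *: "v \<in> borel_measurable M" if "u \<in> borel_measurable M" "AE x in M. u x = v x"
    for u v :: "'a \<Rightarrow> 'b"
    by (rule borel_measurable_AE_limit[of "\<lambda>_. u"]) (use that in auto)
  have eq: "f \<in> borel_measurable M \<longleftrightarrow> g \<in> borel_measurable M"
  proof
    show "g \<in> borel_measurable M" if "f \<in> borel_measurable M" using *[OF that assms] .
    have "AE x in M. g x = f x" using assms by eventually_elim simp
    then show "f \<in> borel_measurable M" if "g \<in> borel_measurable M" using *[OF that] by blast
  qed
  show "integrable M f \<longleftrightarrow> integrable M g"
  proof (cases "f \<in> borel_measurable M")
    case True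
    with eq assms show ?thesis by (intro integrable_cong_AE) auto
  next
    case False
    with eq show ?thesis by auto
  qed
  show "(LINT x|M. f x) = (LINT x|M. g x)"
  proof (cases "f \<in> borel_measurable M")
    case True
    with eq assms show ?thesis by (intro integral_cong_AE) auto
  next
    case False
    with eq have "\<not> integrable M f" "\<not> integrable M g" by auto
    then show ?thesis by (simp add: not_integrable_integral_eq)
  qed
qed

text \<open>The composition with \<open>h\<close> maps the approximating simple functions to simple functions.\<close>

lemma (in complete_measure) borel_measurable_strongly:
  fixes h :: "'b::metric_space \<Rightarrow> 'c::metric_space \<Rightarrow> 'd::metric_space"
  assumes "strongly_measurable M f" "strongly_measurable M g"
    and h: "\<And>x y. isCont (\<lambda>p. h (fst p) (snd p)) (x, y)"
  shows "(\<lambda>t. h (f t) (g t)) \<in> borel_measurable M"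
proof -
  obtain s r where s: "\<And>n. simple_function M (s n)" "AE t in M. (\<lambda>n. s n t) \<longlonglongrightarrow> f t"
    and r: "\<And>n. simple_function M (r n)" "AE t in M. (\<lambda>n. r n t) \<longlonglongrightarrow> g t"
    using assms(1,2) unfolding strongly_measurable_def by blast
  show ?thesis
  proof (rule borel_measurable_AE_limit)
    show "(\<lambda>t. h (s n t) (r n t)) \<in> borel_measurable M" for n
      by (rule borel_measurable_simple_function[OF simple_function_compose2[OF s(1) r(1)]])
    show "AE t in M. (\<lambda>n. h (s n t) (r n t)) \<longlonglongrightarrow> h (f t) (g t)"
      using s(2) r(2)
    proof eventually_elim
      case (elim t)
      from isCont_tendsto_compose[OF h tendsto_Pair[OF elim]] show ?case by simp
    qed
  qed
qed

lemma AE_summable: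
  fixes f :: "nat \<Rightarrow> 'a \<Rightarrow> real"
  assumes f: "\<And>i. integrable M (f i)" "\<And>i x. 0 \<le> f i x" and sum: "summable (\<lambda>i. LINT x|M. f i x)"
  shows "AE x in M. summable (\<lambda>i. f i x)"
proof -
  have [measurable]: "f i \<in> borel_measurable M" for i using f(1) by auto
  have "(\<integral>\<^sup>+x. (\<Sum>i. ennreal (f i x)) \<partial>M) = (\<Sum>i. \<integral>\<^sup>+x. ennreal (f i x) \<partial>M)"
    by (rule nn_integral_suminf) simp
  also have "\<dots> = (\<Sum>i. ennreal (LINT x|M. f i x))"
    using f by (simp add: nn_integral_eq_integral)
  also have "\<dots> = ennreal (\<Sum>i. LINT x|M. f i x)"
    using f sum by (intro suminf_ennreal2) auto
  finally have "(\<integral>\<^sup>+x. (\<Sum>i. ennreal (f i x)) \<partial>M) \<noteq> \<infinity>" by simp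
  then have "AE x in M. (\<Sum>i. ennreal (f i x)) \<noteq> \<infinity>"
    by (intro nn_integral_noteq_infinite) auto
  then show ?thesis
    by eventually_elim (use f(2) in \<open>auto intro: summable_suminf_not_top\<close>)
qed

locale complete_finite_measure = complete_measure M + finite_measure M for M :: "'a measure"
begin

text \<open>
  In a finite measure space convergence almost everywhere implies convergence in measure; this
  selects simple functions that approximate each \<open>f n\<close> so well that they have the same limit.
\<close>

lemma strongly_measurable_limit:
  fixes f :: "nat \<Rightarrow> 'a \<Rightarrow> 'b::metric_space"
  assumes f: "\<And>n. strongly_measurable M (f n)" and lim: "AE t in M. (\<lambda>n. f n t) \<longlonglongrightarrow> g t"
  shows "strongly_measurable M g"
proof -
  have "\<exists>s. simple_function M s \<and> integrable M (\<lambda>t. min 1 (dist (s t) (f n t))) \<and>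
      (LINT t|M. min 1 (dist (s t) (f n t))) < (1/2) ^ n" (is "\<exists>s. ?Q n s") for n
  proof -
    obtain s where s: "\<And>k. simple_function M (s k)" "AE t in M. (\<lambda>k. s k t) \<longlonglongrightarrow> f n t"
      using f[of n] by (auto simp: strongly_measurable_def)
    have meas: "(\<lambda>t. min 1 (dist (s k t) (f n t))) \<in> borel_measurable M" for k
    proof (rule borel_measurable_strongly[where h = "\<lambda>x y. min 1 (dist x y)"])
      show "strongly_measurable M (s k)"
        unfolding strongly_measurable_def using s(1) by (intro exI[of _ "\<lambda>_. s k"]) auto
    qed (auto simp: f intro!: continuous_intros)
    have int: "integrable M (\<lambda>t. min 1 (dist (s k t) (f n t)))" for k
      by (rule integrable_const_bound[where B = 1]) (use meas in auto)
    have "(\<lambda>k. LINT t|M. min 1 (dist (s k t) (f n t))) \<longlonglongrightarrow> (LINT t|M. 0)"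
    proof (rule integral_dominated_convergence[where w = "\<lambda>_. 1"])
      show "AE t in M. (\<lambda>k. min 1 (dist (s k t) (f n t))) \<longlonglongrightarrow> 0"
        using s(2)
      proof eventually_elim
        case (elim t)
        have "(\<lambda>k. min 1 (dist (s k t) (f n t))) \<longlonglongrightarrow> min 1 (dist (f n t) (f n t))"
          by (intro tendsto_intros elim)
        then show ?case by simp
      qed
    qed (use meas in auto)
    then have "\<forall>\<^sub>F k in sequentially. (LINT t|M. min 1 (dist (s k t) (f n t))) < (1/2) ^ n"
      by (intro order_tendstoD) auto
    then obtain k where "(LINT t|M. min 1 (dist (s k t) (f n t))) < (1/2) ^ n"
      by (auto simp: eventually_sequentially)
    then show ?thesis using s(1) int by blast
  qed
  then have "\<exists>s. \<forall>n. ?Q n (s n)" by (intro choice allI)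
  then obtain s where "\<forall>n. ?Q n (s n)" by (rule exE)
  then have s: "\<And>n. simple_function M (s n)"
    "\<And>n. integrable M (\<lambda>t. min 1 (dist (s n t) (f n t)))"
    "\<And>n. (LINT t|M. min 1 (dist (s n t) (f n t))) < (1/2) ^ n"
    by simp_all
  have "AE t in M. summable (\<lambda>n. min 1 (dist (s n t) (f n t)))"
  proof (rule AE_summable[OF s(2)])
    show "summable (\<lambda>n. LINT t|M. min 1 (dist (s n t) (f n t)))"
      by (rule summable_comparison_test'[OF summable_geometric[of "1/2 :: real"], of 0])
        (use s(3) in \<open>auto simp: less_imp_le\<close>)
  qed simp
  with lim have "AE t in M. (\<lambda>n. s n t) \<longlonglongrightarrow> g t"
  proof eventually_elim
    case (elim t)
    have "(\<lambda>n. min 1 (dist (s n t) (f n t))) \<longlonglongrightarrow> 0"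
      using elim(2) by (rule summable_LIMSEQ_zero)
    then have lim0: "(\<lambda>n. dist (s n t) (f n t)) \<longlonglongrightarrow> 0"
    proof (rule Lim_transform_eventually)
      have "\<forall>\<^sub>F n in sequentially. min 1 (dist (s n t) (f n t)) < 1"
        using \<open>(\<lambda>n. min 1 _) \<longlonglongrightarrow> 0\<close> by (rule order_tendstoD) simp
      then show "\<forall>\<^sub>F n in sequentially. min 1 (dist (s n t) (f n t)) = dist (s n t) (f n t)"
        by eventually_elim auto
    qed
    have "(\<lambda>n. dist (f n t) (g t)) \<longlonglongrightarrow> 0" using elim(1) by (rule tendsto_dist_iff[THEN iffD1])
    from tendsto_add[OF lim0 this] have *: "(\<lambda>n. dist (s n t) (f n t) + dist (f n t) (g t)) \<longlonglongrightarrow> 0"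
      by simp
    have "(\<lambda>n. dist (s n t) (g t)) \<longlonglongrightarrow> 0"
      by (rule tendsto_sandwich[OF _ _ tendsto_const *]) (auto simp: dist_triangle)
    then show ?case by (rule tendsto_dist_iff[THEN iffD2])
  qed
  with s(1) show ?thesis by (auto simp: strongly_measurable_def)
qed

lemma square_measurable:
  fixes U V :: "'a \<Rightarrow> 'b::real_normed_vector"
  assumes "strongly_measurable M U" "strongly_measurable M V"
  shows "(\<lambda>t. (norm (U t - V t))\<^sup>2) \<in> borel_measurable M"
    and "(\<lambda>t. norm (U t - V t)) \<in> borel_measurable M"
    and "(\<lambda>t. norm (U t)) \<in> borel_measurable M"
  by (rule borel_measurable_strongly[OF assms]; auto intro!: continuous_intros)+

lemma square_integrable_diff:
  fixes U V :: "'a \<Rightarrow> 'b::real_normed_vector"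
  assumes UV: "strongly_measurable M U" "strongly_measurable M V"
    and int: "integrable M (\<lambda>t. (norm (U t))\<^sup>2)" "integrable M (\<lambda>t. (norm (V t))\<^sup>2)"
  shows "integrable M (\<lambda>t. (norm (U t - V t))\<^sup>2)"
proof (rule Bochner_Integration.integrable_bound)
  show "integrable M (\<lambda>t. 2 * (norm (U t))\<^sup>2 + 2 * (norm (V t))\<^sup>2)" using int by auto
  have "(norm (u - v))\<^sup>2 \<le> 2 * (norm u)\<^sup>2 + 2 * (norm v)\<^sup>2" for u v :: 'b
  proof -
    have "(norm (u - v))\<^sup>2 \<le> (norm u + norm v)\<^sup>2" by (intro power_mono norm_triangle_ineq4) auto
    also have "\<dots> \<le> 2 * (norm u)\<^sup>2 + 2 * (norm v)\<^sup>2"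
      using zero_le_power2[of "norm u - norm v"] by (simp add: power2_eq_square algebra_simps)
    finally show ?thesis .
  qed
  then show "AE t in M. norm ((norm (U t - V t))\<^sup>2) \<le> norm (2 * (norm (U t))\<^sup>2 + 2 * (norm (V t))\<^sup>2)"
    by auto
qed (rule square_measurable[OF UV])

text \<open>With a weight \<open>e\<close>, the arithmetic-geometric inequality takes the place of Cauchy-Schwarz.\<close>

lemma integral_norm_le:
  fixes D :: "'a \<Rightarrow> 'b::real_normed_vector"
  assumes meas: "(\<lambda>t. norm (D t)) \<in> borel_measurable M"
    and int: "integrable M (\<lambda>t. (norm (D t))\<^sup>2)" and e: "e > 0"
  shows "integrable M (\<lambda>t. norm (D t))"
    and "(LINT t|M. norm (D t)) \<le> ((LINT t|M. (norm (D t))\<^sup>2) / e + e * Sigma_Algebra.measure M (space M)) / 2"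
proof -
  have le: "norm d \<le> ((norm d)\<^sup>2 / e + e) / 2" for d :: 'b
    using zero_le_power2[of "norm d - e"] e by (simp add: power2_eq_square field_simps)
  have int': "integrable M (\<lambda>t. ((norm (D t))\<^sup>2 / e + e) / 2)" using int by auto
  show i: "integrable M (\<lambda>t. norm (D t))"
    by (rule Bochner_Integration.integrable_bound[OF int' meas]) (use le in \<open>auto intro: order_trans[OF _ abs_ge_self]\<close>)
  have "(LINT t|M. norm (D t)) \<le> (LINT t|M. ((norm (D t))\<^sup>2 / e + e) / 2)"
    by (rule integral_mono[OF i int']) (rule le)
  also have "\<dots> = ((LINT t|M. (norm (D t))\<^sup>2) / e + e * Sigma_Algebra.measure M (space M)) / 2"
    using int by (simp add: mult.commute)
  finally show "(LINT t|M. norm (D t)) \<le> \<dots>" .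
qed

text \<open>The same device for products; the bound is homogeneous in \<open>D\<close> only.\<close>

lemma integral_inner_le_L2:
  fixes U D :: "'a \<Rightarrow> 'b::real_inner"
  assumes meas: "(\<lambda>t. inner (U t) (D t)) \<in> borel_measurable M"
    and int: "integrable M (\<lambda>t. (norm (U t))\<^sup>2)" "integrable M (\<lambda>t. (norm (D t))\<^sup>2)"
  shows "integrable M (\<lambda>t. inner (U t) (D t))"
    and "\<bar>LINT t|M. inner (U t) (D t)\<bar>
      \<le> (1 + (LINT t|M. (norm (U t))\<^sup>2)) * sqrt (LINT t|M. (norm (D t))\<^sup>2)"
proof -
  have le: "\<bar>inner u d\<bar> \<le> (e * (norm u)\<^sup>2 + (norm d)\<^sup>2 / e) / 2" if "e > 0" for u d :: 'b and e
  proof -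
    have "\<bar>inner u d\<bar> \<le> norm u * norm d" by (rule Cauchy_Schwarz_ineq2)
    moreover have "2 * (norm u * norm d) \<le> e * (norm u)\<^sup>2 + (norm d)\<^sup>2 / e"
      using zero_le_power2[of "e * norm u - norm d"] that
      by (simp add: power2_eq_square field_simps)
    ultimately show ?thesis by simp
  qed
  have int': "integrable M (\<lambda>t. (e * (norm (U t))\<^sup>2 + (norm (D t))\<^sup>2 / e) / 2)" for e using int by auto
  show i: "integrable M (\<lambda>t. inner (U t) (D t))"
    by (rule Bochner_Integration.integrable_bound[OF int'[of 1] meas])
      (use le[of 1] in \<open>auto intro!: order_trans[OF _ abs_ge_self] AE_I2\<close>)
  let ?u = "LINT t|M. (norm (U t))\<^sup>2" and ?d = "LINT t|M. (norm (D t))\<^sup>2"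
  have bound: "\<bar>LINT t|M. inner (U t) (D t)\<bar> \<le> (e * ?u + ?d / e) / 2" if "e > 0" for e
  proof -
    have "\<bar>LINT t|M. inner (U t) (D t)\<bar> \<le> (LINT t|M. \<bar>inner (U t) (D t)\<bar>)"
      by (rule integral_abs_bound)
    also have "\<dots> \<le> (LINT t|M. (e * (norm (U t))\<^sup>2 + (norm (D t))\<^sup>2 / e) / 2)"
      by (rule integral_mono[OF _ int']) (use i le[OF that] in auto)
    also have "\<dots> = (e * ?u + ?d / e) / 2" using int by simp
    finally show ?thesis .
  qed
  have u0: "?u \<ge> 0" and d0: "?d \<ge> 0" by simp_all
  show "\<bar>LINT t|M. inner (U t) (D t)\<bar> \<le> (1 + ?u) * sqrt ?d"
  proof (cases "?d = 0")
    case True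
    then have "AE t in M. (norm (D t))\<^sup>2 = 0"
      using integral_nonneg_eq_0_iff_AE[OF int(2)] by simp
    then have "AE t in M. inner (U t) (D t) = 0" by eventually_elim simp
    then have "(LINT t|M. inner (U t) (D t)) = 0" by (rule integral_eq_zero_AE)
    with True show ?thesis by simp
  next
    case False
    with d0 have "?d > 0" by linarith
    then have "sqrt ?d > 0" by (simp only: real_sqrt_gt_0_iff)
    from bound[OF this] have "\<bar>LINT t|M. inner (U t) (D t)\<bar> \<le> (sqrt ?d * ?u + sqrt ?d) / 2"
      using d0 by (simp add: real_div_sqrt)
    also have "\<dots> \<le> sqrt ?d * ?u + sqrt ?d" using u0 d0 by simp
    finally show ?thesis by (simp add: algebra_simps)
  qed
qed

lemma integral_norm_le_L2:
  fixes D :: "'a \<Rightarrow> 'b::real_normed_vector"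
  assumes meas: "(\<lambda>t. norm (D t)) \<in> borel_measurable M"
    and int: "integrable M (\<lambda>t. (norm (D t))\<^sup>2)"
  shows "(LINT t|M. norm (D t)) \<le> (1 + Sigma_Algebra.measure M (space M)) * sqrt (LINT t|M. (norm (D t))\<^sup>2)"
  using integral_inner_le_L2(2)[of "\<lambda>_. 1 :: real" "\<lambda>t. norm (D t)"] meas int by simp

text \<open>Riesz-Fischer: a rapidly converging subsequence converges almost everywhere; then Fatou.\<close>

lemma L2_complete:
  fixes U :: "nat \<Rightarrow> 'a \<Rightarrow> 'b::banach"
  assumes U: "\<And>n. strongly_measurable M (U n)" "\<And>n. integrable M (\<lambda>t. (norm (U n t))\<^sup>2)"
    and Cauchy: "\<And>e. e > 0 \<Longrightarrow> \<exists>N. \<forall>m\<ge>N. \<forall>n\<ge>N. sqrt (LINT t|M. (norm (U m t - U n t))\<^sup>2) < e"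
  obtains V where "strongly_measurable M V" "integrable M (\<lambda>t. (norm (V t))\<^sup>2)"
    "(\<lambda>n. sqrt (LINT t|M. (norm (U n t - V t))\<^sup>2)) \<longlonglongrightarrow> 0"
proof -
  define q where "q m n = (LINT t|M. (norm (U m t - U n t))\<^sup>2)" for m n
  have q0: "q m n \<ge> 0" for m n unfolding q_def by simp
  have intU: "integrable M (\<lambda>t. (norm (U m t - U n t))\<^sup>2)" for m n
    by (intro square_integrable_diff U)
  have "\<exists>N. \<forall>m\<ge>N. \<forall>n\<ge>N. q m n < (1/4) ^ k" for k :: nat
  proof -
    obtain N where N: "\<forall>m\<ge>N. \<forall>n\<ge>N. sqrt (q m n) < (1/2) ^ k"
      using Cauchy[of "(1/2) ^ k"] by (auto simp: q_def)
    have "q m n < (1/4) ^ k" if "m \<ge> N" "n \<ge> N" for m n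
    proof -
      have "(sqrt (q m n))\<^sup>2 < ((1/2) ^ k)\<^sup>2"
        using N that q0 by (intro power_strict_mono) auto
      also have "\<dots> = (1/4::real) ^ k" by (simp add: power2_eq_square flip: power_mult_distrib)
      finally show ?thesis using q0 by simp
    qed
    then show ?thesis by blast
  qed
  then obtain N where N: "\<And>k m n. m \<ge> N k \<Longrightarrow> n \<ge> N k \<Longrightarrow> q m n < (1/4) ^ k" by metis
  \<comment> \<open>partial sums, so that \<open>r k\<close> exceeds \<open>N j\<close> for all \<open>j \<le> k\<close>\<close>
  define r where "r k = (\<Sum>i\<le>k. N i)" for k
  have r: "r k \<ge> N j" if "j \<le> k" for j k
    unfolding r_def using that by (intro member_le_sum) auto
  have sum: "AE t in M. summable (\<lambda>k. norm (U (r (Suc k)) t - U (r k) t))"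
  proof (rule AE_summable)
    let ?C = "(1 + Sigma_Algebra.measure M (space M)) / 2"
    have le: "norm (LINT t|M. norm (U (r (Suc k)) t - U (r k) t)) \<le> ?C * (1/2) ^ k" for k
    proof -
      \<comment> \<open>the weight \<open>2\<^sup>-\<^sup>k\<close> balances the two terms, as \<open>q\<close> is at most \<open>4\<^sup>-\<^sup>k\<close>\<close>
      have "q (r (Suc k)) (r k) / (1/2) ^ k \<le> (1/4) ^ k / (1/2) ^ k"
        by (intro divide_right_mono less_imp_le[OF N] r) auto
      also have "\<dots> = (1/2 :: real) ^ k" by (simp flip: power_divide)
      finally have "(q (r (Suc k)) (r k) / (1/2) ^ k + (1/2) ^ k * Sigma_Algebra.measure M (space M)) / 2
          \<le> ((1/2) ^ k + (1/2) ^ k * Sigma_Algebra.measure M (space M)) / 2"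
        by (intro divide_right_mono add_mono) auto
      moreover have "(LINT t|M. norm (U (r (Suc k)) t - U (r k) t))
          \<le> (q (r (Suc k)) (r k) / (1/2) ^ k + (1/2) ^ k * Sigma_Algebra.measure M (space M)) / 2"
        unfolding q_def by (intro integral_norm_le square_measurable U intU) simp
      ultimately show ?thesis by (simp add: algebra_simps)
    qed
    have "summable (\<lambda>k. ?C * (1/2) ^ k)" by (intro summable_mult summable_geometric) simp
    then show "summable (\<lambda>k. LINT t|M. norm (U (r (Suc k)) t - U (r k) t))"
      by (rule summable_comparison_test') (rule le)
    show "integrable M (\<lambda>t. norm (U (r (Suc k)) t - U (r k) t))" for k
      by (rule integral_norm_le(1)[OF square_measurable(2)[OF U(1) U(1)] intU zero_less_one])
  qed simp
  define V where "V t = lim (\<lambda>k. U (r k) t)" for t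
  have lim: "AE t in M. (\<lambda>k. U (r k) t) \<longlonglongrightarrow> V t"
    using sum
  proof eventually_elim
    case (elim t)
    then have "summable (\<lambda>k. U (r (Suc k)) t - U (r k) t)" by (rule summable_norm_cancel)
    then have "convergent (\<lambda>n. U (r n) t - U (r 0) t)"
      by (simp add: summable_iff_convergent sum_lessThan_telescope[of "\<lambda>k. U (r k) t"])
    then have "convergent (\<lambda>n. (U (r n) t - U (r 0) t) + U (r 0) t)"
      by (intro convergent_add convergent_const)
    then show ?case by (simp add: V_def convergent_LIMSEQ_iff)
  qed
  have V: "strongly_measurable M V"
    by (rule strongly_measurable_limit[OF U(1) lim])
  have fatou: "(\<integral>\<^sup>+t. ennreal ((norm (U n t - V t))\<^sup>2) \<partial>M) \<le> ennreal ((1/4) ^ j)" if n: "n \<ge> N j" for n j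
  proof -
    have "(\<integral>\<^sup>+t. ennreal ((norm (U n t - V t))\<^sup>2) \<partial>M)
        = (\<integral>\<^sup>+t. liminf (\<lambda>k. ennreal ((norm (U n t - U (r k) t))\<^sup>2)) \<partial>M)"
    proof (rule nn_integral_cong_AE, use lim in eventually_elim)
      case (elim t)
      have "(\<lambda>k. ennreal ((norm (U n t - U (r k) t))\<^sup>2)) \<longlonglongrightarrow> ennreal ((norm (U n t - V t))\<^sup>2)"
        by (intro tendsto_intros elim)
      then show ?case by (rule lim_imp_Liminf[OF trivial_limit_sequentially, symmetric])
    qed
    also have "\<dots> \<le> liminf (\<lambda>k. \<integral>\<^sup>+t. ennreal ((norm (U n t - U (r k) t))\<^sup>2) \<partial>M)"
      by (intro nn_integral_liminf measurable_compose[OF square_measurable(1)[OF U(1) U(1)]] measurable_ennreal)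
    also have "\<dots> = liminf (\<lambda>k. ennreal (q n (r k)))"
      using intU by (simp add: nn_integral_eq_integral q_def)
    also have "\<dots> \<le> limsup (\<lambda>k. ennreal (q n (r k)))" by (rule Liminf_le_Limsup) simp
    also have "\<dots> \<le> ennreal ((1/4) ^ j)"
    proof (rule Limsup_bounded)
      show "\<forall>\<^sub>F k in sequentially. ennreal (q n (r k)) \<le> ennreal ((1/4) ^ j)"
        using eventually_ge_at_top[of j] by eventually_elim (rule ennreal_leI[OF less_imp_le[OF N[OF n r]]])
    qed
    finally show ?thesis .
  qed
  have meas: "(\<lambda>t. (norm (U n t - V t))\<^sup>2) \<in> borel_measurable M" for n
    by (rule square_measurable[OF U(1) V])
  have int: "integrable M (\<lambda>t. (norm (U n t - V t))\<^sup>2)"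
    and le: "(LINT t|M. (norm (U n t - V t))\<^sup>2) \<le> (1/4) ^ j" if n: "n \<ge> N j" for n j
  proof -
    show int: "integrable M (\<lambda>t. (norm (U n t - V t))\<^sup>2)"
      using fatou[OF n] meas by (intro integrableI_bounded) (auto simp: le_less_trans)
    have "ennreal (LINT t|M. (norm (U n t - V t))\<^sup>2) \<le> ennreal ((1/4) ^ j)"
      using fatou[OF n] int by (simp add: nn_integral_eq_integral)
    then show "(LINT t|M. (norm (U n t - V t))\<^sup>2) \<le> (1/4) ^ j" by (simp add: ennreal_le_iff)
  qed
  have VL2: "integrable M (\<lambda>t. (norm (V t))\<^sup>2)"
  proof (rule Bochner_Integration.integrable_bound)
    show "integrable M (\<lambda>t. 2 * (norm (U (N 0) t - V t))\<^sup>2 + 2 * (norm (U (N 0) t))\<^sup>2)"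
      using int[of 0 "N 0"] U(2) by auto
    have "(norm v)\<^sup>2 \<le> 2 * (norm (u - v))\<^sup>2 + 2 * (norm u)\<^sup>2" for u v :: 'b
    proof -
      have "norm v \<le> norm (u - v) + norm u"
        by (metis add.commute norm_minus_commute norm_triangle_sub)
      then have "(norm v)\<^sup>2 \<le> (norm (u - v) + norm u)\<^sup>2" by (intro power_mono) auto
      also have "\<dots> \<le> 2 * (norm (u - v))\<^sup>2 + 2 * (norm u)\<^sup>2"
        using zero_le_power2[of "norm (u - v) - norm u"] by (simp add: power2_eq_square algebra_simps)
      finally show ?thesis .
    qed
    then show "AE t in M. norm ((norm (V t))\<^sup>2)
        \<le> norm (2 * (norm (U (N 0) t - V t))\<^sup>2 + 2 * (norm (U (N 0) t))\<^sup>2)"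
      by auto
    show "(\<lambda>t. (norm (V t))\<^sup>2) \<in> borel_measurable M"
      by (intro borel_measurable_power square_measurable(3)[OF V V])
  qed
  have "(\<lambda>n. LINT t|M. (norm (U n t - V t))\<^sup>2) \<longlonglongrightarrow> 0"
  proof (rule LIMSEQ_I)
    fix e :: real assume "e > 0"
    then obtain j where j: "(1/4) ^ j < e" using real_arch_pow_inv[of e "1/4"] by auto
    have "norm ((LINT t|M. (norm (U n t - V t))\<^sup>2) - 0) < e" if "n \<ge> N j" for n
      using le[OF that] j by simp
    then show "\<exists>no. \<forall>n\<ge>no. norm ((LINT t|M. (norm (U n t - V t))\<^sup>2) - 0) < e" by blast
  qed
  from tendsto_real_sqrt[OF this] have "(\<lambda>n. sqrt (LINT t|M. (norm (U n t - V t))\<^sup>2)) \<longlonglongrightarrow> 0"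
    by simp
  with V VL2 that show ?thesis by blast
qed

end

lemma complete_finite_measure_time: "complete_finite_measure (time T)"
proof -
  interpret finite_measure "time T" by (rule finite_measure_lebesgue_on) simp
  show ?thesis
  proof unfold_locales
    fix A B assume "B \<subseteq> A" "A \<in> null_sets (time T)"
    then have "B \<in> null_sets lebesgue" "B \<subseteq> {0<..<T}"
      using completion.complete2[of B A lborel] by (auto simp: null_sets_restrict_space)
    then show "B \<in> sets (time T)" by (auto simp: sets_restrict_space intro!: image_eqI[of _ _ B])
  qed
qed

section \<open>Smooth bump functions\<close>

text \<open>
  The functions \<open>p(t) q(t)\<^sup>-\<^sup>m exp (- c / q(t))\<close> on \<open>(a, b)\<close>, extended by zero, where
  \<open>q(t) = (t - a) (b - t)\<close> and \<open>p\<close> is a polynomial: a class closed under differentiation.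
\<close>

definition bump :: "real \<Rightarrow> real \<Rightarrow> real \<Rightarrow> real poly \<Rightarrow> nat \<Rightarrow> real \<Rightarrow> real" where
  "bump a b c p m t = (if a < t \<and> t < b
     then poly p t / ((t - a) * (b - t)) ^ m * exp (- c / ((t - a) * (b - t))) else 0)"

text \<open>With \<open>u = 1 / q(t)\<close> this shows that the bumps vanish to all orders at \<open>a\<close> and \<open>b\<close>.\<close>

lemma power_exp_bounded:
  assumes "c > (0::real)" "u \<ge> 0"
  shows "u ^ k * exp (- c * u) \<le> (real (Suc k) / c) ^ Suc k + 1"
proof (cases "u \<le> 1")
  case True
  have "u ^ k * exp (- c * u) \<le> 1 * 1"
    using assms True by (intro mult_mono power_le_one) auto
  also have "\<dots> \<le> (real (Suc k) / c) ^ Suc k + 1" using assms by simp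
  finally show ?thesis .
next
  case False
  have "(c * u / real (Suc k)) ^ Suc k \<le> (1 + c * u / real (Suc k)) ^ Suc k"
    using assms by (intro power_mono) auto
  also have "\<dots> \<le> exp (c * u)"
    using assms by (intro exp_ge_one_plus_x_over_n_power_n) (auto intro: order_trans[of _ 0])
  finally have "(c * u / real (Suc k)) ^ Suc k \<le> exp (c * u)" .
  moreover have "u ^ Suc k = (real (Suc k) / c) ^ Suc k * (c * u / real (Suc k)) ^ Suc k"
    unfolding power_mult_distrib[symmetric] using assms by simp
  moreover have "(real (Suc k) / c) ^ Suc k \<ge> 0" using assms by simp
  ultimately have "u ^ Suc k \<le> (real (Suc k) / c) ^ Suc k * exp (c * u)"
    using mult_left_mono by metis
  then have "u ^ Suc k * exp (- c * u) \<le> (real (Suc k) / c) ^ Suc k * exp (c * u) * exp (- c * u)"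
    by (intro mult_right_mono) auto
  also have "\<dots> = (real (Suc k) / c) ^ Suc k" by (simp add: mult.assoc flip: exp_add)
  finally have "u ^ Suc k * exp (- c * u) \<le> (real (Suc k) / c) ^ Suc k" .
  moreover have "u ^ k * exp (- c * u) \<le> u ^ Suc k * exp (- c * u)"
    using False by (intro mult_right_mono power_increasing) auto
  ultimately show ?thesis by linarith
qed

lemma DERIV_zero_of_quadratic_bound:
  fixes f :: "real \<Rightarrow> real"
  assumes f: "f x = 0" "\<And>t. \<bar>f t\<bar> \<le> K * (t - x)\<^sup>2"
  shows "(f has_field_derivative 0) (at x)"
proof -
  have "((\<lambda>y. K * \<bar>y - x\<bar>) \<longlongrightarrow> K * \<bar>x - x\<bar>) (at x)"
    by (intro tendsto_intros)
  then have lim: "((\<lambda>y. K * \<bar>y - x\<bar>) \<longlongrightarrow> 0) (at x)" by simp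
  have "norm ((f y - f x) / (y - x)) \<le> K * \<bar>y - x\<bar>" if "y \<noteq> x" for y
    using f(2)[of y] that by (simp add: f(1) divide_le_eq power2_eq_square abs_mult_self_eq mult.assoc)
  then have "((\<lambda>y. (f y - f x) / (y - x)) \<longlongrightarrow> 0) (at x)"
    by (intro Lim_null_comparison[OF _ lim]) (simp add: eventually_at_filter)
  then show ?thesis by (simp add: has_field_derivative_iff)
qed

text \<open>
  Inside \<open>(a, b)\<close> the derivative is computed. Elsewhere it is zero, because the function is bounded
  by a multiple of \<open>q\<^sup>2\<close>, and \<open>q\<close> by a multiple of the distance to any point outside of \<open>(a, b)\<close>.
\<close>

lemma bump_DERIV:
  assumes "c > 0" "a < b"
  shows "\<exists>p'. \<forall>t. (bump a b c p m has_field_derivative bump a b c p' (m + 2) t) (at t)"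
proof -
  define q where "q = [:- a, 1:] * [:b, - 1:]"
  define p' where "p' = pderiv p * q\<^sup>2 - smult (real m) (p * pderiv q * q) + smult c (p * pderiv q)"
  have q: "poly q t = (t - a) * (b - t)" for t by (simp add: q_def algebra_simps)
  have "(bump a b c p m has_field_derivative bump a b c p' (m + 2) t) (at t)" for t
  proof (cases "a < t \<and> t < b")
    case True
    then have qt: "poly q t > 0" by (simp add: q)
    let ?D = "((poly (pderiv p) t * poly q t ^ m - poly p t * (real m * poly q t ^ (m - 1) * poly (pderiv q) t))
            / (poly q t ^ m * poly q t ^ m)) * exp (- c / poly q t)
          + poly p t / poly q t ^ m * (exp (- c / poly q t) * (c * poly (pderiv q) t / (poly q t * poly q t)))"
    have "((\<lambda>t. poly p t / poly q t ^ m * exp (- c / poly q t)) has_field_derivative ?D) (at t)"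
    proof -
      have d2: "((\<lambda>t. poly q t ^ m) has_field_derivative
          real m * poly q t ^ (m - 1) * poly (pderiv q) t) (at t)"
        by (auto intro!: derivative_eq_intros poly_DERIV)
      have d3: "((\<lambda>t. exp (- c / poly q t)) has_field_derivative
          exp (- c / poly q t) * (c * poly (pderiv q) t / (poly q t * poly q t))) (at t)"
        using qt by (auto intro!: derivative_eq_intros poly_DERIV)
      have "poly q t ^ m \<noteq> 0" using qt by simp
      from DERIV_mult[OF DERIV_divide[OF poly_DERIV d2 this] d3]
      show ?thesis by (simp add: algebra_simps)
    qed
    moreover have "?D = bump a b c p' (m + 2) t"
    proof -
      define Q e where "Q = poly q t" and "e = exp (- c / Q)"
      have Q: "Q > 0" using qt by (simp add: Q_def)
      have "real m * Q ^ (m - 1) * Q = real m * Q ^ m"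
        by (cases m) auto
      then have m1: "real m * Q ^ (m - 1) = real m * Q ^ m / Q"
        using Q by (simp add: field_simps)
      have "?D = poly p' t / Q ^ (m + 2) * e"
        unfolding Q_def[symmetric] e_def[symmetric] m1 p'_def
        using Q by (simp add: Q_def[symmetric] field_simps power2_eq_square)
      then show ?thesis using True by (simp add: bump_def q[symmetric] Q_def e_def)
    qed
    ultimately have "((\<lambda>t. poly p t / poly q t ^ m * exp (- c / poly q t))
        has_field_derivative bump a b c p' (m + 2) t) (at t)" by simp
    then show ?thesis
    proof (rule has_field_derivative_transform_within_open[of _ _ _ "{a<..<b}"])
    qed (use True in \<open>auto simp: bump_def q\<close>)
  next
    case False
    obtain P where P: "\<And>s. s \<in> {a..b} \<Longrightarrow> \<bar>poly p s\<bar> \<le> P"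
    proof -
      have "compact (poly p ` {a..b})" by (intro compact_continuous_image continuous_intros) auto
      then show ?thesis using that by (fastforce dest: compact_imp_bounded simp: bounded_iff)
    qed
    define C where "C = (real (Suc (m + 2)) / c) ^ Suc (m + 2) + 1"
    have P0: "P \<ge> 0" using P[of a] assms by auto
    have C0: "C \<ge> 0" using assms by (simp add: C_def)
    have "\<bar>bump a b c p m s\<bar> \<le> (P * C * (b - a)\<^sup>2) * (s - t)\<^sup>2" for s
    proof (cases "a < s \<and> s < b")
      case True
      let ?q = "(s - a) * (b - s)"
      have q: "?q > 0" using True by simp
      have "\<bar>bump a b c p m s\<bar> = \<bar>poly p s\<bar> * ((1 / ?q) ^ m * exp (- c * (1 / ?q)))"
        using True q by (simp add: bump_def abs_mult power_one_over field_simps)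
      also have "(1 / ?q) ^ m = ?q\<^sup>2 * (1 / ?q) ^ (m + 2)"
        using True by (simp add: power_add power2_eq_square)
      also have "\<bar>poly p s\<bar> * (?q\<^sup>2 * (1 / ?q) ^ (m + 2) * exp (- c * (1 / ?q)))
          = \<bar>poly p s\<bar> * (?q\<^sup>2 * ((1 / ?q) ^ (m + 2) * exp (- c * (1 / ?q))))" by (simp only: mult.assoc)
      also have "\<dots> \<le> P * (?q\<^sup>2 * C)"
        unfolding C_def using True assms q P0
        by (intro mult_mono P order_refl power_exp_bounded mult_left_mono) auto
      also have "\<dots> \<le> P * (((b - a) * \<bar>s - t\<bar>)\<^sup>2 * C)"
      proof -
        \<comment> \<open>the zero of \<open>q\<close> on the side of \<open>t\<close> lies between \<open>t\<close> and \<open>s\<close>\<close>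
        have "?q \<le> (b - a) * \<bar>s - t\<bar>"
        proof (cases "t \<le> a")
          case le: True
          have "(s - a) * (b - s) \<le> \<bar>s - t\<bar> * (b - a)"
            using True le by (intro mult_mono) auto
          then show ?thesis by (simp add: mult.commute)
        next
          case nle: False
          with False have "t \<ge> b" by auto
          then show ?thesis using True by (intro mult_mono) auto
        qed
        then have "?q\<^sup>2 \<le> ((b - a) * \<bar>s - t\<bar>)\<^sup>2" using q by (intro power_mono) auto
        then show ?thesis using P0 C0 by (intro mult_left_mono mult_right_mono) auto
      qed
      also have "\<dots> = (P * C * (b - a)\<^sup>2) * (s - t)\<^sup>2" by (simp add: power_mult_distrib)
      finally show ?thesis .
    next
      case False
      then have "bump a b c p m s = 0" by (auto simp: bump_def)
      then show ?thesis using P0 C0 by simp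
    qed
    moreover have "bump a b c p' (m + 2) t = 0" "bump a b c p m t = 0"
      using False by (auto simp: bump_def)
    ultimately show ?thesis using DERIV_zero_of_quadratic_bound by metis
  qed
  then show ?thesis by blast
qed

lemma test_fun_bump:
  assumes "c > 0" "a < b" "0 < a" "b < T"
  shows "test_fun T (bump a b c p m)"
  unfolding test_fun_def
proof (intro conjI allI)
  have "\<exists>p' m'. (deriv ^^ k) (bump a b c p m) = bump a b c p' m'" for k
  proof (induction k)
    case (Suc k)
    then obtain p' m' where IH: "(deriv ^^ k) (bump a b c p m) = bump a b c p' m'" by blast
    obtain p'' where "\<forall>t. (bump a b c p' m' has_field_derivative bump a b c p'' (m' + 2) t) (at t)"
      using bump_DERIV[OF assms(1,2)] by blast
    then have "deriv (bump a b c p' m') = bump a b c p'' (m' + 2)"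
      by (intro ext DERIV_imp_deriv) simp
    with IH show ?case by auto
  qed auto
  then show "(deriv ^^ k) (bump a b c p m) field_differentiable at t" for k t
    using bump_DERIV[OF assms(1,2)] by (metis field_differentiable_def)
  show "\<exists>K. compact K \<and> K \<subseteq> {0<..<T} \<and> (\<forall>t. t \<notin> K \<longrightarrow> bump a b c p m t = 0)"
    by (rule exI[of _ "{a..b}"]) (use assms in \<open>auto simp: bump_def\<close>)
qed

text \<open>
  The supports shrink from \<open>[a, b]\<close> by \<open>e n\<close>, which keeps them away from the ends of the time
  interval; \<open>c = 1 / (n + 1)\<close> tends to zero, which flattens the bumps.
\<close>

lemma bump_tendsto_indicator:
  fixes a b t :: real
  assumes "a < b"
  defines "e n \<equiv> (b - a) / (3 * real (Suc n))"
  shows "(\<lambda>n. bump (a + e n) (b - e n) (1 / real (Suc n)) 1 0 t) \<longlonglongrightarrow> indicator {a<..<b} t"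
proof -
  have e0: "e n > 0" for n using assms by (simp add: e_def)
  have "(\<lambda>n. (b - a) / 3 * (inverse (real (Suc n)))) \<longlonglongrightarrow> (b - a) / 3 * 0"
    by (intro tendsto_intros LIMSEQ_inverse_real_of_nat)
  then have e: "e \<longlonglongrightarrow> 0" unfolding e_def by (simp add: field_simps)
  show ?thesis
  proof (cases "t \<in> {a<..<b}")
    case False
    then have "bump (a + e n) (b - e n) (1 / real (Suc n)) 1 0 t = 0" for n
      using e0[of n] by (auto simp: bump_def)
    with False show ?thesis by simp
  next
    case True
    have c: "(\<lambda>n. 1 / real (Suc n)) \<longlonglongrightarrow> 0"
      using LIMSEQ_inverse_real_of_nat by (simp add: inverse_eq_divide)
    have "(\<lambda>n. exp (- (1 / real (Suc n)) / ((t - (a + e n)) * ((b - e n) - t))))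
        \<longlonglongrightarrow> exp (- 0 / ((t - (a + 0)) * ((b - 0) - t)))"
      using True by (intro tendsto_intros c e) auto
    then have lim: "(\<lambda>n. exp (- (1 / real (Suc n)) / ((t - (a + e n)) * ((b - e n) - t)))) \<longlonglongrightarrow> 1"
      by simp
    have "\<forall>\<^sub>F n in sequentially. e n < min (t - a) (b - t)"
      using e True by (intro order_tendstoD) auto
    then have "\<forall>\<^sub>F n in sequentially. exp (- (1 / real (Suc n)) / ((t - (a + e n)) * ((b - e n) - t)))
        = bump (a + e n) (b - e n) (1 / real (Suc n)) 1 0 t"
      by eventually_elim (auto simp: bump_def)
    from Lim_transform_eventually[OF lim this] True show ?thesis by simp
  qed
qed

lemma bump_bounds:
  assumes "c > 0" shows "0 \<le> bump a b c 1 0 t" "bump a b c 1 0 t \<le> 1"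
  using assms by (auto simp: bump_def)

section \<open>Weak derivatives\<close>

lemma test_funD:
  assumes "test_fun T \<phi>"
  shows "(\<phi> has_real_derivative deriv \<phi> t) (at t)" and "continuous_on S \<phi>" and "continuous_on S (deriv \<phi>)"
    and "t \<notin> {0<..<T} \<Longrightarrow> \<phi> t = 0"
proof -
  have 0: "\<phi> field_differentiable at t" "deriv \<phi> field_differentiable at t" for t
    using assms[unfolded test_fun_def, THEN conjunct1, rule_format, of 0 t]
      assms[unfolded test_fun_def, THEN conjunct1, rule_format, of "Suc 0" t] by simp_all
  show "(\<phi> has_real_derivative deriv \<phi> t) (at t)"
    using 0(1) by (rule field_differentiable_derivI)
  show "continuous_on S \<phi>" "continuous_on S (deriv \<phi>)"
    using 0 by (auto intro!: continuous_at_imp_continuous_on field_differentiable_imp_continuous_at)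
  show "\<phi> t = 0" if "t \<notin> {0<..<T}"
    using assms that by (auto simp: test_fun_def)
qed

lemma continuous_time_bounded:
  fixes \<phi> :: "real \<Rightarrow> real"
  assumes "continuous_on {0..T} \<phi>"
  shows "\<phi> \<in> borel_measurable (time T)" and "\<exists>B\<ge>0. \<forall>t\<in>{0<..<T}. \<bar>\<phi> t\<bar> \<le> B"
proof -
  show "\<phi> \<in> borel_measurable (time T)"
    using assms by (intro continuous_imp_measurable_on_sets_lebesgue continuous_on_subset[OF assms]) auto
  have "compact (\<phi> ` {0..T})" using assms by (intro compact_continuous_image) auto
  then obtain B where "\<And>t. t \<in> {0..T} \<Longrightarrow> \<bar>\<phi> t\<bar> \<le> B"
    by (fastforce dest: compact_imp_bounded simp: bounded_iff)
  then have "\<And>t. t \<in> {0<..<T} \<Longrightarrow> \<bar>\<phi> t\<bar> \<le> max B 0" by (auto intro: order_trans[OF _ max.cobounded1])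
  then show "\<exists>B\<ge>0. \<forall>t\<in>{0<..<T}. \<bar>\<phi> t\<bar> \<le> B" by (intro exI[of _ "max B 0"]) auto
qed

lemma integrable_continuous_scaleR:
  fixes h :: "real \<Rightarrow> 'a::{banach,second_countable_topology}"
  assumes \<phi>: "continuous_on {0..T} \<phi>" and h: "integrable (time T) h"
  shows "integrable (time T) (\<lambda>t. \<phi> t *\<^sub>R h t)"
proof -
  obtain B where B: "B \<ge> 0" "\<And>t. t \<in> {0<..<T} \<Longrightarrow> \<bar>\<phi> t\<bar> \<le> B"
    using continuous_time_bounded(2)[OF \<phi>] by blast
  have [measurable]: "\<phi> \<in> borel_measurable (time T)" "h \<in> borel_measurable (time T)"
    using continuous_time_bounded(1)[OF \<phi>] h by auto
  show ?thesis
  proof (rule Bochner_Integration.integrable_bound)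
    show "integrable (time T) (\<lambda>t. B * norm (h t))" using h by auto
    show "AE t in time T. norm (\<phi> t *\<^sub>R h t) \<le> norm (B * norm (h t))"
      using B by (intro AE_I2) (auto simp: space_restrict_space intro!: mult_right_mono)
  qed measurable
qed

lemma interval_sets_time: "0 \<le> a \<Longrightarrow> b \<le> T \<Longrightarrow> {a<..<b} \<in> sets (time T)"
  unfolding sets_restrict_space by (rule image_eqI[of _ _ "{a<..<b}"]) auto

lemma integrable_interval:
  fixes f :: "real \<Rightarrow> 'a::{banach,second_countable_topology}"
  assumes "integrable (time T) f" "0 \<le> a" "b \<le> T"
  shows "integrable (time T) (\<lambda>t. indicator {a<..<b} t *\<^sub>R f t)"
  by (rule integrable_mult_indicator[OF interval_sets_time[OF assms(2,3)] assms(1)])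

text \<open>
  The fundamental lemma of the calculus of variations, in the form that identifies integrals
  over intervals.
\<close>

lemma test_fun_orthogonal_imp_interval_zero:
  fixes k :: "real \<Rightarrow> 'a::{banach,second_countable_topology}"
  assumes k: "integrable (time T) k"
    and orth: "\<And>\<phi>. test_fun T \<phi> \<Longrightarrow> (LINT t|time T. \<phi> t *\<^sub>R k t) = 0"
    and ab: "0 \<le> a" "a < b" "b \<le> T"
  shows "(LINT t|time T. indicator {a<..<b} t *\<^sub>R k t) = 0"
proof -
  define e where "e n = (b - a) / (3 * real (Suc n))" for n
  let ?\<phi> = "\<lambda>n. bump (a + e n) (b - e n) (1 / real (Suc n)) 1 0"
  have e: "e n > 0" "2 * e n < b - a" for n
  proof -
    show "e n > 0" using ab by (simp add: e_def)
    have "e n \<le> (b - a) / 3" unfolding e_def using ab by (intro divide_left_mono) auto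
    then show "2 * e n < b - a" using ab by simp
  qed
  have test: "test_fun T (?\<phi> n)" for n
    using e[of n] ab by (intro test_fun_bump) auto
  have [measurable]: "k \<in> borel_measurable (time T)" using k by auto
  have [measurable]: "?\<phi> n \<in> borel_measurable (time T)" for n
    by (rule continuous_time_bounded(1)[OF test_funD(2)[OF test]])
  have "(\<lambda>n. LINT t|time T. ?\<phi> n t *\<^sub>R k t) \<longlonglongrightarrow> (LINT t|time T. indicator {a<..<b} t *\<^sub>R k t)"
  proof (rule integral_dominated_convergence[where w = "\<lambda>t. norm (k t)"])
    show "AE t in time T. (\<lambda>n. ?\<phi> n t *\<^sub>R k t) \<longlonglongrightarrow> indicator {a<..<b} t *\<^sub>R k t"
      unfolding e_def
      by (intro AE_I2 tendsto_scaleR tendsto_const bump_tendsto_indicator ab)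
    show "AE t in time T. norm (?\<phi> n t *\<^sub>R k t) \<le> norm (k t)" for n
      using bump_bounds[of "1 / real (Suc n)" "a + e n" "b - e n"]
      by (intro AE_I2) (auto intro!: mult_left_le_one_le)
    show "(\<lambda>t. indicator {a<..<b} t *\<^sub>R k t) \<in> borel_measurable (time T)"
      using ab by (intro borel_measurable_scaleR borel_measurable_indicator interval_sets_time) auto
    show "(\<lambda>t. ?\<phi> n t *\<^sub>R k t) \<in> borel_measurable (time T)" for n
      by measurable
  qed (use k in auto)
  moreover have "(LINT t|time T. ?\<phi> n t *\<^sub>R k t) = 0" for n by (rule orth[OF test])
  ultimately show ?thesis by (simp add: LIMSEQ_const_iff)
qed

text \<open>
  Absolute continuity of \<open>\<rho>\<close> with derivative \<open>\<rho>'\<close>, expressed by the fundamental theorem of calculus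
  and by integration by parts against test functions.
\<close>

definition has_weak_primitive :: "real \<Rightarrow> (real \<Rightarrow> real) \<Rightarrow> (real \<Rightarrow> real) \<Rightarrow> bool" where
  "has_weak_primitive T \<rho>' \<rho> \<longleftrightarrow> continuous_on {0..T} \<rho> \<and> integrable (time T) \<rho>' \<and>
     (\<forall>a b. 0 \<le> a \<and> a \<le> b \<and> b \<le> T \<longrightarrow> (LINT t|time T. indicator {a<..<b} t * \<rho>' t) = \<rho> b - \<rho> a) \<and>
     (\<forall>\<phi>. test_fun T \<phi> \<longrightarrow> (LINT t|time T. deriv \<phi> t * \<rho> t) = - (LINT t|time T. \<phi> t * \<rho>' t))"

lemma integral_time_of_has_integral:
  fixes f :: "real \<Rightarrow> real"
  assumes int: "integrable (time T) f" and f: "(f has_integral I) {a..b}" and ab: "0 \<le> a" "a \<le> b" "b \<le> T"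
  shows "(LINT t|time T. indicator {a<..<b} t * f t) = I"
proof -
  have *: "(\<lambda>t. indicator {a<..<b} t * f t) = (\<lambda>t. indicator {a<..<b} t *\<^sub>R f t)" by simp
  have "integrable lebesgue (\<lambda>t. indicator {0<..<T} t *\<^sub>R f t)"
    using int by (simp add: integrable_restrict_space)
  then have "set_integrable lebesgue {0<..<T} f" by (simp add: set_integrable_def)
  then have "set_integrable lebesgue {a<..<b} f"
    by (rule set_integrable_subset) (use ab in auto)
  then have "(LINT t:{a<..<b}|lebesgue. f t) = integral {a<..<b} f"
    by (rule set_lebesgue_integral_eq_integral)
  also have "\<dots> = I"
    using f by (intro integral_unique) (simp add: has_integral_Icc_iff_Ioo)
  finally have "(LINT t|lebesgue. indicator {a<..<b} t * f t) = I"
    by (simp add: set_lebesgue_integral_def)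
  moreover have "(LINT t|time T. indicator {a<..<b} t * f t)
      = (LINT t|lebesgue. indicator {0<..<T} t *\<^sub>R (indicator {a<..<b} t * f t))"
    by (rule integral_restrict_space) simp
  moreover have "(\<lambda>t. indicator {0<..<T} t *\<^sub>R (indicator {a<..<b} t * f t)) = (\<lambda>t. indicator {a<..<b} t * f t)"
    using ab by (intro ext) (auto simp: indicator_def)
  ultimately show ?thesis by (simp only:)
qed

text \<open>
  The sign of the derivative turns Henstock-Kurzweil integrability, which the fundamental theorem
  provides, into absolute integrability; the kernels of fractional integration are singular.
\<close>

lemma has_weak_primitive_mono:
  assumes cont: "continuous_on {0..T} \<rho>" and T: "0 \<le> T" and "finite S"
    and deriv: "\<And>t. t \<in> {0<..<T} - S \<Longrightarrow> (\<rho> has_real_derivative \<rho>' t) (at t)"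
    and nonneg: "\<And>t. \<rho>' t \<ge> 0"
  shows "has_weak_primitive T \<rho>' \<rho>"
proof -
  have FTC: "(\<rho>' has_integral \<rho> b - \<rho> a) {a..b}" if "0 \<le> a" "a \<le> b" "b \<le> T" for a b
  proof (rule fundamental_theorem_of_calculus_interior_strong[OF \<open>finite S\<close> \<open>a \<le> b\<close>])
    show "(\<rho> has_vector_derivative \<rho>' x) (at x)" if "x \<in> {a<..<b} - S" for x
      using deriv[of x] that \<open>0 \<le> a\<close> \<open>b \<le> T\<close> by (simp add: has_real_derivative_iff_has_vector_derivative)
    show "continuous_on {a..b} \<rho>" using continuous_on_subset[OF cont] that by auto
  qed
  have "\<rho>' absolutely_integrable_on {0..T}"
    using FTC[of 0 T] T nonneg by (intro nonnegative_absolutely_integrable_1) (auto simp: integrable_on_def)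
  then have "set_integrable lebesgue {0<..<T} \<rho>'"
    by (rule set_integrable_subset) auto
  then have int: "integrable (time T) \<rho>'"
    by (simp add: integrable_restrict_space set_integrable_def)
  have "(LINT t|time T. deriv \<phi> t * \<rho> t) = - (LINT t|time T. \<phi> t * \<rho>' t)" if \<phi>: "test_fun T \<phi>" for \<phi>
  proof -
    have int1: "integrable (time T) (\<lambda>t. \<phi> t * \<rho>' t)"
      using integrable_continuous_scaleR[OF test_funD(2)[OF \<phi>] int] by simp
    have "integrable (time T) (\<lambda>t. (deriv \<phi> t * \<rho> t) *\<^sub>R (1::real))"
    proof (rule integrable_continuous_scaleR)
      show "continuous_on {0..T} (\<lambda>t. deriv \<phi> t * \<rho> t)"
        by (intro continuous_intros cont test_funD[OF \<phi>])
      show "integrable (time T) (\<lambda>t. 1::real)"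
        by (intro finite_measure.integrable_const finite_measure_lebesgue_on) simp
    qed
    then have int2: "integrable (time T) (\<lambda>t. deriv \<phi> t * \<rho> t)" by simp
    have "((\<lambda>t. deriv \<phi> t * \<rho> t + \<phi> t * \<rho>' t) has_integral \<phi> T * \<rho> T - \<phi> 0 * \<rho> 0) {0..T}"
    proof (rule fundamental_theorem_of_calculus_interior_strong[OF \<open>finite S\<close> T])
      show "((\<lambda>t. \<phi> t * \<rho> t) has_vector_derivative deriv \<phi> t * \<rho> t + \<phi> t * \<rho>' t) (at t)"
        if "t \<in> {0<..<T} - S" for t
        using DERIV_mult[OF test_funD(1)[OF \<phi>] deriv[OF that]]
        by (simp add: has_real_derivative_iff_has_vector_derivative mult.commute add.commute)
      show "continuous_on {0..T} (\<lambda>t. \<phi> t * \<rho> t)"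
        by (intro continuous_intros cont test_funD[OF \<phi>])
    qed
    then have "(LINT t|time T. indicator {0<..<T} t * (deriv \<phi> t * \<rho> t + \<phi> t * \<rho>' t)) = 0"
      using integral_time_of_has_integral[OF Bochner_Integration.integrable_add[OF int2 int1]] T
        test_funD(4)[OF \<phi>, of 0] test_funD(4)[OF \<phi>, of T] by auto
    moreover have "(LINT t|time T. indicator {0<..<T} t * (deriv \<phi> t * \<rho> t + \<phi> t * \<rho>' t))
        = (LINT t|time T. deriv \<phi> t * \<rho> t + \<phi> t * \<rho>' t)"
      by (rule Bochner_Integration.integral_cong) (auto simp: space_restrict_space)
    ultimately show ?thesis using int1 int2 by simp
  qed
  with cont int integral_time_of_has_integral[OF int FTC] show ?thesis
    by (auto simp: has_weak_primitive_def)
qed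

lemma has_weak_primitive_diff:
  assumes "has_weak_primitive T \<rho>' \<rho>" "has_weak_primitive T \<sigma>' \<sigma>"
  shows "has_weak_primitive T (\<lambda>t. \<rho>' t - \<sigma>' t) (\<lambda>t. \<rho> t - \<sigma> t)"
  unfolding has_weak_primitive_def
proof (intro conjI allI impI)
  have int: "integrable (time T) \<rho>'" "integrable (time T) \<sigma>'"
    and cont: "continuous_on {0..T} \<rho>" "continuous_on {0..T} \<sigma>"
    using assms by (auto simp: has_weak_primitive_def)
  have one: "integrable (time T) (\<lambda>t. 1::real)"
    by (intro finite_measure.integrable_const finite_measure_lebesgue_on) simp
  show "continuous_on {0..T} (\<lambda>t. \<rho> t - \<sigma> t)" by (intro continuous_intros cont)
  show "integrable (time T) (\<lambda>t. \<rho>' t - \<sigma>' t)" using int by simp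
  show "(LINT t|time T. indicator {a<..<b} t * (\<rho>' t - \<sigma>' t)) = \<rho> b - \<sigma> b - (\<rho> a - \<sigma> a)"
    if "0 \<le> a \<and> a \<le> b \<and> b \<le> T" for a b
  proof -
    have "integrable (time T) (\<lambda>t. indicator {a<..<b} t * f t)" if "integrable (time T) f" for f :: "real \<Rightarrow> real"
      using integrable_interval[OF that, of a b] \<open>0 \<le> a \<and> a \<le> b \<and> b \<le> T\<close> by simp
    then show ?thesis
      using assms that int by (simp add: right_diff_distrib has_weak_primitive_def)
  qed
  show "(LINT t|time T. deriv \<phi> t * (\<rho> t - \<sigma> t)) = - (LINT t|time T. \<phi> t * (\<rho>' t - \<sigma>' t))"
    if \<phi>: "test_fun T \<phi>" for \<phi>
  proof -
    have "integrable (time T) (\<lambda>t. \<phi> t * f t)" if "integrable (time T) f" for f :: "real \<Rightarrow> real"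
      using integrable_continuous_scaleR[OF test_funD(2)[OF \<phi>] that] by simp
    moreover have "integrable (time T) (\<lambda>t. deriv \<phi> t * f t)" if "continuous_on {0..T} f" for f
    proof -
      have "integrable (time T) (\<lambda>t. (deriv \<phi> t * f t) *\<^sub>R (1::real))"
        by (intro integrable_continuous_scaleR continuous_intros that test_funD[OF \<phi>] one)
      then show ?thesis by simp
    qed
    ultimately show ?thesis
      using assms \<phi> int cont by (simp add: right_diff_distrib has_weak_primitive_def)
  qed
qed

text \<open>
  \<open>weak_deriv\<close> chooses an arbitrary weak derivative; by the fundamental lemma its integrals over
  intervals are those of the explicit one \<open>\<Sum>\<^sub>j \<rho>'\<^sub>j w\<^sub>j\<close>.
\<close>

lemma weak_deriv_integral:
  fixes F :: "real \<Rightarrow> 'a::{banach,second_countable_topology}"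
  assumes I: "finite I" and \<rho>: "\<And>j. j \<in> I \<Longrightarrow> has_weak_primitive T (\<rho>' j) (\<rho> j)"
    and F: "\<And>t. t \<in> {0<..<T} \<Longrightarrow> F t = (\<Sum>j\<in>I. \<rho> j t *\<^sub>R w j)"
  shows "integrable (time T) (weak_deriv T F)"
    and "0 \<le> a \<Longrightarrow> a < b \<Longrightarrow> b \<le> T \<Longrightarrow>
      (LINT t|time T. indicator {a<..<b} t *\<^sub>R weak_deriv T F t) = (\<Sum>j\<in>I. (\<rho> j b - \<rho> j a) *\<^sub>R w j)"
proof -
  define h where "h t = (\<Sum>j\<in>I. \<rho>' j t *\<^sub>R w j)" for t
  have int: "integrable (time T) (\<rho>' j)" "continuous_on {0..T} (\<rho> j)" if "j \<in> I" for j
    using \<rho>[OF that] by (auto simp: has_weak_primitive_def)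
  have h: "integrable (time T) h"
    unfolding h_def using int by (intro Bochner_Integration.integrable_sum integrable_scaleR_left) auto
  have sum: "(LINT t|time T. k t *\<^sub>R (\<Sum>j\<in>I. \<sigma> j t *\<^sub>R w j)) = (\<Sum>j\<in>I. (LINT t|time T. k t * \<sigma> j t) *\<^sub>R w j)"
    if "\<And>j. j \<in> I \<Longrightarrow> integrable (time T) (\<lambda>t. k t * \<sigma> j t)" for k \<sigma>
    using that by (simp add: scaleR_sum_right Bochner_Integration.integral_sum)
  have h_weak: "is_weak_deriv T F h"
    unfolding is_weak_deriv_def
  proof (intro conjI h allI impI)
    fix \<phi> assume \<phi>: "test_fun T \<phi>"
    have "integrable (time T) (\<lambda>t. deriv \<phi> t * \<rho> j t)" if "j \<in> I" for j
    proof -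
      have "integrable (time T) (\<lambda>t. (deriv \<phi> t * \<rho> j t) *\<^sub>R (1::real))"
        by (intro integrable_continuous_scaleR continuous_intros int[OF that] test_funD[OF \<phi>]
            finite_measure.integrable_const finite_measure_lebesgue_on) simp
      then show ?thesis by simp
    qed
    moreover have "integrable (time T) (\<lambda>t. \<phi> t * \<rho>' j t)" if "j \<in> I" for j
      using integrable_continuous_scaleR[OF test_funD(2)[OF \<phi>] int(1)[OF that]] by simp
    moreover have "(LINT t|time T. deriv \<phi> t *\<^sub>R F t) = (LINT t|time T. deriv \<phi> t *\<^sub>R (\<Sum>j\<in>I. \<rho> j t *\<^sub>R w j))"
      by (rule Bochner_Integration.integral_cong) (auto simp: space_restrict_space F)
    moreover have "(LINT t|time T. deriv \<phi> t * \<rho> j t) = - (LINT t|time T. \<phi> t * \<rho>' j t)" if "j \<in> I" for j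
      using \<rho>[OF that] \<phi> by (auto simp: has_weak_primitive_def)
    ultimately show "(LINT t|time T. deriv \<phi> t *\<^sub>R F t) = - (LINT t|time T. \<phi> t *\<^sub>R h t)"
      by (simp add: sum h_def sum_negf)
  qed
  then have w: "is_weak_deriv T F (weak_deriv T F)"
    unfolding weak_deriv_def by (rule someI[of "is_weak_deriv T F"])
  then show i: "integrable (time T) (weak_deriv T F)" by (simp add: is_weak_deriv_def)
  assume ab: "0 \<le> a" "a < b" "b \<le> T"
  have "(LINT t|time T. indicator {a<..<b} t *\<^sub>R (weak_deriv T F t - h t)) = 0"
  proof (rule test_fun_orthogonal_imp_interval_zero[OF _ _ ab])
    fix \<phi> assume \<phi>: "test_fun T \<phi>"
    show "(LINT t|time T. \<phi> t *\<^sub>R (weak_deriv T F t - h t)) = 0"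
      using Bochner_Integration.integral_diff[OF integrable_continuous_scaleR[OF test_funD(2)[OF \<phi>] i]
          integrable_continuous_scaleR[OF test_funD(2)[OF \<phi>] h]] w h_weak \<phi>
      by (simp add: scaleR_diff_right is_weak_deriv_def)
  qed (use i h in simp)
  then have "(LINT t|time T. indicator {a<..<b} t *\<^sub>R weak_deriv T F t) = (LINT t|time T. indicator {a<..<b} t *\<^sub>R h t)"
    using integrable_interval[OF i, of a b] integrable_interval[OF h, of a b] ab
    by (simp add: scaleR_diff_right)
  also have "\<dots> = (\<Sum>j\<in>I. (LINT t|time T. indicator {a<..<b} t * \<rho>' j t) *\<^sub>R w j)"
    unfolding h_def using integrable_interval[OF int(1), of _ a b] ab by (intro sum) simp
  also have "\<dots> = (\<Sum>j\<in>I. (\<rho> j b - \<rho> j a) *\<^sub>R w j)"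
    using \<rho> ab by (intro sum.cong) (auto simp: has_weak_primitive_def)
  finally show "(LINT t|time T. indicator {a<..<b} t *\<^sub>R weak_deriv T F t) = \<dots>" .
qed

section \<open>Piecewise constant functions\<close>

definition cell :: "real \<Rightarrow> nat \<Rightarrow> nat \<Rightarrow> real set" where
  "cell T J k = {node T J (k - 1)<..<node T J k}"

definition cell_value :: "real \<Rightarrow> nat \<Rightarrow> (real \<Rightarrow> 'a) \<Rightarrow> nat \<Rightarrow> 'a" where
  "cell_value T J V k = V ((node T J (k - 1) + node T J k) / 2)"

lemma node_0: "node T J 0 = 0"
  by (simp add: node_def)

lemma node_end: "J > 0 \<Longrightarrow> node T J J = T"
  by (simp add: node_def)

lemma node_mono:
  assumes "0 < T" "0 < J"
  shows "i \<le> j \<Longrightarrow> node T J i \<le> node T J j" and "i < j \<Longrightarrow> node T J i < node T J j"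
  using assms by (auto simp: node_def intro!: mult_right_mono divide_right_mono divide_strict_right_mono)

lemma node_bounds:
  assumes "0 < T" "0 < J" "k \<in> {1..J}"
  shows "0 \<le> node T J (k - 1)" "node T J (k - 1) < node T J k" "node T J k \<le> T"
    "node T J k - node T J (k - 1) = T / real J"
proof -
  show "0 \<le> node T J (k - 1)" "node T J (k - 1) < node T J k" "node T J k \<le> T"
    using node_mono(1)[OF assms(1,2), of 0 "k - 1"] node_mono(2)[OF assms(1,2), of "k - 1" k]
      node_mono(1)[OF assms(1,2), of k J] node_0[of T J] node_end[OF assms(2), of T] assms(3)
    by auto
  have "real k * c - real (k - 1) * c = c" for c
    using assms(3) by (simp add: of_nat_diff algebra_simps)
  then show "node T J k - node T J (k - 1) = T / real J" by (simp only: node_def)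
qed

lemma W_space_value:
  assumes V: "V \<in> W_space T J" and J: "0 < T" "0 < J" "k \<in> {1..J}" and t: "t \<in> cell T J k"
  shows "V t = cell_value T J V k"
proof -
  obtain b where b: "\<And>t. node T J (k - 1) < t \<Longrightarrow> t < node T J k \<Longrightarrow> V t = b"
    using V J(3) unfolding W_space_def by blast
  from node_bounds(2)[OF J] b[of t] b[of "(node T J (k - 1) + node T J k) / 2"] t show ?thesis
    by (simp add: cell_value_def cell_def)
qed

lemma cell_disjoint:
  assumes J: "0 < T" "0 < J" and "t \<in> cell T J j" "t \<in> cell T J k" "j \<in> {1..J}" "k \<in> {1..J}"
  shows "j = k"
proof (rule ccontr)
  assume "j \<noteq> k"
  then have "j \<le> k - 1 \<or> k \<le> j - 1" using assms by auto
  then show False using node_mono(1)[OF J, of j "k - 1"] node_mono(1)[OF J, of k "j - 1"] assms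
    by (auto simp: cell_def)
qed

lemma AE_in_cell:
  assumes "0 < T" "0 < J"
  shows "AE t in time T. \<exists>k\<in>{1..J}. t \<in> cell T J k"
proof -
  have "node T J ` {..J} \<in> null_sets lebesgue"
    by (simp add: negligible_finite flip: negligible_iff_null_sets)
  then have "AE t in lebesgue. t \<notin> node T J ` {..J}" by (rule AE_not_in)
  then have "AE t in time T. t \<notin> node T J ` {..J}" by (auto simp: AE_restrict_space_iff)
  moreover have "AE t in time T. t \<in> {0<..<T}"
    by (rule AE_I2) (simp add: space_restrict_space)
  ultimately show ?thesis
  proof eventually_elim
    case (elim t)
    define k where "k = (LEAST k. t < node T J k)"
    have "t < node T J J" using elim(2) assms by (simp add: node_end)
    then have k: "t < node T J k" "k \<le> J"
      unfolding k_def by (rule LeastI, rule Least_le)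
    have "k \<noteq> 0"
    proof
      assume "k = 0"
      with k(1) elim(2) show False by (simp add: node_0)
    qed
    then have "k - 1 < k" by simp
    then have "\<not> t < node T J (k - 1)" unfolding k_def by (rule not_less_Least)
    moreover have "t \<noteq> node T J (k - 1)" using elim(1) k by auto
    ultimately have "t \<in> cell T J k" using k by (simp add: cell_def)
    with k \<open>k \<noteq> 0\<close> show ?case by (intro bexI[of _ k]) auto
  qed
qed

lemma sum_cell_indicator:
  assumes "0 < T" "0 < J" "k \<in> {1..J}" "t \<in> cell T J k"
  shows "(\<Sum>j\<in>{1..J}. indicator (cell T J j) t *\<^sub>R f j) = (f k :: 'a::real_vector)"
proof -
  have "(\<Sum>j\<in>{1..J}. indicator (cell T J j) t *\<^sub>R f j) = (\<Sum>j\<in>{1..J}. if j = k then f k else 0)"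
  proof (rule sum.cong[OF refl])
    fix j assume j: "j \<in> {1..J}"
    show "indicator (cell T J j) t *\<^sub>R f j = (if j = k then f k else 0)"
      using cell_disjoint[OF assms(1,2) _ assms(4) j assms(3)] assms(4)
      by (cases "t \<in> cell T J j") auto
  qed
  then show ?thesis using assms(3) by simp
qed

lemma AE_cell_decomposition:
  fixes F :: "real \<Rightarrow> 'x \<Rightarrow> 'b::real_vector"
  assumes "V \<in> W_space T J" "0 < T" "0 < J"
  shows "AE t in time T. F t (V t) = (\<Sum>k\<in>{1..J}. indicator (cell T J k) t *\<^sub>R F t (cell_value T J V k))"
  using AE_in_cell[OF assms(2,3)]
proof eventually_elim
  case (elim t)
  then obtain k where k: "k \<in> {1..J}" "t \<in> cell T J k" by blast
  show ?case
    using sum_cell_indicator[OF assms(2,3) k, of "\<lambda>j. F t (cell_value T J V j)"]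
    by (simp add: W_space_value[OF assms k])
qed

lemma integral_time_AE_eq:
  fixes f g :: "real \<Rightarrow> 'b::{banach,second_countable_topology}"
  assumes "AE t in time T. f t = g t"
  shows "integrable (time T) f \<longleftrightarrow> integrable (time T) g" "(LINT t|time T. f t) = (LINT t|time T. g t)"
proof -
  interpret complete_finite_measure "time T" by (rule complete_finite_measure_time)
  show "integrable (time T) f \<longleftrightarrow> integrable (time T) g" "(LINT t|time T. f t) = (LINT t|time T. g t)"
    using integral_AE_eq[OF assms] by auto
qed

lemma integrable_cell:
  fixes f :: "real \<Rightarrow> 'a::{banach,second_countable_topology}"
  assumes "integrable (time T) f" "0 < T" "0 < J" "k \<in> {1..J}"
  shows "integrable (time T) (\<lambda>t. indicator (cell T J k) t *\<^sub>R f t)"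
  unfolding cell_def using node_bounds[OF assms(2-4)] by (intro integrable_interval assms) auto

lemma integral_cell_decomposition:
  fixes F :: "real \<Rightarrow> 'x \<Rightarrow> 'b::{banach,second_countable_topology}"
  assumes V: "V \<in> W_space T J" "0 < T" "0 < J"
    and F: "\<And>k. k \<in> {1..J} \<Longrightarrow> integrable (time T) (\<lambda>t. indicator (cell T J k) t *\<^sub>R F t (cell_value T J V k))"
  shows "integrable (time T) (\<lambda>t. F t (V t))"
    and "(LINT t|time T. F t (V t)) =
    (\<Sum>k\<in>{1..J}. LINT t|time T. indicator (cell T J k) t *\<^sub>R F t (cell_value T J V k))"
proof -
  note eq = integral_time_AE_eq[OF AE_cell_decomposition[OF V, of F]]
  show "integrable (time T) (\<lambda>t. F t (V t))"
    unfolding eq(1) by (rule Bochner_Integration.integrable_sum[OF F])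
  show "(LINT t|time T. F t (V t)) =
      (\<Sum>k\<in>{1..J}. LINT t|time T. indicator (cell T J k) t *\<^sub>R F t (cell_value T J V k))"
    unfolding eq(2) by (rule Bochner_Integration.integral_sum[OF F])
qed

lemma integral_cell_const:
  fixes c :: "'b::{banach,second_countable_topology}"
  assumes "0 < T" "0 < J" "k \<in> {1..J}"
  shows "integrable (time T) (\<lambda>t. indicator (cell T J k) t *\<^sub>R c)"
    and "(LINT t|time T. indicator (cell T J k) t *\<^sub>R c) = (T / real J) *\<^sub>R c"
proof -
  have one: "integrable (time T) (\<lambda>t. 1::real)"
    by (intro finite_measure.integrable_const finite_measure_lebesgue_on) simp
  have i: "integrable (time T) (\<lambda>t. indicator (cell T J k) t :: real)"
    using integrable_cell[OF one assms] by simp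
  then show "integrable (time T) (\<lambda>t. indicator (cell T J k) t *\<^sub>R c)" by simp
  have "((\<lambda>t. 1::real) has_integral (node T J k - node T J (k - 1))) {node T J (k - 1)..node T J k}"
    using has_integral_const_real[of "1::real" "node T J (k - 1)" "node T J k"] node_bounds[OF assms] by simp
  from integral_time_of_has_integral[OF one this]
  have "(LINT t|time T. indicator (cell T J k) t) = T / real J"
    using node_bounds[OF assms] by (simp add: cell_def)
  with i show "(LINT t|time T. indicator (cell T J k) t *\<^sub>R c) = (T / real J) *\<^sub>R c" by simp
qed

definition cell_fun :: "real \<Rightarrow> nat \<Rightarrow> (nat \<Rightarrow> 'a::real_vector) \<Rightarrow> real \<Rightarrow> 'a" where
  "cell_fun T J v t = (\<Sum>k\<in>{1..J}. indicator (cell T J k) t *\<^sub>R v k)"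

lemma cell_fun:
  assumes "0 < T" "0 < J"
  shows "cell_fun T J v \<in> W_space T J" and "k \<in> {1..J} \<Longrightarrow> cell_value T J (cell_fun T J v) k = v k"
proof -
  show *: "cell_fun T J v \<in> W_space T J"
    unfolding W_space_def
  proof (intro CollectI ballI)
    fix j assume j: "j \<in> {1..J}"
    show "\<exists>b. \<forall>t. node T J (j - 1) < t \<and> t < node T J j \<longrightarrow> cell_fun T J v t = b"
      using sum_cell_indicator[OF assms j, of _ v]
      by (intro exI[of _ "v j"] allI impI) (simp only: cell_fun_def cell_def greaterThanLessThan_iff)
  qed
  show "cell_value T J (cell_fun T J v) k = v k" if "k \<in> {1..J}"
    unfolding cell_value_def cell_fun_def using node_bounds(2)[OF assms that]
    by (intro sum_cell_indicator[OF assms that]) (simp add: cell_def)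
qed

lemma lim_right_node:
  assumes "V \<in> W_space T J" "0 < T" "0 < J" "k < J"
  shows "lim_right V (node T J k) = cell_value T J V (Suc k)"
proof -
  have k: "Suc k \<in> {1..J}" using assms by auto
  have "\<forall>\<^sub>F t in at_right (node T J k). V t = cell_value T J V (Suc k)"
    using eventually_at_right_real[OF node_mono(2)[OF assms(2,3) lessI[of k]]]
  proof eventually_elim
    case (elim t)
    then show ?case by (intro W_space_value[OF assms(1-3) k]) (simp add: cell_def)
  qed
  then have "(V \<longlongrightarrow> cell_value T J V (Suc k)) (at_right (node T J k))"
    by (rule tendsto_eventually)
  then show ?thesis unfolding lim_right_def by (intro tendsto_Lim) auto
qed

lemma lim_left_node:
  assumes "V \<in> W_space T J" "0 < T" "0 < J" "k \<in> {1..J}"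
  shows "lim_left V (node T J k) = cell_value T J V k"
proof -
  have "\<forall>\<^sub>F t in at_left (node T J k). V t = cell_value T J V k"
    using eventually_at_left_real[OF node_bounds(2)[OF assms(2-4)]]
  proof eventually_elim
    case (elim t)
    then show ?case by (intro W_space_value[OF assms]) (simp add: cell_def)
  qed
  then have "(V \<longlongrightarrow> cell_value T J V k) (at_left (node T J k))"
    by (rule tendsto_eventually)
  then show ?thesis unfolding lim_left_def by (intro tendsto_Lim) auto
qed

section \<open>Fractional derivatives of piecewise constant functions\<close>

definition frac_kernel :: "real \<Rightarrow> real \<Rightarrow> real" where
  "frac_kernel \<gamma> x = (if x > 0 then x powr (\<gamma> - 1) / Gamma \<gamma> else 0)"

definition frac_primitive :: "real \<Rightarrow> real \<Rightarrow> real" where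
  "frac_primitive \<gamma> x = (max 0 x) powr \<gamma> / (\<gamma> * Gamma \<gamma>)"

lemma frac_primitive_DERIV:
  assumes "\<gamma> > 0" "x \<noteq> 0"
  shows "(frac_primitive \<gamma> has_real_derivative frac_kernel \<gamma> x) (at x)"
proof (cases "x > 0")
  case True
  have "((\<lambda>x. x powr \<gamma> / (\<gamma> * Gamma \<gamma>)) has_real_derivative \<gamma> * x powr (\<gamma> - 1) / (\<gamma> * Gamma \<gamma>)) (at x)"
    using True by (intro DERIV_cdivide has_real_derivative_powr)
  then have "((\<lambda>x. x powr \<gamma> / (\<gamma> * Gamma \<gamma>)) has_real_derivative frac_kernel \<gamma> x) (at x)"
    using assms True by (simp add: frac_kernel_def)
  then show ?thesis
    by (rule has_field_derivative_transform_within_open[of _ _ _ "{0<..}"])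
      (use True in \<open>auto simp: frac_primitive_def\<close>)
next
  case False
  have "((\<lambda>x. 0) has_real_derivative frac_kernel \<gamma> x) (at x)"
    using False by (simp add: frac_kernel_def)
  then show ?thesis
    by (rule has_field_derivative_transform_within_open[of _ _ _ "{..<0}"])
      (use False assms in \<open>auto simp: frac_primitive_def\<close>)
qed

lemma continuous_on_frac_primitive:
  assumes "\<gamma> > 0" "continuous_on S f"
  shows "continuous_on S (\<lambda>x. frac_primitive \<gamma> (f x))"
proof -
  have "continuous_on S (\<lambda>x. max 0 (f x) powr \<gamma>)"
    by (rule continuous_on_powr') (use assms in \<open>auto intro!: continuous_intros\<close>)
  then show ?thesis
    unfolding frac_primitive_def divide_inverse by (intro continuous_on_mult continuous_on_const)
qed

lemma frac_kernel_nonneg: "\<gamma> > 0 \<Longrightarrow> 0 \<le> frac_kernel \<gamma> x"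
  using Gamma_real_pos[of \<gamma>] by (simp add: frac_kernel_def)

lemma frac_primitive_zero: "x \<le> 0 \<Longrightarrow> frac_primitive \<gamma> x = 0"
  by (simp add: frac_primitive_def)

lemma frac_primitive_pos: "x > 0 \<Longrightarrow> \<gamma> > 0 \<Longrightarrow> frac_primitive \<gamma> x > 0"
  using Gamma_real_pos[of \<gamma>] by (simp add: frac_primitive_def)

lemma has_weak_primitive_left:
  assumes "\<gamma> > 0" "0 \<le> T"
  shows "has_weak_primitive T (\<lambda>t. frac_kernel \<gamma> (t - s)) (\<lambda>t. frac_primitive \<gamma> (t - s))"
proof (rule has_weak_primitive_mono[where S = "{s}"])
  show "((\<lambda>t. frac_primitive \<gamma> (t - s)) has_real_derivative frac_kernel \<gamma> (t - s)) (at t)"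
    if "t \<in> {0<..<T} - {s}" for t
  proof -
    have "((\<lambda>t. t - s) has_real_derivative 1) (at t)" by (auto intro!: derivative_eq_intros)
    with that show ?thesis
      using DERIV_chain2[where f = "frac_primitive \<gamma>" and g = "\<lambda>t. t - s",
          OF frac_primitive_DERIV[OF assms(1)], of t 1 UNIV] by simp
  qed
qed (use assms frac_kernel_nonneg in \<open>auto intro!: continuous_on_frac_primitive continuous_intros\<close>)

lemma has_weak_primitive_right:
  assumes "\<gamma> > 0" "0 \<le> T"
  shows "has_weak_primitive T (\<lambda>t. frac_kernel \<gamma> (s - t)) (\<lambda>t. - frac_primitive \<gamma> (s - t))"
proof (rule has_weak_primitive_mono[where S = "{s}"])
  show "((\<lambda>t. - frac_primitive \<gamma> (s - t)) has_real_derivative frac_kernel \<gamma> (s - t)) (at t)"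
    if "t \<in> {0<..<T} - {s}" for t
  proof -
    have "((\<lambda>t. s - t) has_real_derivative - 1) (at t)" by (auto intro!: derivative_eq_intros)
    with that show ?thesis
      using DERIV_minus[OF DERIV_chain2[where f = "frac_primitive \<gamma>" and g = "\<lambda>t. s - t",
          OF frac_primitive_DERIV[OF assms(1)], of t "- 1" UNIV]] by simp
  qed
qed (use assms frac_kernel_nonneg in \<open>auto intro!: continuous_on_frac_primitive continuous_intros\<close>)

lemma integral_kernel_cells:
  fixes W :: "real \<Rightarrow> 'a::{banach,second_countable_topology}"
  assumes W: "W \<in> W_space T J" "0 < T" "0 < J" and \<kappa>: "has_weak_primitive T \<kappa> \<rho>"
  shows "(LINT s|time T. \<kappa> s *\<^sub>R W s) =
    (\<Sum>j\<in>{1..J}. (\<rho> (node T J j) - \<rho> (node T J (j - 1))) *\<^sub>R cell_value T J W j)"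
proof -
  have int: "integrable (time T) (\<lambda>s. indicator (cell T J j) s *\<^sub>R \<kappa> s)" if "j \<in> {1..J}" for j
    using \<kappa> by (intro integrable_cell W that) (simp add: has_weak_primitive_def)
  then have int': "integrable (time T) (\<lambda>s. indicator (cell T J j) s *\<^sub>R \<kappa> s *\<^sub>R cell_value T J W j)" if "j \<in> {1..J}" for j
    using that integrable_scaleR_left[OF int[OF that], of "cell_value T J W j"] by simp
  have "(LINT s|time T. \<kappa> s *\<^sub>R W s)
      = (\<Sum>j\<in>{1..J}. LINT s|time T. indicator (cell T J j) s *\<^sub>R \<kappa> s *\<^sub>R cell_value T J W j)"
    by (rule integral_cell_decomposition(2)[OF W, of "\<lambda>s. scaleR (\<kappa> s)"]) (rule int')
  also have "\<dots> = (\<Sum>j\<in>{1..J}. (LINT s|time T. indicator (cell T J j) s * \<kappa> s) *\<^sub>R cell_value T J W j)"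
    using int by (intro sum.cong) simp_all
  also have "\<dots> = (\<Sum>j\<in>{1..J}. (\<rho> (node T J j) - \<rho> (node T J (j - 1))) *\<^sub>R cell_value T J W j)"
    using \<kappa> node_bounds[OF W(2,3)] by (intro sum.cong) (auto simp: has_weak_primitive_def cell_def less_imp_le)
  finally show ?thesis .
qed

lemma frac_int_left_eq:
  assumes W: "W \<in> W_space T J" "0 < T" "0 < J" and \<gamma>: "0 < \<gamma>" and t: "t \<in> {0<..<T}"
  shows "frac_int_left \<gamma> W t = (\<Sum>j\<in>{1..J}. (frac_primitive \<gamma> (t - node T J (j - 1)) -
    frac_primitive \<gamma> (t - node T J j)) *\<^sub>R cell_value T J W j)"
proof -
  have "frac_int_left \<gamma> W t = (1 / Gamma \<gamma>) *\<^sub>R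
      (LINT s|lebesgue. indicator {0<..<t} s *\<^sub>R (t - s) powr (\<gamma> - 1) *\<^sub>R W s)"
    using \<gamma> by (simp add: frac_int_left_def integral_restrict_space)
  also have "\<dots> = (LINT s|lebesgue. (1 / Gamma \<gamma>) *\<^sub>R indicator {0<..<t} s *\<^sub>R (t - s) powr (\<gamma> - 1) *\<^sub>R W s)"
    by (rule integral_scaleR_right[symmetric])
  also have "\<dots> = (LINT s|lebesgue. indicator {0<..<T} s *\<^sub>R frac_kernel \<gamma> (t - s) *\<^sub>R W s)"
    using t by (intro Bochner_Integration.integral_cong) (auto simp: frac_kernel_def indicator_def)
  also have "\<dots> = (LINT s|time T. frac_kernel \<gamma> (t - s) *\<^sub>R W s)"
    by (simp add: integral_restrict_space)
  also have "\<dots> = (\<Sum>j\<in>{1..J}. (- frac_primitive \<gamma> (t - node T J j) - - frac_primitive \<gamma> (t - node T J (j - 1)))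
      *\<^sub>R cell_value T J W j)"
    by (rule integral_kernel_cells[OF W has_weak_primitive_right[OF \<gamma>]]) (use W in simp)
  finally show ?thesis by simp
qed

lemma frac_int_right_eq:
  assumes W: "W \<in> W_space T J" "0 < T" "0 < J" and \<gamma>: "0 < \<gamma>" and t: "t \<in> {0<..<T}"
  shows "frac_int_right T \<gamma> W t = (\<Sum>j\<in>{1..J}. (frac_primitive \<gamma> (node T J j - t) -
    frac_primitive \<gamma> (node T J (j - 1) - t)) *\<^sub>R cell_value T J W j)"
proof -
  have "frac_int_right T \<gamma> W t = (1 / Gamma \<gamma>) *\<^sub>R
      (LINT s|lebesgue. indicator {t<..<T} s *\<^sub>R (s - t) powr (\<gamma> - 1) *\<^sub>R W s)"
    using \<gamma> by (simp add: frac_int_right_def integral_restrict_space)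
  also have "\<dots> = (LINT s|lebesgue. (1 / Gamma \<gamma>) *\<^sub>R indicator {t<..<T} s *\<^sub>R (s - t) powr (\<gamma> - 1) *\<^sub>R W s)"
    by (rule integral_scaleR_right[symmetric])
  also have "\<dots> = (LINT s|lebesgue. indicator {0<..<T} s *\<^sub>R frac_kernel \<gamma> (s - t) *\<^sub>R W s)"
    using t by (intro Bochner_Integration.integral_cong) (auto simp: frac_kernel_def indicator_def)
  also have "\<dots> = (LINT s|time T. frac_kernel \<gamma> (s - t) *\<^sub>R W s)"
    by (simp add: integral_restrict_space)
  also have "\<dots> = (\<Sum>j\<in>{1..J}. (frac_primitive \<gamma> (node T J j - t) - frac_primitive \<gamma> (node T J (j - 1) - t))
      *\<^sub>R cell_value T J W j)"
    by (rule integral_kernel_cells[OF W has_weak_primitive_left[OF \<gamma>]]) (use W in simp)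
  finally show ?thesis by simp
qed

text \<open>
  For \<open>\<alpha> < 1\<close> the entry is the integral over the \<open>k\<close>-th cell of the fractional derivative of the
  indicator function of the \<open>j\<close>-th cell; for \<open>\<alpha> = 1\<close> it encodes the jumps of the backward Euler
  scheme.
\<close>

definition scheme_matrix :: "real \<Rightarrow> nat \<Rightarrow> real \<Rightarrow> nat \<Rightarrow> nat \<Rightarrow> real" where
  "scheme_matrix T J \<alpha> k j = (if \<alpha> < 1
     then (frac_primitive (1 - \<alpha>) (node T J k - node T J (j - 1)) - frac_primitive (1 - \<alpha>) (node T J k - node T J j))
        - (frac_primitive (1 - \<alpha>) (node T J (k - 1) - node T J (j - 1)) - frac_primitive (1 - \<alpha>) (node T J (k - 1) - node T J j))
     else if j = k then 1 else if Suc j = k then -1 else 0)"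

lemma frac_deriv_left_cell:
  assumes W: "W \<in> W_space T J" "0 < T" "0 < J" and \<alpha>: "0 < \<alpha>" "\<alpha> < 1"
  shows "integrable (time T) (frac_deriv_left T \<alpha> W)"
    and "k \<in> {1..J} \<Longrightarrow> (LINT t|time T. indicator (cell T J k) t *\<^sub>R frac_deriv_left T \<alpha> W t)
      = (\<Sum>j\<in>{1..J}. scheme_matrix T J \<alpha> k j *\<^sub>R cell_value T J W j)"
proof -
  let ?\<gamma> = "1 - \<alpha>"
  let ?\<rho>' = "\<lambda>j t. frac_kernel ?\<gamma> (t - node T J (j - 1)) - frac_kernel ?\<gamma> (t - node T J j)"
  let ?\<rho> = "\<lambda>j t. frac_primitive ?\<gamma> (t - node T J (j - 1)) - frac_primitive ?\<gamma> (t - node T J j)"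
  have \<gamma>: "?\<gamma> > 0" using \<alpha> by simp
  have \<rho>: "has_weak_primitive T (?\<rho>' j) (?\<rho> j)" for j
    using \<gamma> W by (intro has_weak_primitive_diff has_weak_primitive_left) auto
  note * = weak_deriv_integral[of "{1..J}" T ?\<rho>' ?\<rho> "frac_int_left ?\<gamma> W" "cell_value T J W",
      OF _ \<rho> frac_int_left_eq[OF W \<gamma>]]
  show "integrable (time T) (frac_deriv_left T \<alpha> W)"
    unfolding frac_deriv_left_def by (rule *(1)) auto
  show "(LINT t|time T. indicator (cell T J k) t *\<^sub>R frac_deriv_left T \<alpha> W t)
      = (\<Sum>j\<in>{1..J}. scheme_matrix T J \<alpha> k j *\<^sub>R cell_value T J W j)" if k: "k \<in> {1..J}"
    unfolding frac_deriv_left_def cell_def scheme_matrix_def using \<alpha>(2) node_bounds[OF W(2,3) k]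
    by (subst *(2)) auto
qed

text \<open>
  The kernel depends on the difference of the times only, so exchanging past and future exchanges
  the two indices.
\<close>

lemma frac_deriv_right_cell:
  assumes W: "W \<in> W_space T J" "0 < T" "0 < J" and \<alpha>: "0 < \<alpha>" "\<alpha> < 1"
  shows "integrable (time T) (frac_deriv_right T \<alpha> W)"
    and "k \<in> {1..J} \<Longrightarrow> (LINT t|time T. indicator (cell T J k) t *\<^sub>R frac_deriv_right T \<alpha> W t)
      = (\<Sum>j\<in>{1..J}. scheme_matrix T J \<alpha> j k *\<^sub>R cell_value T J W j)"
proof -
  let ?\<gamma> = "1 - \<alpha>"
  let ?\<rho>' = "\<lambda>j t. frac_kernel ?\<gamma> (node T J (j - 1) - t) - frac_kernel ?\<gamma> (node T J j - t)"
  let ?\<rho> = "\<lambda>j t. - frac_primitive ?\<gamma> (node T J (j - 1) - t) - - frac_primitive ?\<gamma> (node T J j - t)"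
  have \<gamma>: "?\<gamma> > 0" using \<alpha> by simp
  have \<rho>: "has_weak_primitive T (?\<rho>' j) (?\<rho> j)" for j
    using \<gamma> W by (intro has_weak_primitive_diff has_weak_primitive_right) auto
  have F: "frac_int_right T ?\<gamma> W t = (\<Sum>j\<in>{1..J}. ?\<rho> j t *\<^sub>R cell_value T J W j)" if "t \<in> {0<..<T}" for t
    using frac_int_right_eq[OF W \<gamma> that] by simp
  note * = weak_deriv_integral[of "{1..J}" T ?\<rho>' ?\<rho> "frac_int_right T ?\<gamma> W" "cell_value T J W",
      OF _ \<rho> F]
  have i: "integrable (time T) (weak_deriv T (frac_int_right T ?\<gamma> W))"
    by (rule *(1)) auto
  then show "integrable (time T) (frac_deriv_right T \<alpha> W)"
    unfolding frac_deriv_right_def by simp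
  show "(LINT t|time T. indicator (cell T J k) t *\<^sub>R frac_deriv_right T \<alpha> W t)
      = (\<Sum>j\<in>{1..J}. scheme_matrix T J \<alpha> j k *\<^sub>R cell_value T J W j)" if k: "k \<in> {1..J}"
  proof -
    have "(LINT t|time T. indicator (cell T J k) t *\<^sub>R frac_deriv_right T \<alpha> W t)
        = - (LINT t|time T. indicator (cell T J k) t *\<^sub>R weak_deriv T (frac_int_right T ?\<gamma> W) t)"
      by (simp add: frac_deriv_right_def)
    also have "\<dots> = - (\<Sum>j\<in>{1..J}. (?\<rho> j (node T J k) - ?\<rho> j (node T J (k - 1))) *\<^sub>R cell_value T J W j)"
      unfolding cell_def using node_bounds[OF W(2,3) k] by (subst *(2)) auto
    also have "\<dots> = (\<Sum>j\<in>{1..J}. scheme_matrix T J \<alpha> j k *\<^sub>R cell_value T J W j)"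
      unfolding sum_negf[symmetric] scaleR_minus_left[symmetric] scheme_matrix_def
      using \<alpha>(2) by (intro sum.cong) (auto simp: algebra_simps)
    finally show ?thesis .
  qed
qed

lemma scheme_matrix_triangular:
  assumes "0 < T" "0 < J" "k < j" "\<alpha> \<le> 1"
  shows "scheme_matrix T J \<alpha> k j = 0"
  using node_mono(1)[OF assms(1,2), of k "j - 1"] node_mono(1)[OF assms(1,2), of k j]
    node_mono(1)[OF assms(1,2), of "k - 1" "j - 1"] node_mono(1)[OF assms(1,2), of "k - 1" j] assms
  by (auto simp: scheme_matrix_def frac_primitive_zero)

lemma scheme_matrix_diagonal:
  assumes "0 < T" "0 < J" "k \<in> {1..J}" "\<alpha> \<le> 1"
  shows "scheme_matrix T J \<alpha> k k > 0"
  using node_bounds(2)[OF assms(1-3)] frac_primitive_pos[of "node T J k - node T J (k - 1)" "1 - \<alpha>"]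
  by (auto simp: scheme_matrix_def frac_primitive_zero)

section \<open>The discrete scheme as a triangular system\<close>

definition load :: "real \<Rightarrow> nat \<Rightarrow> (real \<Rightarrow> 'x::complex_normed antidual) \<Rightarrow> nat \<Rightarrow> 'x \<Rightarrow> complex" where
  "load T J g k v = (LINT t|time T. indicator (cell T J k) t *\<^sub>R pairing (g t) v)"

text \<open>Testing with functions that vanish off one cell decouples a variational equation.\<close>

lemma W_space_test:
  fixes L G :: "nat \<Rightarrow> 'x::complex_normed \<Rightarrow> complex"
  assumes J: "0 < T" "0 < J"
    and lhs: "\<And>V. V \<in> W_space T J \<Longrightarrow> lhs V = (\<Sum>k\<in>{1..J}. L k (cell_value T J V k))"
    and rhs: "\<And>V. V \<in> W_space T J \<Longrightarrow> rhs V = (\<Sum>k\<in>{1..J}. G k (cell_value T J V k))"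
    and zero: "\<And>k. L k 0 = 0" "\<And>k. G k 0 = 0"
  shows "(\<forall>V\<in>W_space T J. lhs V = rhs V) \<longleftrightarrow> (\<forall>k\<in>{1..J}. \<forall>v. L k v = G k v)"
proof
  assume all: "\<forall>V\<in>W_space T J. lhs V = rhs V"
  show "\<forall>k\<in>{1..J}. \<forall>v. L k v = G k v"
  proof (intro ballI allI)
    fix k and v :: 'x assume k: "k \<in> {1..J}"
    define V where "V = cell_fun T J (\<lambda>i. if i = k then v else 0)"
    have V: "V \<in> W_space T J" "\<And>i. i \<in> {1..J} \<Longrightarrow> cell_value T J V i = (if i = k then v else 0)"
      unfolding V_def by (rule cell_fun[OF J], rule cell_fun(2)[OF J])
    have "(\<Sum>i\<in>{1..J}. H i (cell_value T J V i)) = H k v" if "\<And>i. H i 0 = 0"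
      for H :: "nat \<Rightarrow> 'x \<Rightarrow> complex"
    proof -
      have "(\<Sum>i\<in>{1..J}. H i (cell_value T J V i)) = (\<Sum>i\<in>{1..J}. if i = k then H k v else 0)"
        using that V(2) by (intro sum.cong) auto
      then show ?thesis using k by simp
    qed
    then show "L k v = G k v" using all V(1) lhs[OF V(1)] rhs[OF V(1)] zero by simp
  qed
qed (simp add: lhs rhs)

lemma load_sum:
  assumes J: "0 < T" "0 < J" and g: "\<And>v. integrable (time T) (\<lambda>t. pairing (g t) v)"
    and V: "V \<in> W_space T J"
  shows "(LINT t|time T. pairing (g t) (V t)) = (\<Sum>k\<in>{1..J}. load T J g k (cell_value T J V k))"
  unfolding load_def
  by (rule integral_cell_decomposition(2)[OF V J, of "\<lambda>t. pairing (g t)"]) (intro integrable_cell J g)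

lemma load_zero: "load T J g k 0 = 0"
  by (simp add: load_def pairing.zero_right)

lemma integral_cell_cinner:
  assumes W: "W \<in> W_space T J" "0 < T" "0 < J" "k \<in> {1..J}" and B: "bounded_clinear B"
  shows "integrable (time T) (\<lambda>t. indicator (cell T J k) t *\<^sub>R pairing (dual_op B (W t)) v)"
    and "(LINT t|time T. indicator (cell T J k) t *\<^sub>R pairing (dual_op B (W t)) v)
      = (T / real J) *\<^sub>R cinner (cell_value T J W k) (B v)"
proof -
  have *: "(\<lambda>t. indicator (cell T J k) t *\<^sub>R pairing (dual_op B (W t)) v)
      = (\<lambda>t. indicator (cell T J k) t *\<^sub>R cinner (cell_value T J W k) (B v))"
    using W_space_value[OF W] by (intro ext) (auto simp: pairing_dual_op[OF B] indicator_def)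
  show "integrable (time T) (\<lambda>t. indicator (cell T J k) t *\<^sub>R pairing (dual_op B (W t)) v)"
    unfolding * by (rule integral_cell_const(1)[OF W(2-4)])
  show "(LINT t|time T. indicator (cell T J k) t *\<^sub>R pairing (dual_op B (W t)) v)
      = (T / real J) *\<^sub>R cinner (cell_value T J W k) (B v)"
    unfolding * by (rule integral_cell_const(2)[OF W(2-4)])
qed

text \<open>Both fractional schemes at once: \<open>h\<close> is the left or the right derivative of \<open>W\<close>.\<close>

lemma fractional_lhs:
  fixes W h :: "real \<Rightarrow> 'y::{complex_hilbert,second_countable_topology}"
  assumes W: "W \<in> W_space T J" "0 < T" "0 < J" and V: "V \<in> W_space T J"
    and \<iota>: "bounded_clinear \<iota>" and B: "bounded_clinear B" and h: "integrable (time T) h"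
    and hk: "\<And>k. k \<in> {1..J} \<Longrightarrow> (LINT t|time T. indicator (cell T J k) t *\<^sub>R h t)
      = (\<Sum>j\<in>{1..J}. K k j *\<^sub>R cell_value T J W j)"
  shows "(LINT t|time T. pairing (dual_op \<iota> (h t) - dual_op B (W t)) (V t)) =
    (\<Sum>k\<in>{1..J}. (\<Sum>j\<in>{1..J}. K k j *\<^sub>R cinner (cell_value T J W j) (\<iota> (cell_value T J V k)))
      - (T / real J) *\<^sub>R cinner (cell_value T J W k) (B (cell_value T J V k)))"
proof -
  have *: "integrable (time T) (\<lambda>t. indicator (cell T J k) t *\<^sub>R pairing (dual_op \<iota> (h t) - dual_op B (W t)) v)"
    "(LINT t|time T. indicator (cell T J k) t *\<^sub>R pairing (dual_op \<iota> (h t) - dual_op B (W t)) v)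
      = (\<Sum>j\<in>{1..J}. K k j *\<^sub>R cinner (cell_value T J W j) (\<iota> v))
      - (T / real J) *\<^sub>R cinner (cell_value T J W k) (B v)" if k: "k \<in> {1..J}" for k v
  proof -
    have bl: "bounded_linear (\<lambda>y. cinner y (\<iota> v))" by (rule cinner.bounded_linear_left)
    have eq: "indicator (cell T J k) t *\<^sub>R pairing (dual_op \<iota> (h t)) v
        = cinner (indicator (cell T J k) t *\<^sub>R h t) (\<iota> v)" for t
      by (simp add: pairing_dual_op[OF \<iota>] cinner.scaleR_left)
    note ih = integrable_cell[OF h W(2,3) k]
    have i1: "integrable (time T) (\<lambda>t. indicator (cell T J k) t *\<^sub>R pairing (dual_op \<iota> (h t)) v)"
      unfolding eq by (rule integrable_bounded_linear[OF bl ih])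
    have "(LINT t|time T. indicator (cell T J k) t *\<^sub>R pairing (dual_op \<iota> (h t)) v)
        = cinner (LINT t|time T. indicator (cell T J k) t *\<^sub>R h t) (\<iota> v)"
      unfolding eq by (rule integral_bounded_linear[OF bl ih])
    also have "\<dots> = (\<Sum>j\<in>{1..J}. K k j *\<^sub>R cinner (cell_value T J W j) (\<iota> v))"
      by (simp only: hk[OF k] cinner.sum_left cinner.scaleR_left)
    finally have v1: "(LINT t|time T. indicator (cell T J k) t *\<^sub>R pairing (dual_op \<iota> (h t)) v) = \<dots>" .
    note i2 = integral_cell_cinner[OF W k B, of v]
    show "integrable (time T) (\<lambda>t. indicator (cell T J k) t *\<^sub>R pairing (dual_op \<iota> (h t) - dual_op B (W t)) v)"
      unfolding pairing.diff_left scaleR_diff_right by (rule Bochner_Integration.integrable_diff[OF i1 i2(1)])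
    show "(LINT t|time T. indicator (cell T J k) t *\<^sub>R pairing (dual_op \<iota> (h t) - dual_op B (W t)) v)
      = (\<Sum>j\<in>{1..J}. K k j *\<^sub>R cinner (cell_value T J W j) (\<iota> v))
      - (T / real J) *\<^sub>R cinner (cell_value T J W k) (B v)"
      unfolding pairing.diff_left scaleR_diff_right
      by (simp only: Bochner_Integration.integral_diff[OF i1 i2(1)] v1 i2(2))
  qed
  have "(LINT t|time T. pairing (dual_op \<iota> (h t) - dual_op B (W t)) (V t)) =
      (\<Sum>k\<in>{1..J}. LINT t|time T. indicator (cell T J k) t *\<^sub>R
        pairing (dual_op \<iota> (h t) - dual_op B (W t)) (cell_value T J V k))"
    by (rule integral_cell_decomposition(2)[OF V W(2,3), of "\<lambda>t. pairing (dual_op \<iota> (h t) - dual_op B (W t))"])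
      (rule *(1))
  also have "\<dots> = (\<Sum>k\<in>{1..J}. (\<Sum>j\<in>{1..J}. K k j *\<^sub>R cinner (cell_value T J W j) (\<iota> (cell_value T J V k)))
      - (T / real J) *\<^sub>R cinner (cell_value T J W k) (B (cell_value T J V k)))"
    by (rule sum.cong[OF refl]) (rule *(2))
  finally show ?thesis .
qed

lemma scheme_matrix_one:
  fixes a :: "nat \<Rightarrow> 'a::real_vector"
  assumes k: "k \<in> {1..J}"
  shows "(\<Sum>j\<in>{1..J}. scheme_matrix T J 1 k j *\<^sub>R a j) = a k - (if k = 1 then 0 else a (k - 1))"
    and "(\<Sum>j\<in>{1..J}. scheme_matrix T J 1 j k *\<^sub>R a j) = a k - (if k = J then 0 else a (Suc k))"
proof -
  have "(\<Sum>j\<in>{1..J}. scheme_matrix T J 1 k j *\<^sub>R a j)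
      = (\<Sum>j\<in>{1..J}. (if j = k then a k else 0) - (if j = k - 1 then a (k - 1) else 0))"
    by (intro sum.cong) (use k in \<open>auto simp: scheme_matrix_def\<close>)
  then show "(\<Sum>j\<in>{1..J}. scheme_matrix T J 1 k j *\<^sub>R a j) = a k - (if k = 1 then 0 else a (k - 1))"
    using k by (auto simp: sum_subtractf)
  have "(\<Sum>j\<in>{1..J}. scheme_matrix T J 1 j k *\<^sub>R a j)
      = (\<Sum>j\<in>{1..J}. (if j = k then a k else 0) - (if j = Suc k then a (Suc k) else 0))"
    by (intro sum.cong) (use k in \<open>auto simp: scheme_matrix_def\<close>)
  then show "(\<Sum>j\<in>{1..J}. scheme_matrix T J 1 j k *\<^sub>R a j) = a k - (if k = J then 0 else a (Suc k))"
    using k by (auto simp: sum_subtractf)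
qed

lemma sum_split_first:
  fixes J :: nat
  assumes "0 < J"
  shows "(\<Sum>k\<in>{1..J}. f k) = f 1 + (\<Sum>j=1..J-1. f (Suc j))"
proof -
  obtain n where "J = Suc n" using assms by (cases J) auto
  have "(\<Sum>k\<in>{1..Suc n}. f k) = f 1 + (\<Sum>k\<in>{Suc 1..Suc n}. f k)"
    by (rule sum.atLeast_Suc_atMost) simp
  also have "(\<Sum>k\<in>{Suc 1..Suc n}. f k) = (\<Sum>j\<in>{1..n}. f (Suc j))"
    by (rule sum.shift_bounds_cl_Suc_ivl)
  finally show ?thesis by (simp only: \<open>J = Suc n\<close> diff_Suc_1)
qed

lemma backward_Euler_sum:
  assumes W: "W \<in> W_space T J" "0 < T" "1 < J" and V: "V \<in> W_space T J"
  shows "cinner (lim_right W 0) (\<iota> (lim_right V 0)) +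
      (\<Sum>j=1..J-1. cinner (lim_right W (node T J j) - lim_left W (node T J j)) (\<iota> (lim_right V (node T J j))))
    = (\<Sum>k\<in>{1..J}. \<Sum>j\<in>{1..J}. scheme_matrix T J 1 k j *\<^sub>R
        cinner (cell_value T J W j) (\<iota> (cell_value T J V k)))"
proof -
  let ?w = "cell_value T J W" and ?v = "cell_value T J V"
  have J: "0 < J" using W by simp
  have "(\<Sum>k\<in>{1..J}. \<Sum>j\<in>{1..J}. scheme_matrix T J 1 k j *\<^sub>R cinner (?w j) (\<iota> (?v k)))
      = (\<Sum>k\<in>{1..J}. cinner (?w k) (\<iota> (?v k)) - (if k = 1 then 0 else cinner (?w (k - 1)) (\<iota> (?v k))))"
    by (rule sum.cong[OF refl]) (rule scheme_matrix_one)
  also have "\<dots> = cinner (?w 1) (\<iota> (?v 1)) + (\<Sum>j=1..J-1. cinner (?w (Suc j)) (\<iota> (?v (Suc j))) - cinner (?w j) (\<iota> (?v (Suc j))))"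
    by (subst sum_split_first[OF J]) simp
  also have "\<dots> = cinner (lim_right W 0) (\<iota> (lim_right V 0)) +
      (\<Sum>j=1..J-1. cinner (lim_right W (node T J j) - lim_left W (node T J j)) (\<iota> (lim_right V (node T J j))))"
    using lim_right_node[OF W(1,2) J, of 0] lim_right_node[OF V W(2) J, of 0] lim_right_node[OF W(1,2) J]
      lim_right_node[OF V W(2) J] lim_left_node[OF W(1,2) J] J
    by (intro arg_cong2[of _ _ _ _ "(+)"] sum.cong) (auto simp: node_0 cinner.diff_left)
  finally show ?thesis by simp
qed

lemma forward_Euler_sum:
  assumes W: "W \<in> W_space T J" "0 < T" "1 < J" and V: "V \<in> W_space T J"
  shows "cinner (lim_left W T) (\<iota> (lim_left V T)) +
      (\<Sum>j=1..J-1. cinner (lim_left W (node T J j) - lim_right W (node T J j)) (\<iota> (lim_left V (node T J j))))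
    = (\<Sum>k\<in>{1..J}. \<Sum>j\<in>{1..J}. scheme_matrix T J 1 j k *\<^sub>R
        cinner (cell_value T J W j) (\<iota> (cell_value T J V k)))"
proof -
  let ?w = "cell_value T J W" and ?v = "cell_value T J V"
  have J: "0 < J" using W by simp
  have split: "{1..J} = insert J {1..J-1}" using J by auto
  have "(\<Sum>k\<in>{1..J}. \<Sum>j\<in>{1..J}. scheme_matrix T J 1 j k *\<^sub>R cinner (?w j) (\<iota> (?v k)))
      = (\<Sum>k\<in>{1..J}. cinner (?w k) (\<iota> (?v k)) - (if k = J then 0 else cinner (?w (Suc k)) (\<iota> (?v k))))"
    by (rule sum.cong[OF refl]) (rule scheme_matrix_one)
  also have "\<dots> = cinner (?w J) (\<iota> (?v J)) + (\<Sum>j=1..J-1. cinner (?w j) (\<iota> (?v j)) - cinner (?w (Suc j)) (\<iota> (?v j)))"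
    unfolding split using J by (subst sum.insert) (auto intro!: sum.cong)
  also have "\<dots> = cinner (lim_left W T) (\<iota> (lim_left V T)) +
      (\<Sum>j=1..J-1. cinner (lim_left W (node T J j) - lim_right W (node T J j)) (\<iota> (lim_left V (node T J j))))"
    using lim_left_node[OF W(1,2) J, of J] lim_left_node[OF V W(2) J, of J] lim_right_node[OF W(1,2) J]
      lim_left_node[OF V W(2) J] lim_left_node[OF W(1,2) J] J
    by (intro arg_cong2[of _ _ _ _ "(+)"] sum.cong) (auto simp: node_end cinner.diff_left)
  finally show ?thesis by simp
qed

lemma integral_dual_op_sum:
  fixes W :: "real \<Rightarrow> 'y::{complex_hilbert,second_countable_topology}"
  assumes W: "W \<in> W_space T J" "0 < T" "0 < J" and V: "V \<in> W_space T J" and B: "bounded_clinear B"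
  shows "(LINT t|time T. pairing (dual_op B (W t)) (V t)) =
    (\<Sum>k\<in>{1..J}. (T / real J) *\<^sub>R cinner (cell_value T J W k) (B (cell_value T J V k)))"
proof -
  have "(LINT t|time T. pairing (dual_op B (W t)) (V t)) = (\<Sum>k\<in>{1..J}. LINT t|time T.
      indicator (cell T J k) t *\<^sub>R pairing (dual_op B (W t)) (cell_value T J V k))"
    by (rule integral_cell_decomposition(2)[OF V W(2,3), of "\<lambda>t. pairing (dual_op B (W t))"])
      (rule integral_cell_cinner(1)[OF W _ B])
  also have "\<dots> = (\<Sum>k\<in>{1..J}. (T / real J) *\<^sub>R cinner (cell_value T J W k) (B (cell_value T J V k)))"
    by (rule sum.cong[OF refl]) (rule integral_cell_cinner(2)[OF W _ B])
  finally show ?thesis .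
qed

lemma is_sol_iff:
  fixes \<iota> :: "'x::complex_hilbert \<Rightarrow> 'y::{complex_hilbert,second_countable_topology}"
  assumes \<iota>: "bounded_clinear \<iota>" and B: "bounded_clinear B" and \<alpha>: "0 < \<alpha>" "\<alpha> \<le> 1" and J: "0 < T" "1 < J"
    and g: "\<And>v. integrable (time T) (\<lambda>t. pairing (g t) v)"
  shows "is_sol \<iota> B \<alpha> T J g W \<longleftrightarrow> W \<in> W_space T J \<and> (\<forall>k\<in>{1..J}. \<forall>v.
      (\<Sum>j\<in>{1..J}. scheme_matrix T J \<alpha> k j *\<^sub>R cinner (cell_value T J W j) (\<iota> v))
      - (T / real J) *\<^sub>R cinner (cell_value T J W k) (B v) = load T J g k v)"
  unfolding is_sol_def
proof (rule conj_cong[OF refl], rule W_space_test[OF J(1)])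
  assume W: "W \<in> W_space T J"
  show J0: "0 < J" using J by simp
  show "(LINT t|time T. pairing (g t) (V t)) = (\<Sum>k\<in>{1..J}. load T J g k (cell_value T J V k))"
    if "V \<in> W_space T J" for V :: "real \<Rightarrow> 'x"
    by (rule load_sum[OF J(1) J0 g that])
  fix V :: "real \<Rightarrow> 'x" assume V: "V \<in> W_space T J"
  show "(if \<alpha> < 1 then
           (LINT t|time T. pairing (dual_op \<iota> (frac_deriv_left T \<alpha> W t) - dual_op B (W t)) (V t))
         else
           cinner (lim_right W 0) (\<iota> (lim_right V 0)) +
           (\<Sum>j=1..J-1. cinner (lim_right W (node T J j) - lim_left W (node T J j))
                              (\<iota> (lim_right V (node T J j)))) -
           (LINT t|time T. pairing (dual_op B (W t)) (V t))) =
       (\<Sum>k\<in>{1..J}. (\<Sum>j\<in>{1..J}. scheme_matrix T J \<alpha> k j *\<^sub>R cinner (cell_value T J W j) (\<iota> (cell_value T J V k)))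
      - (T / real J) *\<^sub>R cinner (cell_value T J W k) (B (cell_value T J V k)))"
  proof (cases "\<alpha> < 1")
    case True
    show ?thesis
      unfolding if_P[OF True]
      by (rule fractional_lhs[OF W J(1) J0 V \<iota> B frac_deriv_left_cell[OF W J(1) J0 \<alpha>(1) True]])
  next
    case False
    with \<alpha> have "\<alpha> = 1" by simp
    then show ?thesis
      using backward_Euler_sum[OF W J V, of \<iota>] integral_dual_op_sum[OF W J(1) J0 V B]
      by (simp add: sum_subtractf)
  qed
qed (simp_all add: load_zero linear_simps(3)[OF bounded_clinearD(1)[OF \<iota>]]
    linear_simps(3)[OF bounded_clinearD(1)[OF B]] cinner.zero_right)

lemma is_adj_sol_iff:
  fixes \<iota> :: "'x::complex_hilbert \<Rightarrow> 'y::{complex_hilbert,second_countable_topology}"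
  assumes \<iota>: "bounded_clinear \<iota>" and B: "bounded_clinear B" and \<alpha>: "0 < \<alpha>" "\<alpha> \<le> 1" and J: "0 < T" "1 < J"
    and g: "\<And>v. integrable (time T) (\<lambda>t. pairing (g t) v)"
  shows "is_adj_sol \<iota> B \<alpha> T J g W \<longleftrightarrow> W \<in> W_space T J \<and> (\<forall>k\<in>{1..J}. \<forall>v.
      (\<Sum>j\<in>{1..J}. scheme_matrix T J \<alpha> j k *\<^sub>R cinner (cell_value T J W j) (\<iota> v))
      - (T / real J) *\<^sub>R cinner (cell_value T J W k) (B v) = load T J g k v)"
  unfolding is_adj_sol_def
proof (rule conj_cong[OF refl], rule W_space_test[OF J(1)])
  assume W: "W \<in> W_space T J"
  show J0: "0 < J" using J by simp
  show "(LINT t|time T. pairing (g t) (V t)) = (\<Sum>k\<in>{1..J}. load T J g k (cell_value T J V k))"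
    if "V \<in> W_space T J" for V :: "real \<Rightarrow> 'x"
    by (rule load_sum[OF J(1) J0 g that])
  fix V :: "real \<Rightarrow> 'x" assume V: "V \<in> W_space T J"
  show "(if \<alpha> < 1 then
           (LINT t|time T. pairing (dual_op \<iota> (frac_deriv_right T \<alpha> W t) - dual_op B (W t)) (V t))
         else
           cinner (lim_left W T) (\<iota> (lim_left V T)) +
           (\<Sum>j=1..J-1. cinner (lim_left W (node T J j) - lim_right W (node T J j))
                              (\<iota> (lim_left V (node T J j)))) -
           (LINT t|time T. pairing (dual_op B (W t)) (V t))) =
       (\<Sum>k\<in>{1..J}. (\<Sum>j\<in>{1..J}. scheme_matrix T J \<alpha> j k *\<^sub>R cinner (cell_value T J W j) (\<iota> (cell_value T J V k)))
      - (T / real J) *\<^sub>R cinner (cell_value T J W k) (B (cell_value T J V k)))"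
  proof (cases "\<alpha> < 1")
    case True
    show ?thesis
      unfolding if_P[OF True]
      by (rule fractional_lhs[OF W J(1) J0 V \<iota> B frac_deriv_right_cell[OF W J(1) J0 \<alpha>(1) True]])
  next
    case False
    with \<alpha> have "\<alpha> = 1" by simp
    then show ?thesis
      using forward_Euler_sum[OF W J V, of \<iota>] integral_dual_op_sum[OF W J(1) J0 V B]
      by (simp add: sum_subtractf)
  qed
qed (simp_all add: load_zero linear_simps(3)[OF bounded_clinearD(1)[OF \<iota>]]
    linear_simps(3)[OF bounded_clinearD(1)[OF B]] cinner.zero_right)

context positive_resolvent
begin

text \<open>
  With \<open>r = \<kappa> / \<tau>\<close>, substitute \<open>v = res r y / \<tau>\<close>: the left-hand side becomes \<open>(w, y)\<^sub>Y\<close>, and the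
  right-hand side a bounded antilinear functional of \<open>y \<in> Y\<close>.
\<close>

lemma weak_step_exists:
  assumes pos': "\<kappa> > 0" "\<tau> > 0"
    and f: "\<And>u v. f (u + v) = f u + f v" "\<And>c v. f (c *\<^sub>C v) = cnj c * f v" "\<And>v. cmod (f v) \<le> C * norm v"
    and "C \<ge> 0"
  shows "\<exists>w. \<forall>v. \<kappa> *\<^sub>R cinner w (\<iota> v) - \<tau> *\<^sub>R cinner w (B v) = f v"
proof -
  define r where "r = \<kappa> / \<tau>"
  have r: "r > 0" using pos' by (simp add: r_def)
  note bc = bounded_clinear_res[OF r]
  interpret res: bounded_linear "res r" by (rule bounded_clinearD[OF bc])
  have fR: "f (s *\<^sub>R v) = s *\<^sub>R f v" for s v
    by (simp add: scaleR_scaleC f(2) scaleR_conv_of_real)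
  have "\<exists>w. \<forall>y. (1 / \<tau>) *\<^sub>R f (res r y) = cinner w y"
  proof (rule riesz_antilinear)
    show "(1 / \<tau>) *\<^sub>R f (res r (c *\<^sub>C y)) = cnj c * (1 / \<tau>) *\<^sub>R f (res r y)" for c y
      by (simp add: bounded_clinearD(2)[OF bc] f(2))
    show "cmod ((1 / \<tau>) *\<^sub>R f (res r y)) \<le> (1 / \<tau> * (C * ((M + 1) / c\<^sub>0))) * norm y" for y
    proof -
      have "cmod (f (res r y)) \<le> C * (norm y * ((M + 1) / c\<^sub>0))"
        using f(3)[of "res r y"] mult_left_mono[OF norm_res[OF r, of y] \<open>C \<ge> 0\<close>] by linarith
      then have "1 / \<tau> * cmod (f (res r y)) \<le> 1 / \<tau> * (C * (norm y * ((M + 1) / c\<^sub>0)))"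
        using pos' by (intro mult_left_mono) auto
      then show ?thesis using pos' by (simp add: mult_ac)
    qed
  qed (simp_all add: res.add f(1) scaleR_add_right)
  then obtain w where w: "\<forall>y. (1 / \<tau>) *\<^sub>R f (res r y) = cinner w y" by (rule exE)
  have "\<kappa> *\<^sub>R cinner w (\<iota> v) - \<tau> *\<^sub>R cinner w (B v) = f v" for v
  proof -
    have "\<kappa> *\<^sub>R cinner w (\<iota> v) - \<tau> *\<^sub>R cinner w (B v) = \<tau> *\<^sub>R cinner w (r *\<^sub>R \<iota> v - B v)"
      using pos' by (simp add: cinner.diff_right cinner.scaleR_right r_def scaleR_diff_right)
    also have "\<dots> = f (res r (r *\<^sub>R \<iota> v - B v))" using w[rule_format, symmetric] pos' by simp
    also have "\<dots> = f v" by (simp only: res_eqI[OF r refl])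
    finally show ?thesis .
  qed
  then show ?thesis by blast
qed

lemma weak_step_bound:
  assumes pos': "\<kappa> > 0" "\<tau> > 0"
    and w: "\<And>v. \<kappa> *\<^sub>R cinner w (\<iota> v) - \<tau> *\<^sub>R cinner w (B v) = f v"
    and f: "\<And>v. cmod (f v) \<le> C * norm v" and "C \<ge> 0"
  shows "norm w \<le> C * ((M + 1) / c\<^sub>0 / \<tau>)"
proof -
  define r where "r = \<kappa> / \<tau>"
  have r: "r > 0" using pos' by (simp add: r_def)
  define v where "v = (1 / \<tau>) *\<^sub>R res r w"
  have "f v = cinner w (\<kappa> *\<^sub>R \<iota> v - \<tau> *\<^sub>R B v)"
    by (simp add: w[symmetric] cinner.diff_right cinner.scaleR_right)
  also have "\<kappa> *\<^sub>R \<iota> v - \<tau> *\<^sub>R B v = r *\<^sub>R \<iota> (res r w) - B (res r w)"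
    using pos' by (simp add: v_def \<iota>.scaleR B.scaleR r_def)
  finally have "f v = cinner w w" by (simp only: res_right[OF r])
  then have "(norm w)\<^sup>2 = cmod (f v)" by (simp add: cinner_self norm_power)
  also have "\<dots> \<le> C * (1 / \<tau> * norm (res r w))" using f[of v] pos' by (simp add: v_def)
  also have "\<dots> \<le> C * (1 / \<tau> * (norm w * ((M + 1) / c\<^sub>0)))"
    using \<open>C \<ge> 0\<close> pos' by (intro mult_left_mono norm_res r) auto
  finally have *: "norm w * norm w \<le> C * ((M + 1) / c\<^sub>0 / \<tau>) * norm w"
    by (simp add: power2_eq_square mult_ac)
  show ?thesis
  proof (cases "w = 0")
    case True
    then show ?thesis using \<open>C \<ge> 0\<close> pos pos' by simp
  next
    case False
    with * show ?thesis by (simp only: mult_le_cancel_right) auto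
  qed
qed

lemma strong_step_exists:
  assumes pos': "\<kappa> > 0" "\<tau> > 0"
  shows "\<exists>p. \<kappa> *\<^sub>R \<iota> p - \<tau> *\<^sub>R B p = y"
proof -
  define r where "r = \<kappa> / \<tau>"
  have r: "r > 0" using pos' by (simp add: r_def)
  have "\<kappa> *\<^sub>R \<iota> ((1 / \<tau>) *\<^sub>R res r y) - \<tau> *\<^sub>R B ((1 / \<tau>) *\<^sub>R res r y) = r *\<^sub>R \<iota> (res r y) - B (res r y)"
    using pos' by (simp add: \<iota>.scaleR B.scaleR r_def)
  also have "\<dots> = y" by (rule res_right[OF r])
  finally show ?thesis by blast
qed

text \<open>Forward substitution: the values already found go to the right-hand side.\<close>

lemma triangular_weak_exists:
  fixes K :: "nat \<Rightarrow> nat \<Rightarrow> real"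
  assumes \<tau>: "\<tau> > 0" and diag: "\<And>k. k \<in> {1..n} \<Longrightarrow> K k k > 0"
    and G: "\<And>k u v. G k (u + v) = G k u + G k v" "\<And>k c v. G k (c *\<^sub>C v) = cnj c * G k v"
      "\<And>k v. cmod (G k v) \<le> C * norm v" and "C \<ge> 0"
  shows "\<exists>w. \<forall>k\<in>{1..n}. \<forall>v. (\<Sum>j\<in>{1..k}. K k j *\<^sub>R cinner (w j) (\<iota> v)) - \<tau> *\<^sub>R cinner (w k) (B v) = G k v"
  using diag
proof (induction n)
  case (Suc n)
  then obtain w where w: "\<forall>k\<in>{1..n}. \<forall>v. (\<Sum>j\<in>{1..k}. K k j *\<^sub>R cinner (w j) (\<iota> v)) - \<tau> *\<^sub>R cinner (w k) (B v) = G k v"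
    by auto
  define f where "f v = G (Suc n) v - (\<Sum>j\<in>{1..n}. K (Suc n) j *\<^sub>R cinner (w j) (\<iota> v))" for v
  let ?C = "C + (\<Sum>j\<in>{1..n}. \<bar>K (Suc n) j\<bar> * (norm (w j) * onorm \<iota>))"
  have o: "norm (\<iota> v) \<le> onorm \<iota> * norm v" for v by (rule onorm) (rule \<iota>.bounded_linear_axioms)
  have o0: "0 \<le> onorm \<iota>" by (rule onorm_pos_le) (rule \<iota>.bounded_linear_axioms)
  have "\<exists>w'. \<forall>v. K (Suc n) (Suc n) *\<^sub>R cinner w' (\<iota> v) - \<tau> *\<^sub>R cinner w' (B v) = f v"
  proof (rule weak_step_exists)
    show "f (u + v) = f u + f v" for u v
      by (simp add: f_def G(1) \<iota>.add cinner_add_right scaleR_add_right sum.distrib)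
    show "f (c *\<^sub>C v) = cnj c * f v" for c v
      by (simp add: f_def G(2) bounded_clinearD(2)[OF \<iota>] cinner_scaleC_right right_diff_distrib sum_distrib_left)
    show "cmod (f v) \<le> ?C * norm v" for v
    proof -
      have "cmod (f v) \<le> cmod (G (Suc n) v) + (\<Sum>j\<in>{1..n}. cmod (K (Suc n) j *\<^sub>R cinner (w j) (\<iota> v)))"
        unfolding f_def by (rule order_trans[OF norm_triangle_ineq4 add_left_mono[OF norm_sum]])
      also have "\<dots> \<le> C * norm v + (\<Sum>j\<in>{1..n}. \<bar>K (Suc n) j\<bar> * (norm (w j) * (onorm \<iota> * norm v)))"
      proof (intro add_mono G(3) sum_mono)
        fix j
        have "cmod (cinner (w j) (\<iota> v)) \<le> norm (w j) * (onorm \<iota> * norm v)"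
          using cmod_cinner_le[of "w j" "\<iota> v"] mult_left_mono[OF o[of v] norm_ge_zero[of "w j"]] by linarith
        then show "cmod (K (Suc n) j *\<^sub>R cinner (w j) (\<iota> v)) \<le> \<bar>K (Suc n) j\<bar> * (norm (w j) * (onorm \<iota> * norm v))"
          by (simp add: mult_left_mono)
      qed
      also have "\<dots> = ?C * norm v" by (simp add: distrib_right distrib_left sum_distrib_left sum_distrib_right mult_ac)
      finally show ?thesis .
    qed
    show "?C \<ge> 0" using \<open>C \<ge> 0\<close> o0 by (intro add_nonneg_nonneg sum_nonneg) auto
  qed (use Suc \<tau> in auto)
  then obtain w' where w': "\<forall>v. K (Suc n) (Suc n) *\<^sub>R cinner w' (\<iota> v) - \<tau> *\<^sub>R cinner w' (B v) = f v"
    by (rule exE)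
  have "\<forall>k\<in>{1..Suc n}. \<forall>v. (\<Sum>j\<in>{1..k}. K k j *\<^sub>R cinner ((w(Suc n := w')) j) (\<iota> v))
      - \<tau> *\<^sub>R cinner ((w(Suc n := w')) k) (B v) = G k v"
  proof (intro ballI allI)
    fix k v assume "k \<in> {1..Suc n}"
    then consider "k \<in> {1..n}" | "k = Suc n" by fastforce
    then show "(\<Sum>j\<in>{1..k}. K k j *\<^sub>R cinner ((w(Suc n := w')) j) (\<iota> v))
      - \<tau> *\<^sub>R cinner ((w(Suc n := w')) k) (B v) = G k v"
    proof cases
      case 1
      then have "(\<Sum>j\<in>{1..k}. K k j *\<^sub>R cinner ((w(Suc n := w')) j) (\<iota> v)) = (\<Sum>j\<in>{1..k}. K k j *\<^sub>R cinner (w j) (\<iota> v))"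
        by (intro sum.cong) auto
      with 1 w show ?thesis by auto
    next
      case 2
      have "(\<Sum>j\<in>{1..n}. K (Suc n) j *\<^sub>R cinner ((w(Suc n := w')) j) (\<iota> v)) = (\<Sum>j\<in>{1..n}. K (Suc n) j *\<^sub>R cinner (w j) (\<iota> v))"
        by (intro sum.cong) auto
      with 2 w'[rule_format, of v] show ?thesis by (simp add: f_def algebra_simps)
    qed
  qed
  then show ?case by blast
qed auto

text \<open>Stability; for \<open>g = 0\<close> it is uniqueness.\<close>

lemma triangular_weak_bound:
  fixes K :: "nat \<Rightarrow> nat \<Rightarrow> real"
  assumes \<tau>: "\<tau> > 0" and diag: "\<And>k. k \<in> {1..n} \<Longrightarrow> K k k > 0"
  shows "\<exists>C\<ge>0. \<forall>w G g. g \<ge> 0 \<longrightarrow>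
    (\<forall>k\<in>{1..n}. \<forall>v. (\<Sum>j\<in>{1..k}. K k j *\<^sub>R cinner (w j) (\<iota> v)) - \<tau> *\<^sub>R cinner (w k) (B v) = G k v) \<longrightarrow>
    (\<forall>k\<in>{1..n}. \<forall>v. cmod (G k v) \<le> g * norm v) \<longrightarrow> (\<forall>k\<in>{1..n}. norm (w k) \<le> C * g)"
  using diag
proof (induction n)
  case (Suc n)
  let ?P = "\<lambda>n C w G g. g \<ge> 0 \<longrightarrow>
    (\<forall>k\<in>{1..n}. \<forall>v. (\<Sum>j\<in>{1..k}. K k j *\<^sub>R cinner (w j) (\<iota> v)) - \<tau> *\<^sub>R cinner (w k) (B v) = G k v) \<longrightarrow>
    (\<forall>k\<in>{1..n}. \<forall>v. cmod (G k v) \<le> g * norm v) \<longrightarrow> (\<forall>k\<in>{1..n}. norm (w k) \<le> C * g)"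
  from Suc obtain C where C: "C \<ge> 0" and IH: "\<And>w G g. ?P n C w G g" by fastforce
  have o: "norm (\<iota> v) \<le> onorm \<iota> * norm v" for v by (rule onorm) (rule \<iota>.bounded_linear_axioms)
  have o0: "0 \<le> onorm \<iota>" by (rule onorm_pos_le) (rule \<iota>.bounded_linear_axioms)
  define S where "S = (\<Sum>j\<in>{1..n}. \<bar>K (Suc n) j\<bar> * (C * onorm \<iota>))"
  define D where "D = (1 + S) * ((M + 1) / c\<^sub>0 / \<tau>)"
  have S0: "S \<ge> 0" unfolding S_def using C o0 by (intro sum_nonneg) auto
  then have D0: "D \<ge> 0" unfolding D_def using pos \<tau> by auto
  have "?P (Suc n) (C + D) w G g" for w G g
  proof (intro impI)
    assume g: "g \<ge> 0"
      and eq: "\<forall>k\<in>{1..Suc n}. \<forall>v. (\<Sum>j\<in>{1..k}. K k j *\<^sub>R cinner (w j) (\<iota> v)) - \<tau> *\<^sub>R cinner (w k) (B v) = G k v"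
      and G: "\<forall>k\<in>{1..Suc n}. \<forall>v. cmod (G k v) \<le> g * norm v"
    have le: "norm (w k) \<le> C * g" if "k \<in> {1..n}" for k
      using IH[of g w G] g eq G that by auto
    have "norm (w (Suc n)) \<le> ((1 + S) * g) * ((M + 1) / c\<^sub>0 / \<tau>)"
    proof (rule weak_step_bound)
      show "K (Suc n) (Suc n) > 0" using Suc by simp
      show "K (Suc n) (Suc n) *\<^sub>R cinner (w (Suc n)) (\<iota> v) - \<tau> *\<^sub>R cinner (w (Suc n)) (B v)
          = G (Suc n) v - (\<Sum>j\<in>{1..n}. K (Suc n) j *\<^sub>R cinner (w j) (\<iota> v))" for v
        using eq[rule_format, of "Suc n" v] by (simp add: algebra_simps)
      show "cmod (G (Suc n) v - (\<Sum>j\<in>{1..n}. K (Suc n) j *\<^sub>R cinner (w j) (\<iota> v))) \<le> (1 + S) * g * norm v" for v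
      proof -
        have "cmod (G (Suc n) v - (\<Sum>j\<in>{1..n}. K (Suc n) j *\<^sub>R cinner (w j) (\<iota> v)))
            \<le> cmod (G (Suc n) v) + (\<Sum>j\<in>{1..n}. cmod (K (Suc n) j *\<^sub>R cinner (w j) (\<iota> v)))"
          by (rule order_trans[OF norm_triangle_ineq4 add_left_mono[OF norm_sum]])
        also have "\<dots> \<le> g * norm v + (\<Sum>j\<in>{1..n}. \<bar>K (Suc n) j\<bar> * ((C * g) * (onorm \<iota> * norm v)))"
        proof (intro add_mono sum_mono)
          show "cmod (G (Suc n) v) \<le> g * norm v" using G by auto
          fix j assume j: "j \<in> {1..n}"
          have "cmod (cinner (w j) (\<iota> v)) \<le> norm (w j) * norm (\<iota> v)" by (rule cmod_cinner_le)
          also have "\<dots> \<le> (C * g) * (onorm \<iota> * norm v)"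
            using C g by (intro mult_mono le j o) auto
          finally show "cmod (K (Suc n) j *\<^sub>R cinner (w j) (\<iota> v)) \<le> \<bar>K (Suc n) j\<bar> * ((C * g) * (onorm \<iota> * norm v))"
            by (simp add: mult_left_mono)
        qed
        also have "\<dots> = (1 + S) * g * norm v"
          by (simp add: S_def distrib_right distrib_left sum_distrib_left sum_distrib_right mult_ac)
        finally show ?thesis .
      qed
    qed (use \<tau> S0 g in auto)
    then have "norm (w (Suc n)) \<le> D * g" by (simp add: D_def mult_ac)
    moreover have "C * g \<le> (C + D) * g" "D * g \<le> (C + D) * g"
      using C D0 g by (auto intro!: mult_right_mono)
    ultimately show "\<forall>k\<in>{1..Suc n}. norm (w k) \<le> (C + D) * g"
      using order_trans[OF le] by (auto simp: atLeastAtMostSuc_conv)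
  qed
  then show ?case using C D0 by (intro exI[of _ "C + D"] conjI allI) auto
qed auto

text \<open>
  Backward substitution. For right-hand sides in \<open>Y\<close> each step is solved by the resolvent itself,
  whose range is in \<open>X\<close>.
\<close>

lemma triangular_strong_exists:
  fixes K :: "nat \<Rightarrow> nat \<Rightarrow> real" and J :: nat
  assumes \<tau>: "\<tau> > 0" and diag: "\<And>k. k \<in> {1..J} \<Longrightarrow> K k k > 0"
  shows "\<exists>p. \<forall>k\<in>{1..J}. (\<Sum>j\<in>{k..J}. K j k *\<^sub>R \<iota> (p j)) - \<tau> *\<^sub>R B (p k) = h k"
proof -
  have "\<exists>p. \<forall>k\<in>{1..J}. J < k + n \<longrightarrow> (\<Sum>j\<in>{k..J}. K j k *\<^sub>R \<iota> (p j)) - \<tau> *\<^sub>R B (p k) = h k" for n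
  proof (induction n)
    case (Suc n)
    then obtain p where p: "\<And>k. k \<in> {1..J} \<Longrightarrow> J < k + n \<Longrightarrow>
        (\<Sum>j\<in>{k..J}. K j k *\<^sub>R \<iota> (p j)) - \<tau> *\<^sub>R B (p k) = h k" by blast
    show ?case
    proof (cases "n < J")
      case False
      then show ?thesis using p by (intro exI[of _ p]) auto
    next
      case True
      define m where "m = J - n"
      have m: "m \<in> {1..J}" using True by (auto simp: m_def)
      obtain x where x: "K m m *\<^sub>R \<iota> x - \<tau> *\<^sub>R B x = h m - (\<Sum>j\<in>{Suc m..J}. K j m *\<^sub>R \<iota> (p j))"
        using strong_step_exists[OF diag[OF m] \<tau>] by blast
      have "(\<Sum>j\<in>{k..J}. K j k *\<^sub>R \<iota> ((p(m := x)) j)) - \<tau> *\<^sub>R B ((p(m := x)) k) = h k"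
        if k: "k \<in> {1..J}" "J < k + Suc n" for k
      proof (cases "k = m")
        case True
        have "(\<Sum>j\<in>{m..J}. K j m *\<^sub>R \<iota> ((p(m := x)) j))
            = K m m *\<^sub>R \<iota> x + (\<Sum>j\<in>{Suc m..J}. K j m *\<^sub>R \<iota> ((p(m := x)) j))"
          using m by (simp add: sum.atLeast_Suc_atMost)
        also have "(\<Sum>j\<in>{Suc m..J}. K j m *\<^sub>R \<iota> ((p(m := x)) j)) = (\<Sum>j\<in>{Suc m..J}. K j m *\<^sub>R \<iota> (p j))"
          by (intro sum.cong) auto
        finally show ?thesis using x True by (simp add: algebra_simps)
      next
        case False
        with k have "m < k" by (auto simp: m_def)
        then have "(\<Sum>j\<in>{k..J}. K j k *\<^sub>R \<iota> ((p(m := x)) j)) = (\<Sum>j\<in>{k..J}. K j k *\<^sub>R \<iota> (p j))"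
          by (intro sum.cong) auto
        moreover have "J < k + n" using \<open>m < k\<close> by (auto simp: m_def)
        ultimately show ?thesis using p[OF k(1)] False by simp
      qed
      then show ?thesis by (intro exI[of _ "p(m := x)"]) blast
    qed
  qed auto
  from this[of J] obtain p where "\<forall>k\<in>{1..J}. J < k + J \<longrightarrow> (\<Sum>j\<in>{k..J}. K j k *\<^sub>R \<iota> (p j)) - \<tau> *\<^sub>R B (p k) = h k"
    by (rule exE)
  then show ?thesis by (intro exI[of _ p]) auto
qed

lemma triangular_weak_unique_backward:
  fixes K :: "nat \<Rightarrow> nat \<Rightarrow> real" and J :: nat
  assumes \<tau>: "\<tau> > 0" and diag: "\<And>k. k \<in> {1..J} \<Longrightarrow> K k k > 0"
    and w: "\<And>k v. k \<in> {1..J} \<Longrightarrow>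
      (\<Sum>j\<in>{k..J}. K j k *\<^sub>R cinner (w j) (\<iota> v)) - \<tau> *\<^sub>R cinner (w k) (B v) = 0"
  shows "k \<in> {1..J} \<Longrightarrow> w k = 0"
proof (induction "J - k" arbitrary: k rule: less_induct)
  case less
  have "K k k *\<^sub>R cinner (w k) (\<iota> v) - \<tau> *\<^sub>R cinner (w k) (B v) = 0" for v
  proof -
    have "(\<Sum>j\<in>{Suc k..J}. K j k *\<^sub>R cinner (w j) (\<iota> v)) = 0"
    proof (intro sum.neutral ballI)
      fix j assume j: "j \<in> {Suc k..J}"
      with less.prems have "w j = 0" by (intro less.hyps) auto
      then show "K j k *\<^sub>R cinner (w j) (\<iota> v) = 0" by (simp add: cinner.zero_left)
    qed
    then show ?thesis using w[OF less.prems, of v] less.prems by (simp add: sum.atLeast_Suc_atMost)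
  qed
  from weak_step_bound[OF diag[OF less.prems] \<tau> this, of 0] show ?case by simp
qed

end

section \<open>The discrete control problem\<close>

locale control_problem =
  fwd: dense_positive_resolvent \<iota> As c\<^sub>0 c\<^sub>1 M + adj: dense_positive_resolvent \<iota> A c\<^sub>0 c\<^sub>1 M
  for \<iota> As A :: "'x::{complex_hilbert,second_countable_topology} \<Rightarrow>
                     'y::{complex_hilbert,second_countable_topology}"
    and c\<^sub>0 c\<^sub>1 M :: real +
  fixes \<alpha> T \<theta> \<nu> :: real and J :: nat
    and R :: "'z::complex_hilbert \<Rightarrow> 'x antidual" and yd :: 'y
  assumes adjoint: "\<And>v w. cinner (A v) (\<iota> w) = cinner (\<iota> v) (As w)"
    and \<alpha>: "0 < \<alpha>" "\<alpha> \<le> 1" and T: "0 < T" and J: "1 < J" and \<theta>: "0 < \<theta>" "\<theta> \<le> 1" and \<nu>: "\<nu> > 0"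
    and R: "bounded_clinear_into_interp \<iota> \<theta> R"
begin

sublocale time: complete_finite_measure "time T" by (rule complete_finite_measure_time)

abbreviation "K \<equiv> scheme_matrix T J \<alpha>"
abbreviation "\<tau> \<equiv> T / real J"

lemma J0: "0 < J" and \<tau>0: "\<tau> > 0" using J T by auto

lemma K_diag: "k \<in> {1..J} \<Longrightarrow> K k k > 0"
  by (rule scheme_matrix_diagonal[OF T J0 _ \<alpha>(2)])

lemma K_sum_lower:
  fixes a :: "nat \<Rightarrow> 'v::real_vector"
  assumes "k \<in> {1..J}" shows "(\<Sum>j\<in>{1..J}. K k j *\<^sub>R a j) = (\<Sum>j\<in>{1..k}. K k j *\<^sub>R a j)"
  using assms by (intro sum.mono_neutral_right) (auto simp: scheme_matrix_triangular[OF T J0 _ \<alpha>(2)])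

lemma K_sum_upper:
  fixes a :: "nat \<Rightarrow> 'v::real_vector"
  assumes "k \<in> {1..J}" shows "(\<Sum>j\<in>{1..J}. K j k *\<^sub>R a j) = (\<Sum>j\<in>{k..J}. K j k *\<^sub>R a j)"
  using assms by (intro sum.mono_neutral_right) (auto simp: scheme_matrix_triangular[OF T J0 _ \<alpha>(2)])

definition solves :: "(nat \<Rightarrow> 'y) \<Rightarrow> (nat \<Rightarrow> 'x \<Rightarrow> complex) \<Rightarrow> bool" where
  "solves w G \<longleftrightarrow> (\<forall>k\<in>{1..J}. \<forall>v.
      (\<Sum>j\<in>{1..J}. K k j *\<^sub>R cinner (w j) (\<iota> v)) - \<tau> *\<^sub>R cinner (w k) (As v) = G k v)"

lemma solves_lincomb:
  assumes "solves w G" "solves w' G'"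
  shows "solves (\<lambda>k. a *\<^sub>R w k + b *\<^sub>R w' k) (\<lambda>k v. a *\<^sub>R G k v + b *\<^sub>R G' k v)"
  unfolding solves_def
proof (intro ballI allI)
  fix k v assume k: "k \<in> {1..J}"
  have "(\<Sum>j\<in>{1..J}. K k j *\<^sub>R cinner (a *\<^sub>R w j + b *\<^sub>R w' j) (\<iota> v)) - \<tau> *\<^sub>R cinner (a *\<^sub>R w k + b *\<^sub>R w' k) (As v)
    = a *\<^sub>R ((\<Sum>j\<in>{1..J}. K k j *\<^sub>R cinner (w j) (\<iota> v)) - \<tau> *\<^sub>R cinner (w k) (As v))
    + b *\<^sub>R ((\<Sum>j\<in>{1..J}. K k j *\<^sub>R cinner (w' j) (\<iota> v)) - \<tau> *\<^sub>R cinner (w' k) (As v))"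
    by (simp add: cinner_add_left cinner.scaleR_left scaleR_add_right scaleR_diff_right
        scaleR_sum_right sum.distrib scaleR_left_commute algebra_simps)
  then show "(\<Sum>j\<in>{1..J}. K k j *\<^sub>R cinner (a *\<^sub>R w j + b *\<^sub>R w' j) (\<iota> v))
      - \<tau> *\<^sub>R cinner (a *\<^sub>R w k + b *\<^sub>R w' k) (As v) = a *\<^sub>R G k v + b *\<^sub>R G' k v"
    using assms k by (simp add: solves_def)
qed

lemma solves_bound:
  "\<exists>C. C \<ge> 0 \<and> (\<forall>w G g. g \<ge> 0 \<longrightarrow> solves w G \<longrightarrow>
    (\<forall>k\<in>{1..J}. \<forall>v. cmod (G k v) \<le> g * norm v) \<longrightarrow> (\<forall>k\<in>{1..J}. norm (w k) \<le> C * g))"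
proof -
  obtain C where C: "C \<ge> 0" "\<forall>w G g. g \<ge> 0 \<longrightarrow>
      (\<forall>k\<in>{1..J}. \<forall>v. (\<Sum>j\<in>{1..k}. K k j *\<^sub>R cinner (w j) (\<iota> v)) - \<tau> *\<^sub>R cinner (w k) (As v) = G k v) \<longrightarrow>
      (\<forall>k\<in>{1..J}. \<forall>v. cmod (G k v) \<le> g * norm v) \<longrightarrow> (\<forall>k\<in>{1..J}. norm (w k) \<le> C * g)"
    using fwd.triangular_weak_bound[where K = K and n = J, OF \<tau>0 K_diag] by auto
  show ?thesis
  proof (intro exI[of _ C] conjI allI impI)
    fix w G g assume *: "g \<ge> 0" "solves w G" "\<forall>k\<in>{1..J}. \<forall>v. cmod (G k v) \<le> g * norm v"
    then have "\<forall>k\<in>{1..J}. \<forall>v. (\<Sum>j\<in>{1..k}. K k j *\<^sub>R cinner (w j) (\<iota> v)) - \<tau> *\<^sub>R cinner (w k) (As v) = G k v"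
      unfolding solves_def by (intro ballI allI) (simp only: K_sum_lower[symmetric])
    with C(2) * show "\<forall>k\<in>{1..J}. norm (w k) \<le> C * g" by blast
  qed (rule C(1))
qed

lemma solves_unique:
  assumes "solves w G" "solves w' G" "k \<in> {1..J}"
  shows "w k = w' k"
proof -
  obtain C where C: "C \<ge> 0 \<and> (\<forall>w G g. g \<ge> 0 \<longrightarrow> solves w G \<longrightarrow>
    (\<forall>k\<in>{1..J}. \<forall>v. cmod (G k v) \<le> g * norm v) \<longrightarrow> (\<forall>k\<in>{1..J}. norm (w k) \<le> C * g))"
    using solves_bound by (rule exE)
  have "solves (\<lambda>k. 1 *\<^sub>R w k + (-1) *\<^sub>R w' k) (\<lambda>k v. 1 *\<^sub>R G k v + (-1) *\<^sub>R G k v)"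
    by (rule solves_lincomb[OF assms(1,2)])
  with C[THEN conjunct2, rule_format, OF order_refl this] assms(3) show ?thesis by simp
qed

lemma load_add:
  assumes g: "\<And>v. integrable (time T) (\<lambda>t. pairing (g t) v)" and k: "k \<in> {1..J}"
  shows "load T J g k (u + v) = load T J g k u + load T J g k v"
  unfolding load_def pairing.add_right scaleR_add_right
  by (intro Bochner_Integration.integral_add integrable_cell[OF g T J0 k])

lemma load_scaleC: "load T J g k (c *\<^sub>C v) = cnj c * load T J g k v"
  by (simp add: load_def pairing_scaleC_right flip: integral_mult_right_zero)

lemma load_bound:
  assumes g: "integrable (time T) (\<lambda>t. pairing (g t) v)" and k: "k \<in> {1..J}"
    and \<phi>: "integrable (time T) \<phi>" "AE t in time T. cmod (pairing (g t) v) \<le> \<phi> t * norm v"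
  shows "cmod (load T J g k v) \<le> (LINT t|time T. \<phi> t) * norm v"
proof -
  have "cmod (load T J g k v) \<le> (LINT t|time T. cmod (indicator (cell T J k) t *\<^sub>R pairing (g t) v))"
    unfolding load_def by (rule integral_norm_bound)
  also have "\<dots> \<le> (LINT t|time T. \<phi> t * norm v)"
  proof (rule integral_mono_AE)
    show "integrable (time T) (\<lambda>t. cmod (indicator (cell T J k) t *\<^sub>R pairing (g t) v))"
      by (intro integrable_norm integrable_cell[OF g T J0 k])
    show "AE t in time T. cmod (indicator (cell T J k) t *\<^sub>R pairing (g t) v) \<le> \<phi> t * norm v"
      using \<phi>(2)
    proof eventually_elim
      case (elim t)
      then have "0 \<le> \<phi> t * norm v" using norm_ge_zero order_trans by blast
      with elim show ?case by (auto simp: indicator_def)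
    qed
  qed (use \<phi> in auto)
  also have "\<dots> = (LINT t|time T. \<phi> t) * norm v" by simp
  finally show ?thesis .
qed

lemma sol_solves:
  assumes g: "\<And>v. integrable (time T) (\<lambda>t. pairing (g t) v)"
    and b: "C \<ge> 0" "\<And>k v. k \<in> {1..J} \<Longrightarrow> cmod (load T J g k v) \<le> C * norm v"
  shows "sol \<iota> As \<alpha> T J g \<in> W_space T J" and "solves (cell_value T J (sol \<iota> As \<alpha> T J g)) (load T J g)"
proof -
  define G where "G k = (if k \<in> {1..J} then load T J g k else (\<lambda>v. 0))" for k
  have "\<exists>w. \<forall>k\<in>{1..J}. \<forall>v. (\<Sum>j\<in>{1..k}. K k j *\<^sub>R cinner (w j) (\<iota> v)) - \<tau> *\<^sub>R cinner (w k) (As v) = G k v"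
    by (rule fwd.triangular_weak_exists[where K = K, OF \<tau>0 K_diag _ _ _ b(1)])
      (use b in \<open>auto simp: G_def load_add[OF g] load_scaleC\<close>)
  then obtain w where "\<forall>k\<in>{1..J}. \<forall>v. (\<Sum>j\<in>{1..k}. K k j *\<^sub>R cinner (w j) (\<iota> v)) - \<tau> *\<^sub>R cinner (w k) (As v) = G k v"
    by (rule exE)
  then have w: "(\<Sum>j\<in>{1..k}. K k j *\<^sub>R cinner (w j) (\<iota> v)) - \<tau> *\<^sub>R cinner (w k) (As v) = load T J g k v"
    if "k \<in> {1..J}" for k v
    using that by (simp add: G_def)
  have "is_sol \<iota> As \<alpha> T J g (cell_fun T J w)"
    unfolding is_sol_iff[OF fwd.\<iota> fwd.B \<alpha> T J g]
  proof (intro conjI ballI allI)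
    fix k v assume k: "k \<in> {1..J}"
    have "(\<Sum>j\<in>{1..J}. K k j *\<^sub>R cinner (cell_value T J (cell_fun T J w) j) (\<iota> v))
        = (\<Sum>j\<in>{1..J}. K k j *\<^sub>R cinner (w j) (\<iota> v))"
      by (intro sum.cong refl) (simp only: cell_fun(2)[OF T J0])
    then show "(\<Sum>j\<in>{1..J}. K k j *\<^sub>R cinner (cell_value T J (cell_fun T J w) j) (\<iota> v))
        - \<tau> *\<^sub>R cinner (cell_value T J (cell_fun T J w) k) (As v) = load T J g k v"
      using w[OF k, of v] by (simp only: K_sum_lower[OF k] cell_fun(2)[OF T J0 k])
  qed (rule cell_fun(1)[OF T J0])
  then have "is_sol \<iota> As \<alpha> T J g (sol \<iota> As \<alpha> T J g)"
    unfolding sol_def by (rule someI[of "is_sol \<iota> As \<alpha> T J g"])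
  then show "sol \<iota> As \<alpha> T J g \<in> W_space T J" "solves (cell_value T J (sol \<iota> As \<alpha> T J g)) (load T J g)"
    unfolding is_sol_iff[OF fwd.\<iota> fwd.B \<alpha> T J g] solves_def by blast+
qed

text \<open>
  The approximate delta function at \<open>T\<close> is constant on the last cell, with integral one.
\<close>

lemma load_delta:
  "integrable (time T) (\<lambda>t. pairing (dual_op \<iota> (delta_hat T J t *\<^sub>R y)) v)"
  "k \<in> {1..J} \<Longrightarrow> load T J (\<lambda>t. dual_op \<iota> (delta_hat T J t *\<^sub>R y)) k v = cinner (if k = J then y else 0) (\<iota> v)"
proof -
  have Jk: "J \<in> {1..J}" using J0 by auto
  have "node T J (J - 1) = T - \<tau>" "node T J J = T"
    using node_bounds(4)[OF T J0 Jk] node_end[OF J0, of T] by auto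
  then have delta: "delta_hat T J t = indicator (cell T J J) t * inverse \<tau>" for t
    by (auto simp: delta_hat_def cell_def indicator_def)
  have eq: "pairing (dual_op \<iota> (delta_hat T J t *\<^sub>R y)) v = indicator (cell T J J) t *\<^sub>R (inverse \<tau> *\<^sub>R cinner y (\<iota> v))" for t
    by (simp only: pairing_dual_op[OF fwd.\<iota>] delta cinner.scaleR_left scaleR_scaleR)
  show "integrable (time T) (\<lambda>t. pairing (dual_op \<iota> (delta_hat T J t *\<^sub>R y)) v)"
    unfolding eq by (rule integral_cell_const(1)[OF T J0 Jk])
  show "load T J (\<lambda>t. dual_op \<iota> (delta_hat T J t *\<^sub>R y)) k v = cinner (if k = J then y else 0) (\<iota> v)" if k: "k \<in> {1..J}"
  proof (cases "k = J")
    case True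
    have "load T J (\<lambda>t. dual_op \<iota> (delta_hat T J t *\<^sub>R y)) k v
        = (LINT t|time T. indicator (cell T J J) t *\<^sub>R (inverse \<tau> *\<^sub>R cinner y (\<iota> v)))"
      unfolding load_def eq True by (intro Bochner_Integration.integral_cong) (auto simp: indicator_def)
    also have "\<dots> = \<tau> *\<^sub>R (inverse \<tau> *\<^sub>R cinner y (\<iota> v))" by (rule integral_cell_const(2)[OF T J0 Jk])
    also have "\<dots> = cinner y (\<iota> v)"
      by (simp only: scaleR_scaleR right_inverse[OF less_imp_neq[OF \<tau>0, symmetric]] scaleR_one)
    finally show ?thesis using True by simp
  next
    case False
    have "(\<lambda>t. indicator (cell T J k) t *\<^sub>R (indicator (cell T J J) t *\<^sub>R (inverse \<tau> *\<^sub>R cinner y (\<iota> v)))) = (\<lambda>t. 0)"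
      using cell_disjoint[OF T J0 _ _ k Jk] False by (intro ext) (auto simp: indicator_def)
    then show ?thesis using False unfolding load_def eq by (simp add: cinner.zero_left)
  qed
qed

text \<open>
  The adjoint scheme is solved in \<open>X\<close> with the resolvent of \<open>\<A>\<^sup>*\<close>; the resolvent of \<open>\<A>\<close> shows
  that this is the only solution in \<open>Y\<close>.
\<close>

lemma adj_sol_values:
  obtains p :: "nat \<Rightarrow> 'x" where
    "\<And>k t. k \<in> {1..J} \<Longrightarrow> t \<in> cell T J k \<Longrightarrow>
      adj_sol \<iota> A \<alpha> T J (\<lambda>t. dual_op \<iota> (delta_hat T J t *\<^sub>R y)) t = \<iota> (p k)"
    "\<And>k. k \<in> {1..J} \<Longrightarrow> (\<Sum>j\<in>{1..J}. K j k *\<^sub>R \<iota> (p j)) - \<tau> *\<^sub>R As (p k) = (if k = J then y else 0)"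
proof -
  let ?g = "\<lambda>t. dual_op \<iota> (delta_hat T J t *\<^sub>R y)"
  let ?P = "adj_sol \<iota> A \<alpha> T J ?g"
  obtain p where p: "\<forall>k\<in>{1..J}. (\<Sum>j\<in>{k..J}. K j k *\<^sub>R \<iota> (p j)) - \<tau> *\<^sub>R As (p k) = (if k = J then y else 0)"
    using fwd.triangular_strong_exists[where K = K and J = J and h = "\<lambda>k. if k = J then y else 0", OF \<tau>0 K_diag]
    by (rule exE)
  have p': "(\<Sum>j\<in>{1..J}. K j k *\<^sub>R \<iota> (p j)) - \<tau> *\<^sub>R As (p k) = (if k = J then y else 0)" if "k \<in> {1..J}" for k
    using p[rule_format, OF that] by (simp only: K_sum_upper[OF that])
  have adjoint': "cinner (As q) (\<iota> v) = cinner (\<iota> q) (A v)" for q v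
    using adjoint[of v q] by (metis cinner_commute)
  have weak: "(\<Sum>j\<in>{1..J}. K j k *\<^sub>R cinner (\<iota> (p j)) (\<iota> v)) - \<tau> *\<^sub>R cinner (\<iota> (p k)) (A v) = load T J ?g k v"
    if k: "k \<in> {1..J}" for k v
  proof -
    have "(\<Sum>j\<in>{1..J}. K j k *\<^sub>R cinner (\<iota> (p j)) (\<iota> v)) - \<tau> *\<^sub>R cinner (\<iota> (p k)) (A v)
        = cinner ((\<Sum>j\<in>{1..J}. K j k *\<^sub>R \<iota> (p j)) - \<tau> *\<^sub>R As (p k)) (\<iota> v)"
      by (simp only: cinner.diff_left cinner.sum_left cinner.scaleR_left adjoint')
    also have "\<dots> = load T J ?g k v" by (simp only: p'[OF k] load_delta(2)[OF k])
    finally show ?thesis .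
  qed
  note iff = is_adj_sol_iff[OF fwd.\<iota> adj.B \<alpha> T J load_delta(1)]
  have "is_adj_sol \<iota> A \<alpha> T J ?g (cell_fun T J (\<lambda>k. \<iota> (p k)))"
    unfolding iff
  proof (intro conjI ballI allI)
    fix k v assume k: "k \<in> {1..J}"
    let ?w = "cell_fun T J (\<lambda>k. \<iota> (p k))"
    have "(\<Sum>j\<in>{1..J}. K j k *\<^sub>R cinner (cell_value T J ?w j) (\<iota> v))
        = (\<Sum>j\<in>{1..J}. K j k *\<^sub>R cinner (\<iota> (p j)) (\<iota> v))"
      by (intro sum.cong refl) (simp only: cell_fun(2)[OF T J0])
    then show "(\<Sum>j\<in>{1..J}. K j k *\<^sub>R cinner (cell_value T J ?w j) (\<iota> v))
        - \<tau> *\<^sub>R cinner (cell_value T J ?w k) (A v) = load T J ?g k v"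
      using weak[OF k, of v] by (simp only: cell_fun(2)[OF T J0 k])
  qed (rule cell_fun(1)[OF T J0])
  then have "is_adj_sol \<iota> A \<alpha> T J ?g ?P"
    unfolding adj_sol_def by (rule someI[of "is_adj_sol \<iota> A \<alpha> T J ?g"])
  then have W: "?P \<in> W_space T J" and P: "\<And>k v. k \<in> {1..J} \<Longrightarrow>
      (\<Sum>j\<in>{1..J}. K j k *\<^sub>R cinner (cell_value T J ?P j) (\<iota> v)) - \<tau> *\<^sub>R cinner (cell_value T J ?P k) (A v) = load T J ?g k v"
    unfolding iff by blast+
  have "cell_value T J ?P k - \<iota> (p k) = 0" if "k \<in> {1..J}" for k
  proof (rule adj.triangular_weak_unique_backward[where K = K and w = "\<lambda>k. cell_value T J ?P k - \<iota> (p k)",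
        OF \<tau>0 K_diag _ that])
    fix k v assume k: "k \<in> {1..J}"
    have "(\<Sum>j\<in>{1..J}. K j k *\<^sub>R cinner (cell_value T J ?P j - \<iota> (p j)) (\<iota> v)) - \<tau> *\<^sub>R cinner (cell_value T J ?P k - \<iota> (p k)) (A v) = 0"
    proof -
      have "(\<Sum>j\<in>{1..J}. K j k *\<^sub>R cinner (cell_value T J ?P j - \<iota> (p j)) (\<iota> v)) - \<tau> *\<^sub>R cinner (cell_value T J ?P k - \<iota> (p k)) (A v)
        = ((\<Sum>j\<in>{1..J}. K j k *\<^sub>R cinner (cell_value T J ?P j) (\<iota> v)) - \<tau> *\<^sub>R cinner (cell_value T J ?P k) (A v))
        - ((\<Sum>j\<in>{1..J}. K j k *\<^sub>R cinner (\<iota> (p j)) (\<iota> v)) - \<tau> *\<^sub>R cinner (\<iota> (p k)) (A v))"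
        by (simp only: cinner.diff_left scaleR_diff_right sum_subtractf) (simp only: algebra_simps)
      then show ?thesis by (simp only: P[OF k] weak[OF k] diff_self)
    qed
    then show "(\<Sum>j\<in>{k..J}. K j k *\<^sub>R cinner (cell_value T J ?P j - \<iota> (p j)) (\<iota> v)) - \<tau> *\<^sub>R cinner (cell_value T J ?P k - \<iota> (p k)) (A v) = 0"
      by (simp only: K_sum_upper[OF k])
  qed
  then show ?thesis
    using that[of p] p' W_space_value[OF W T J0] by auto
qed

text \<open>Summation by parts in time, in matrix form.\<close>

lemma duality_identity:
  assumes w: "solves w G"
    and p: "\<And>k. k \<in> {1..J} \<Longrightarrow> (\<Sum>j\<in>{1..J}. K j k *\<^sub>R \<iota> (p j)) - \<tau> *\<^sub>R As (p k) = h k"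
  shows "(\<Sum>k\<in>{1..J}. cinner (w k) (h k)) = (\<Sum>k\<in>{1..J}. G k (p k))"
proof -
  have "(\<Sum>k\<in>{1..J}. cinner (w k) (h k))
      = (\<Sum>k\<in>{1..J}. \<Sum>j\<in>{1..J}. K j k *\<^sub>R cinner (w k) (\<iota> (p j))) - (\<Sum>k\<in>{1..J}. \<tau> *\<^sub>R cinner (w k) (As (p k)))"
    by (simp add: p[symmetric] cinner.diff_right cinner.sum_right cinner.scaleR_right sum_subtractf)
  also have "(\<Sum>k\<in>{1..J}. \<Sum>j\<in>{1..J}. K j k *\<^sub>R cinner (w k) (\<iota> (p j)))
      = (\<Sum>k\<in>{1..J}. \<Sum>j\<in>{1..J}. K k j *\<^sub>R cinner (w j) (\<iota> (p k)))"
    by (rule sum.swap)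
  also have "\<dots> - (\<Sum>k\<in>{1..J}. \<tau> *\<^sub>R cinner (w k) (As (p k))) = (\<Sum>k\<in>{1..J}. G k (p k))"
    using w by (simp add: solves_def flip: sum_subtractf)
  finally show ?thesis .
qed

end

section \<open>Existence and optimality conditions\<close>

context control_problem
begin

lemma R_lin: "R (a *\<^sub>R x + b *\<^sub>R y) = a *\<^sub>R R x + b *\<^sub>R R y"
  using R by (simp add: bounded_clinear_into_interp_def scaleR_scaleC)

lemma R_diff: "R (x - y) = R x - R y"
  using R_lin[of 1 x "-1" y] by simp

definition admissible :: "(real \<Rightarrow> 'z) \<Rightarrow> bool" where
  "admissible U \<longleftrightarrow> U \<in> Linf T \<and> U \<in> L2 T"

lemma admissibleD:
  assumes "admissible U"
  shows "strongly_measurable (time T) U" and "integrable (time T) (\<lambda>t. (norm (U t))\<^sup>2)"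
    and "integrable (time T) (\<lambda>t. norm (U t))"
proof -
  show U: "strongly_measurable (time T) U" "integrable (time T) (\<lambda>t. (norm (U t))\<^sup>2)"
    using assms by (auto simp: admissible_def L2_def)
  show "integrable (time T) (\<lambda>t. norm (U t))"
    by (rule time.integral_norm_le(1)[OF time.square_measurable(3)[OF U(1) U(1)] U(2) zero_less_one])
qed

lemma R_bound:
  "\<exists>C. C \<ge> 0 \<and> (\<forall>z v. cmod (pairing (R z) v) \<le> C * norm z * norm v)"
  by (rule fwd.into_interp_bounded[OF R \<theta>]) blast

lemma bounded_linear_R_pairing: "bounded_linear (\<lambda>z. pairing (R z) v)"
proof -
  obtain C where C: "C \<ge> 0 \<and> (\<forall>z v. cmod (pairing (R z) v) \<le> C * norm z * norm v)"
    using R_bound by (rule exE)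
  show ?thesis
  proof (rule bounded_linear_intro[where K = "C * norm v"])
    show "pairing (R (x + y)) v = pairing (R x) v + pairing (R y) v" for x y
      using R_lin[of 1 x 1 y] by (simp add: pairing_add_left)
    show "pairing (R (r *\<^sub>R x)) v = r *\<^sub>R pairing (R x) v" for r x
      using R_lin[of r x 0 0] by (simp add: pairing.scaleR_left)
    show "cmod (pairing (R z) v) \<le> norm z * (C * norm v)" for z
      using C by (simp add: mult_ac)
  qed
qed

lemma R_pairing_integrable:
  assumes U: "admissible U" and V: "V \<in> W_space T J"
  shows "integrable (time T) (\<lambda>t. pairing (R (U t)) (V t))"
proof -
  obtain C where C: "C \<ge> 0 \<and> (\<forall>z v. cmod (pairing (R z) v) \<le> C * norm z * norm v)"
    using R_bound by (rule exE)
  have "integrable (time T) (\<lambda>t. pairing (R (U t)) v)" for v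
  proof (rule Bochner_Integration.integrable_bound)
    show "integrable (time T) (\<lambda>t. C * norm v * norm (U t))" using admissibleD(3)[OF U] by simp
    show "(\<lambda>t. pairing (R (U t)) v) \<in> borel_measurable (time T)"
    proof (rule time.borel_measurable_strongly[where h = "\<lambda>x y. pairing (R x) v",
          OF admissibleD(1)[OF U] admissibleD(1)[OF U]])
      show "isCont (\<lambda>p. pairing (R (fst p)) v) (x, y)" for x y :: 'z
        by (intro bounded_linear.continuous[OF bounded_linear_R_pairing] continuous_intros)
    qed
    show "AE t in time T. cmod (pairing (R (U t)) v) \<le> norm (C * norm v * norm (U t))"
      using C by (auto simp: mult_ac)
  qed
  then show ?thesis
    by (intro integral_cell_decomposition(1)[OF V T J0, of "\<lambda>t. pairing (R (U t))"] integrable_cell T J0)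
qed

lemma const_W_space: "(\<lambda>t. v) \<in> W_space T J"
  by (auto simp: W_space_def)

lemma R_pairing_integrable': "admissible U \<Longrightarrow> integrable (time T) (\<lambda>t. pairing (R (U t)) v)"
  using R_pairing_integrable[OF _ const_W_space] .

abbreviation state :: "(real \<Rightarrow> 'z) \<Rightarrow> nat \<Rightarrow> 'y" where
  "state U \<equiv> cell_value T J (sol \<iota> As \<alpha> T J (\<lambda>t. R (U t)))"

lemma state:
  assumes U: "admissible U"
  shows "sol \<iota> As \<alpha> T J (\<lambda>t. R (U t)) \<in> W_space T J"
    and "solves (state U) (load T J (\<lambda>t. R (U t)))"
    and "lim_left (sol \<iota> As \<alpha> T J (\<lambda>t. R (U t))) T = state U J"
proof -
  obtain C where C: "C \<ge> 0 \<and> (\<forall>z v. cmod (pairing (R z) v) \<le> C * norm z * norm v)"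
    using R_bound by (rule exE)
  have "cmod (load T J (\<lambda>t. R (U t)) k v) \<le> (LINT t|time T. C * norm (U t)) * norm v" if k: "k \<in> {1..J}" for k v
    by (rule load_bound[OF R_pairing_integrable'[OF U] k]) (use C admissibleD(3)[OF U] in auto)
  moreover have "(LINT t|time T. C * norm (U t)) \<ge> 0" using C by simp
  ultimately show W: "sol \<iota> As \<alpha> T J (\<lambda>t. R (U t)) \<in> W_space T J"
    "solves (state U) (load T J (\<lambda>t. R (U t)))"
    using sol_solves[OF R_pairing_integrable'[OF U]] by blast+
  show "lim_left (sol \<iota> As \<alpha> T J (\<lambda>t. R (U t))) T = state U J"
    using lim_left_node[OF W(1) T J0, of J] J0 by (simp add: node_end)
qed

lemma load_lincomb:
  assumes "admissible U" "admissible V" "k \<in> {1..J}"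
  shows "load T J (\<lambda>t. R (a *\<^sub>R U t + b *\<^sub>R V t)) k v
    = a *\<^sub>R load T J (\<lambda>t. R (U t)) k v + b *\<^sub>R load T J (\<lambda>t. R (V t)) k v"
proof -
  note i = integrable_cell[OF R_pairing_integrable'[OF assms(1)] T J0 assms(3)]
    integrable_cell[OF R_pairing_integrable'[OF assms(2)] T J0 assms(3)]
  have "load T J (\<lambda>t. R (a *\<^sub>R U t + b *\<^sub>R V t)) k v
    = (LINT t|time T. a *\<^sub>R (indicator (cell T J k) t *\<^sub>R pairing (R (U t)) v)
        + b *\<^sub>R (indicator (cell T J k) t *\<^sub>R pairing (R (V t)) v))"
    by (simp add: load_def R_lin pairing_add_left pairing.scaleR_left scaleR_add_right mult.commute)
  also have "\<dots> = a *\<^sub>R load T J (\<lambda>t. R (U t)) k v + b *\<^sub>R load T J (\<lambda>t. R (V t)) k v"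
    unfolding load_def
    by (subst Bochner_Integration.integral_add[OF integrable_scaleR_right[OF i(1)] integrable_scaleR_right[OF i(2)]])
      (simp only: integral_scaleR_right)
  finally show ?thesis .
qed

lemma state_lincomb:
  assumes UV: "admissible U" "admissible V" "admissible (\<lambda>t. a *\<^sub>R U t + b *\<^sub>R V t)" and k: "k \<in> {1..J}"
  shows "state (\<lambda>t. a *\<^sub>R U t + b *\<^sub>R V t) k = a *\<^sub>R state U k + b *\<^sub>R state V k"
proof -
  have s: "solves (\<lambda>k. a *\<^sub>R state U k + b *\<^sub>R state V k)
      (\<lambda>k v. a *\<^sub>R load T J (\<lambda>t. R (U t)) k v + b *\<^sub>R load T J (\<lambda>t. R (V t)) k v)"
    by (intro solves_lincomb state UV)
  have "solves (\<lambda>k. a *\<^sub>R state U k + b *\<^sub>R state V k) (load T J (\<lambda>t. R (a *\<^sub>R U t + b *\<^sub>R V t)))"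
    using s by (simp add: solves_def load_lincomb[OF UV(1,2)])
  then show ?thesis using solves_unique[OF state(2)[OF UV(3)]] k by blast
qed

lemma state_diff_solves:
  assumes UV: "admissible U" "admissible V"
  shows "solves (\<lambda>k. state V k - state U k) (load T J (\<lambda>t. R (V t - U t)))"
proof -
  have "solves (\<lambda>k. 1 *\<^sub>R state V k + (-1) *\<^sub>R state U k)
      (\<lambda>k v. 1 *\<^sub>R load T J (\<lambda>t. R (V t)) k v + (-1) *\<^sub>R load T J (\<lambda>t. R (U t)) k v)"
    by (intro solves_lincomb state UV)
  then show ?thesis
    using load_lincomb[OF UV(2,1), where a = 1 and b = "-1"] by (simp add: solves_def)
qed

lemma diff_measurable:
  assumes UV: "admissible U" "admissible V"
  shows "(\<lambda>t. norm (V t - U t)) \<in> borel_measurable (time T)"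
    and "integrable (time T) (\<lambda>t. (norm (V t - U t))\<^sup>2)" and "integrable (time T) (\<lambda>t. norm (V t - U t))"
proof -
  show 1: "(\<lambda>t. norm (V t - U t)) \<in> borel_measurable (time T)"
    by (intro time.square_measurable admissibleD UV)
  show 2: "integrable (time T) (\<lambda>t. (norm (V t - U t))\<^sup>2)"
    by (intro time.square_integrable_diff admissibleD UV)
  show "integrable (time T) (\<lambda>t. norm (V t - U t))"
    by (rule time.integral_norm_le(1)[OF 1 2 zero_less_one])
qed

lemma R_pairing_diff_integrable:
  assumes UV: "admissible U" "admissible V" and W: "W \<in> W_space T J"
  shows "integrable (time T) (\<lambda>t. pairing (R (V t - U t)) (W t))"
  unfolding R_diff pairing.diff_left
  by (intro Bochner_Integration.integrable_diff R_pairing_integrable UV W)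

text \<open>Stability of the scheme, and the bound of the \<open>L\<^sup>1\<close> norm by the \<open>L\<^sup>2\<close> norm.\<close>

lemma state_Lipschitz:
  "\<exists>C. \<forall>U V. admissible U \<longrightarrow> admissible V \<longrightarrow> norm (state V J - state U J) \<le> C * L2_norm T (\<lambda>t. V t - U t)"
proof -
  obtain CR where CR: "CR \<ge> 0 \<and> (\<forall>z v. cmod (pairing (R z) v) \<le> CR * norm z * norm v)"
    using R_bound by (rule exE)
  obtain C where C: "C \<ge> 0 \<and> (\<forall>w G g. g \<ge> 0 \<longrightarrow> solves w G \<longrightarrow>
    (\<forall>k\<in>{1..J}. \<forall>v. cmod (G k v) \<le> g * norm v) \<longrightarrow> (\<forall>k\<in>{1..J}. norm (w k) \<le> C * g))"
    using solves_bound by (rule exE)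
  let ?m = "1 + Sigma_Algebra.measure (time T) (space (time T))"
  have "norm (state V J - state U J) \<le> (C * (CR * ?m)) * L2_norm T (\<lambda>t. V t - U t)"
    if UV: "admissible U" "admissible V" for U V
  proof -
    define g where "g = CR * (?m * L2_norm T (\<lambda>t. V t - U t))"
    have le: "(LINT t|time T. norm (V t - U t)) \<le> ?m * L2_norm T (\<lambda>t. V t - U t)"
      unfolding L2_norm_def by (rule time.integral_norm_le_L2[OF diff_measurable(1,2)[OF UV]])
    have "g \<ge> 0"
      unfolding g_def L2_norm_def using CR by (intro mult_nonneg_nonneg add_nonneg_nonneg) auto
    have "cmod (load T J (\<lambda>t. R (V t - U t)) k v) \<le> g * norm v" if k: "k \<in> {1..J}" for k v
    proof -
      have "cmod (load T J (\<lambda>t. R (V t - U t)) k v) \<le> (LINT t|time T. CR * norm (V t - U t)) * norm v"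
        by (rule load_bound[OF R_pairing_diff_integrable[OF UV const_W_space] k])
          (use CR diff_measurable(3)[OF UV] in auto)
      also have "\<dots> \<le> g * norm v"
        unfolding g_def using CR le by (intro mult_right_mono) (auto intro: mult_left_mono)
      finally show ?thesis .
    qed
    then have "norm (state V J - state U J) \<le> C * g"
      using C[THEN conjunct2, rule_format, OF \<open>g \<ge> 0\<close> state_diff_solves[OF UV], of J] J0 by auto
    then show ?thesis by (simp add: g_def mult_ac)
  qed
  then show ?thesis by blast
qed

abbreviation "J_cost \<equiv> cost \<iota> As \<alpha> T J R yd \<nu>"

lemma J_cost_eq:
  assumes "admissible U"
  shows "J_cost U = (norm (state U J - yd))\<^sup>2 / 2 + \<nu> / 2 * (LINT t|time T. (norm (U t))\<^sup>2)"
  by (simp add: cost_def state(3)[OF assms] L2_norm_def)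

text \<open>The derivative of the cost functional at \<open>U\<close> in the direction \<open>V - U\<close>.\<close>

definition variation :: "(real \<Rightarrow> 'z) \<Rightarrow> (real \<Rightarrow> 'z) \<Rightarrow> real" where
  "variation U V = inner (state U J - yd) (state V J - state U J)
    + \<nu> * (LINT t|time T. inner (U t) (V t - U t))"

lemma inner_diff_integrable:
  assumes UV: "admissible U" "admissible V"
  shows "(\<lambda>t. inner (U t) (V t - U t)) \<in> borel_measurable (time T)"
    and "integrable (time T) (\<lambda>t. inner (U t) (V t - U t))"
proof -
  show m: "(\<lambda>t. inner (U t) (V t - U t)) \<in> borel_measurable (time T)"
    by (rule time.borel_measurable_strongly[OF admissibleD(1)[OF UV(1)] admissibleD(1)[OF UV(2)],
        where h = "\<lambda>u v. inner u (v - u)"]) (intro continuous_intros)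
  show "integrable (time T) (\<lambda>t. inner (U t) (V t - U t))"
    by (rule time.integral_inner_le_L2(1)[OF m admissibleD(2)[OF UV(1)] diff_measurable(2)[OF UV]])
qed

text \<open>
  The state is an affine function of the control. The second-order term dominates
  \<open>\<nu> \<parallel>V - U\<parallel>\<^sup>2\<close>, which makes the cost functional strongly convex.
\<close>

lemma cost_segment:
  assumes UV: "admissible U" "admissible V" "admissible (\<lambda>t. (1 - s) *\<^sub>R U t + s *\<^sub>R V t)"
  shows "J_cost (\<lambda>t. (1 - s) *\<^sub>R U t + s *\<^sub>R V t) = J_cost U + s * variation U V
    + s\<^sup>2 / 2 * ((norm (state V J - state U J))\<^sup>2 + \<nu> * (LINT t|time T. (norm (V t - U t))\<^sup>2))"
proof -
  have Jk: "J \<in> {1..J}" using J0 by auto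
  let ?I = "LINT t|time T. inner (U t) (V t - U t)"
  have quad: "(norm (x + s *\<^sub>R y))\<^sup>2 = (norm x)\<^sup>2 + 2 * s * inner x y + s\<^sup>2 * (norm y)\<^sup>2"
    for x y :: "'v::real_inner"
    unfolding power2_norm_eq_inner
    by (simp add: inner_add_left inner_add_right inner_commute[of y x] power2_eq_square algebra_simps)
  have "state (\<lambda>t. (1 - s) *\<^sub>R U t + s *\<^sub>R V t) J - yd = (state U J - yd) + s *\<^sub>R (state V J - state U J)"
    unfolding state_lincomb[OF UV Jk] by (simp add: algebra_simps)
  then have 1: "(norm (state (\<lambda>t. (1 - s) *\<^sub>R U t + s *\<^sub>R V t) J - yd))\<^sup>2 = (norm (state U J - yd))\<^sup>2
      + 2 * s * inner (state U J - yd) (state V J - state U J) + s\<^sup>2 * (norm (state V J - state U J))\<^sup>2"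
    by (simp only: quad)
  have "(1 - s) *\<^sub>R U t + s *\<^sub>R V t = U t + s *\<^sub>R (V t - U t)" for t by (simp add: algebra_simps)
  then have "(LINT t|time T. (norm ((1 - s) *\<^sub>R U t + s *\<^sub>R V t))\<^sup>2)
      = (LINT t|time T. (norm (U t))\<^sup>2 + 2 * s * inner (U t) (V t - U t) + s\<^sup>2 * (norm (V t - U t))\<^sup>2)"
    by (simp only: quad)
  also have "\<dots> = (LINT t|time T. (norm (U t))\<^sup>2) + 2 * s * ?I + s\<^sup>2 * (LINT t|time T. (norm (V t - U t))\<^sup>2)"
    using admissibleD(2)[OF UV(1)] diff_measurable(2)[OF UV(1,2)] inner_diff_integrable(2)[OF UV(1,2)]
    by simp
  finally have 2: "(LINT t|time T. (norm ((1 - s) *\<^sub>R U t + s *\<^sub>R V t))\<^sup>2) = \<dots>" .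
  have alg: "(A + 2 * s * i + s\<^sup>2 * D) / 2 + \<nu> / 2 * (q + 2 * s * I + s\<^sup>2 * Q)
      = (A / 2 + \<nu> / 2 * q) + s * (i + \<nu> * I) + s\<^sup>2 / 2 * (D + \<nu> * Q)" for A i D q I Q :: real
    by (simp add: field_simps)
  show ?thesis
    unfolding J_cost_eq[OF UV(1)] J_cost_eq[OF UV(3)] 1 2 variation_def by (rule alg)
qed

lemma cost_difference:
  assumes UV: "admissible U" "admissible V"
  shows "J_cost V = J_cost U + variation U V
    + ((norm (state V J - state U J))\<^sup>2 + \<nu> * (LINT t|time T. (norm (V t - U t))\<^sup>2)) / 2"
  using cost_segment[of U V 1] UV by simp

text \<open>
  Almost everywhere the adjoint state \<open>P\<close> has values in \<open>X\<close>, where \<open>R\<^sup>*\<close> is given by the pairing of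
  \<open>X\<^sup>*\<close> with \<open>X\<close>. The first term is then the right-hand side of the equation for the difference of
  the states, tested with \<open>P\<close>, and the duality identity applies.
\<close>

lemma variation_adjoint:
  assumes UV: "admissible U" "admissible V"
  shows "Re (LINT t|time T. cinner (interp_adjoint \<iota> \<theta> R
      (adj_sol \<iota> A \<alpha> T J (\<lambda>t. dual_op \<iota> (delta_hat T J t *\<^sub>R (state U J - yd))) t) + \<nu> *\<^sub>R U t) (V t - U t))
    = variation U V"
proof -
  let ?y = "state U J - yd"
  let ?P = "adj_sol \<iota> A \<alpha> T J (\<lambda>t. dual_op \<iota> (delta_hat T J t *\<^sub>R ?y))"
  obtain p where p: "\<And>k t. k \<in> {1..J} \<Longrightarrow> t \<in> cell T J k \<Longrightarrow> ?P t = \<iota> (p k)"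
    "\<And>k. k \<in> {1..J} \<Longrightarrow> (\<Sum>j\<in>{1..J}. K j k *\<^sub>R \<iota> (p j)) - \<tau> *\<^sub>R As (p k) = (if k = J then ?y else 0)"
    by (rule adj_sol_values[of ?y]) (rule that)
  let ?p = "cell_fun T J p"
  note p_W = cell_fun(1)[OF T J0, of p]
  note i1 = R_pairing_diff_integrable[OF UV p_W]
  have i2: "integrable (time T) (\<lambda>t. cinner (U t) (V t - U t))"
  proof (rule Bochner_Integration.integrable_bound)
    show "integrable (time T) (\<lambda>t. (norm (U t))\<^sup>2 + (norm (V t - U t))\<^sup>2)"
      using admissibleD(2)[OF UV(1)] diff_measurable(2)[OF UV] by simp
    show "(\<lambda>t. cinner (U t) (V t - U t)) \<in> borel_measurable (time T)"
      by (rule time.borel_measurable_strongly[OF admissibleD(1)[OF UV(1)] admissibleD(1)[OF UV(2)],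
          where h = "\<lambda>u v. cinner u (v - u)"]) (intro cinner.continuous continuous_intros)
    have "cmod (cinner u d) \<le> (norm u)\<^sup>2 + (norm d)\<^sup>2" for u d :: 'z
    proof -
      have "2 * (norm u * norm d) \<le> (norm u)\<^sup>2 + (norm d)\<^sup>2"
        using zero_le_power2[of "norm u - norm d"] by (simp add: power2_eq_square algebra_simps)
      moreover have "0 \<le> norm u * norm d" by simp
      ultimately show ?thesis using cmod_cinner_le[of u d] by linarith
    qed
    then show "AE t in time T. cmod (cinner (U t) (V t - U t)) \<le> norm ((norm (U t))\<^sup>2 + (norm (V t - U t))\<^sup>2)"
      by auto
  qed
  have "AE t in time T. cinner (interp_adjoint \<iota> \<theta> R (?P t) + \<nu> *\<^sub>R U t) (V t - U t)
      = cnj (pairing (R (V t - U t)) (?p t)) + \<nu> *\<^sub>R cinner (U t) (V t - U t)"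
    using AE_in_cell[OF T J0]
  proof eventually_elim
    case (elim t)
    then obtain k where k: "k \<in> {1..J}" "t \<in> cell T J k" by blast
    have "?p t = p k" using W_space_value[OF p_W T J0 k] cell_fun(2)[OF T J0 k(1)] by metis
    then show ?case
      by (simp add: p(1)[OF k] cinner_add_left cinner.scaleR_left fwd.interp_adjoint_\<iota>[OF R \<theta>])
  qed
  then have "(LINT t|time T. cinner (interp_adjoint \<iota> \<theta> R (?P t) + \<nu> *\<^sub>R U t) (V t - U t))
      = (LINT t|time T. cnj (pairing (R (V t - U t)) (?p t)) + \<nu> *\<^sub>R cinner (U t) (V t - U t))"
    by (rule integral_time_AE_eq(2))
  also have "\<dots> = cnj (LINT t|time T. pairing (R (V t - U t)) (?p t)) + \<nu> *\<^sub>R (LINT t|time T. cinner (U t) (V t - U t))"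
    using i1 i2 by simp
  also have "(LINT t|time T. pairing (R (V t - U t)) (?p t)) = (\<Sum>k\<in>{1..J}. load T J (\<lambda>t. R (V t - U t)) k (cell_value T J ?p k))"
    by (rule load_sum[OF T J0 R_pairing_diff_integrable[OF UV const_W_space] p_W])
  also have "\<dots> = (\<Sum>k\<in>{1..J}. load T J (\<lambda>t. R (V t - U t)) k (p k))"
    by (intro sum.cong refl) (simp only: cell_fun(2)[OF T J0])
  also have "\<dots> = (\<Sum>k\<in>{1..J}. cinner (state V k - state U k) (if k = J then ?y else 0))"
    by (rule duality_identity[OF state_diff_solves[OF UV] p(2), symmetric])
  also have "\<dots> = (\<Sum>k\<in>{1..J}. if k = J then cinner (state V J - state U J) ?y else 0)"
    by (intro sum.cong) (auto simp: cinner.zero_right)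
  also have "\<dots> = cinner (state V J - state U J) ?y" using J0 by simp
  finally have "(LINT t|time T. cinner (interp_adjoint \<iota> \<theta> R (?P t) + \<nu> *\<^sub>R U t) (V t - U t))
      = cinner ?y (state V J - state U J) + \<nu> *\<^sub>R (LINT t|time T. cinner (U t) (V t - U t))"
    by (simp only: cinner_commute[symmetric])
  moreover have "Re (LINT t|time T. cinner (U t) (V t - U t)) = (LINT t|time T. inner (U t) (V t - U t))"
    using i2 by (simp add: inner_eq_Re_cinner)
  ultimately show ?thesis by (simp add: variation_def inner_eq_Re_cinner)
qed

text \<open>In the exact second-order expansion at \<open>V\<close> all terms but the constant one tend to zero.\<close>

lemma cost_tendsto:
  assumes V: "admissible V" and U: "\<And>n. admissible (U n)"
    and lim: "(\<lambda>n. L2_norm T (\<lambda>t. U n t - V t)) \<longlonglongrightarrow> 0"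
  shows "(\<lambda>n. J_cost (U n)) \<longlonglongrightarrow> J_cost V"
proof -
  obtain C where C: "\<forall>U V. admissible U \<longrightarrow> admissible V \<longrightarrow> norm (state V J - state U J) \<le> C * L2_norm T (\<lambda>t. V t - U t)"
    using state_Lipschitz by (rule exE)
  have s: "(\<lambda>n. state (U n) J - state V J) \<longlonglongrightarrow> 0"
  proof (rule Lim_null_comparison)
    show "(\<lambda>n. C * L2_norm T (\<lambda>t. U n t - V t)) \<longlonglongrightarrow> 0" by (rule tendsto_mult_right_zero[OF lim])
    show "\<forall>\<^sub>F n in sequentially. norm (state (U n) J - state V J) \<le> C * L2_norm T (\<lambda>t. U n t - V t)"
      by (intro always_eventually allI C[rule_format] V U)
  qed
  let ?q = "LINT t|time T. (norm (V t))\<^sup>2"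
  have "(\<lambda>n. (1 + ?q) * L2_norm T (\<lambda>t. U n t - V t)) \<longlonglongrightarrow> (1 + ?q) * 0" by (intro tendsto_intros lim)
  then have "(\<lambda>n. (1 + ?q) * L2_norm T (\<lambda>t. U n t - V t)) \<longlonglongrightarrow> 0" by simp
  then have i: "(\<lambda>n. LINT t|time T. inner (V t) (U n t - V t)) \<longlonglongrightarrow> 0"
  proof (rule Lim_null_comparison[rotated], intro always_eventually allI)
    fix n
    show "norm (LINT t|time T. inner (V t) (U n t - V t)) \<le> (1 + ?q) * L2_norm T (\<lambda>t. U n t - V t)"
      unfolding L2_norm_def real_norm_def
      by (rule time.integral_inner_le_L2(2)[OF inner_diff_integrable(1)[OF V U] admissibleD(2)[OF V] diff_measurable(2)[OF V U]])
  qed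
  have sq: "(L2_norm T (\<lambda>t. U n t - V t))\<^sup>2 = (LINT t|time T. (norm (U n t - V t))\<^sup>2)" for n
    by (simp add: L2_norm_def)
  have "(\<lambda>n. J_cost V + (inner (state V J - yd) (state (U n) J - state V J) + \<nu> * (LINT t|time T. inner (V t) (U n t - V t)))
      + ((norm (state (U n) J - state V J))\<^sup>2 + \<nu> * (L2_norm T (\<lambda>t. U n t - V t))\<^sup>2) / 2)
    \<longlonglongrightarrow> J_cost V + (inner (state V J - yd) 0 + \<nu> * 0) + ((norm (0::'y))\<^sup>2 + \<nu> * 0\<^sup>2) / 2"
    by (intro tendsto_intros s i lim) simp
  then show ?thesis
    unfolding sq cost_difference[OF V U] variation_def by simp
qed

lemma optimal_control:
  assumes Uad: "Uad \<subseteq> Linf T" "Uad \<subseteq> L2 T" "Uad \<noteq> {}" "fun_convex Uad" "L2_closed T Uad"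
  obtains U where "U \<in> Uad" "\<And>V. V \<in> Uad \<Longrightarrow> J_cost U \<le> J_cost V"
    "\<And>U'. U' \<in> Uad \<Longrightarrow> (\<And>V. V \<in> Uad \<Longrightarrow> J_cost U' \<le> J_cost V) \<Longrightarrow> AE t in time T. U' t = U t"
    "\<And>V. V \<in> Uad \<Longrightarrow> variation U V \<ge> 0"
proof -
  have adm: "admissible U" if "U \<in> Uad" for U using that Uad by (auto simp: admissible_def)
  have seg: "(\<lambda>t. (1 - s) *\<^sub>R U t + s *\<^sub>R V t) \<in> Uad" if "U \<in> Uad" "V \<in> Uad" "0 \<le> s" "s \<le> 1" for U V s
    using Uad(4) that by (auto simp: fun_convex_def)
  have cost0: "J_cost U \<ge> 0" if "U \<in> Uad" for U
    unfolding J_cost_eq[OF adm[OF that]] using \<nu> by (intro add_nonneg_nonneg mult_nonneg_nonneg) auto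
  have mid: "\<exists>w\<in>Uad. J_cost w \<le> (J_cost U + J_cost V) / 2 - \<nu> / 8 * (L2_norm T (\<lambda>t. V t - U t))\<^sup>2"
    if UV: "U \<in> Uad" "V \<in> Uad" for U V
  proof (rule bexI)
    \<comment> \<open>the midpoint, compared with both ends by the second-order expansion\<close>
    let ?W = "\<lambda>t. (1 - 1/2) *\<^sub>R U t + (1/2) *\<^sub>R V t"
    show W: "?W \<in> Uad" by (rule seg[OF UV]) auto
    have q: "(L2_norm T (\<lambda>t. V t - U t))\<^sup>2 = (LINT t|time T. (norm (V t - U t))\<^sup>2)"
      by (simp add: L2_norm_def)
    define S Q where "S = (norm (state V J - state U J))\<^sup>2" and "Q = (LINT t|time T. (norm (V t - U t))\<^sup>2)"
    have "J_cost ?W = J_cost U + 1/2 * variation U V + (1/2)\<^sup>2 / 2 * (S + \<nu> * Q)"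
      unfolding S_def Q_def by (rule cost_segment[OF adm[OF UV(1)] adm[OF UV(2)] adm[OF W]])
    moreover have "J_cost V = J_cost U + variation U V + (S + \<nu> * Q) / 2"
      unfolding S_def Q_def by (rule cost_difference[OF adm[OF UV(1)] adm[OF UV(2)]])
    ultimately have "J_cost ?W = (J_cost U + J_cost V) / 2 - S / 8 - \<nu> / 8 * Q"
      by (simp add: power2_eq_square field_simps)
    moreover have "S \<ge> 0" by (simp add: S_def)
    ultimately show "J_cost ?W \<le> (J_cost U + J_cost V) / 2 - \<nu> / 8 * (L2_norm T (\<lambda>t. V t - U t))\<^sup>2"
      unfolding q Q_def by simp
  qed
  have bdd: "bdd_below (J_cost ` Uad)" using cost0 by (auto simp: bdd_below_def)
  have "\<nu> / 8 > 0" using \<nu> by simp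
  obtain U where U: "\<And>n. U n \<in> Uad" "(\<lambda>n. J_cost (U n)) \<longlonglongrightarrow> Inf (J_cost ` Uad)"
    "\<And>e. e > 0 \<Longrightarrow> \<exists>N. \<forall>m\<ge>N. \<forall>n\<ge>N. L2_norm T (\<lambda>t. U n t - U m t) < e"
    by (rule minimizing_sequence_Cauchy[where F = J_cost and d = "\<lambda>U V. L2_norm T (\<lambda>t. V t - U t)",
          OF Uad(3) bdd \<open>\<nu> / 8 > 0\<close> mid]) (assumption+, rule that)
  note U' = adm[OF U(1)]
  have "\<exists>N. \<forall>m\<ge>N. \<forall>n\<ge>N. sqrt (LINT t|time T. (norm (U m t - U n t))\<^sup>2) < e" if "e > 0" for e
    using U(3)[OF that] unfolding L2_norm_def by blast
  then obtain V where V: "strongly_measurable (time T) V" "integrable (time T) (\<lambda>t. (norm (V t))\<^sup>2)"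
    "(\<lambda>n. sqrt (LINT t|time T. (norm (U n t - V t))\<^sup>2)) \<longlonglongrightarrow> 0"
    by (rule time.L2_complete[OF admissibleD(1)[OF U'] admissibleD(2)[OF U']])
  have lim: "(\<lambda>n. L2_norm T (\<lambda>t. U n t - V t)) \<longlonglongrightarrow> 0" using V(3) by (simp only: L2_norm_def)
  have "V \<in> L2 T" using V by (simp add: L2_def)
  with Uad(5) U(1) lim have VU: "V \<in> Uad" unfolding L2_closed_def by blast
  have "J_cost V = Inf (J_cost ` Uad)"
    by (rule LIMSEQ_unique[OF cost_tendsto[OF adm[OF VU] U' lim] U(2)])
  then have min: "J_cost V \<le> J_cost W" if "W \<in> Uad" for W
    using that bdd by (auto intro: cInf_lower)
  have unique: "AE t in time T. W t = V t" if W: "W \<in> Uad" "\<And>W'. W' \<in> Uad \<Longrightarrow> J_cost W \<le> J_cost W'" for W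
  proof -
    obtain w where w: "w \<in> Uad" "J_cost w \<le> (J_cost V + J_cost W) / 2 - \<nu> / 8 * (L2_norm T (\<lambda>t. W t - V t))\<^sup>2"
      using mid[OF VU W(1)] by blast
    have "e \<le> 0" if "c \<le> (a + b) / 2 - e" "a \<le> c" "b \<le> a" for a b c e :: real
      using that by argo
    from this[OF w(2) min[OF w(1)] W(2)[OF VU]]
    have "\<nu> / 8 * (L2_norm T (\<lambda>t. W t - V t))\<^sup>2 \<le> 0" .
    then have "(L2_norm T (\<lambda>t. W t - V t))\<^sup>2 \<le> 0" using \<open>\<nu> / 8 > 0\<close> by (simp only: mult_le_0_iff) auto
    then have "(LINT t|time T. (norm (W t - V t))\<^sup>2) \<le> 0" by (simp add: L2_norm_def)
    then have "(LINT t|time T. (norm (W t - V t))\<^sup>2) = 0" by (rule antisym) simp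
    then have "AE t in time T. (norm (W t - V t))\<^sup>2 = 0"
      using integral_nonneg_eq_0_iff_AE[OF diff_measurable(2)[OF adm[OF VU] adm[OF W(1)]]] by simp
    then show ?thesis by eventually_elim simp
  qed
  have "variation V W \<ge> 0" if W: "W \<in> Uad" for W
  proof -
    define Q where "Q = (norm (state W J - state V J))\<^sup>2 + \<nu> * (LINT t|time T. (norm (W t - V t))\<^sup>2)"
    have "0 \<le> variation V W + s / 2 * Q" if s: "0 < s" "s \<le> 1" for s
    proof -
      have sW: "(\<lambda>t. (1 - s) *\<^sub>R V t + s *\<^sub>R W t) \<in> Uad" using seg[OF VU W] s by simp
      have "0 \<le> s * variation V W + s\<^sup>2 / 2 * Q"
        using min[OF sW] cost_segment[OF adm[OF VU] adm[OF W] adm[OF sW]] by (simp add: Q_def)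
      also have "\<dots> = s * (variation V W + s / 2 * Q)" by (simp add: power2_eq_square algebra_simps)
      finally show ?thesis using s by (simp add: zero_le_mult_iff)
    qed
    then have "\<forall>\<^sub>F s in at_right 0. 0 \<le> variation V W + s / 2 * Q"
      using eventually_at_right_real[of 0 1] by (auto elim!: eventually_mono)
    moreover have "((\<lambda>s. variation V W + s / 2 * Q) \<longlongrightarrow> variation V W + 0 / 2 * Q) (at_right 0)"
      by (intro tendsto_intros) auto
    ultimately have "0 \<le> variation V W + 0 / 2 * Q" by (intro tendsto_lowerbound) auto
    then show ?thesis by simp
  qed
  with VU min unique show ?thesis by (intro that) auto
qed

end

section \<open>The optimal control theorem\<close>

lemma positive_real_in_sector:
  assumes "r > 0" "\<omega> > 0"
  shows "complex_of_real r \<in> sector \<omega>"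
  unfolding sector_def using assms by (intro CollectI exI[of _ r] exI[of _ 0]) simp

lemma dense_positive_resolventI:
  fixes \<iota> B :: "'x::complex_hilbert \<Rightarrow> 'y::complex_hilbert"
  assumes "bounded_clinear \<iota>" "closure (range \<iota>) = UNIV" "bounded_clinear B"
    and "\<omega> > 0" "c\<^sub>0 > 0" "c\<^sub>1 > 0" "M > 0"
    and set: "sector \<omega> \<union> {0} \<subseteq> resolvent_set \<iota> B"
    and bound: "\<And>z. z \<in> sector \<omega> \<Longrightarrow> onorm (resolvent \<iota> B z) \<le> M / (1 + cmod z)"
    and "\<And>v. c\<^sub>0 * norm v \<le> norm (B v) \<and> norm (B v) \<le> c\<^sub>1 * norm v"
  shows "dense_positive_resolvent \<iota> B c\<^sub>0 c\<^sub>1 M"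
proof unfold_locales
  fix r :: real assume r: "r > 0"
  then have z: "complex_of_real r \<in> sector \<omega>" using assms(4) by (rule positive_real_in_sector)
  with set have "complex_of_real r \<in> resolvent_set \<iota> B" by blast
  then have res: "bij (\<lambda>x. complex_of_real r *\<^sub>C \<iota> x - B x)"
    "bounded_linear (resolvent \<iota> B (complex_of_real r))"
    by (auto simp: resolvent_set_def bounded_clinear_def)
  then show "bij (\<lambda>x. complex_of_real r *\<^sub>C \<iota> x - B x)" by blast
  fix y
  have "norm (resolvent \<iota> B (complex_of_real r) y) \<le> onorm (resolvent \<iota> B (complex_of_real r)) * norm y"
    by (rule onorm[OF res(2)])
  also have "\<dots> \<le> M / (1 + r) * norm y"
    using bound[OF z] r by (intro mult_right_mono) auto
  finally show "norm (resolvent \<iota> B (complex_of_real r) y) \<le> M / (1 + r) * norm y" .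
qed (use assms in auto)

theorem theorem2p2:
  fixes \<iota> A As :: "'x::{complex_hilbert,second_countable_topology} \<Rightarrow>
                     'y::{complex_hilbert,second_countable_topology}"
    and \<omega>\<^sub>0 c\<^sub>0 c\<^sub>1 M\<^sub>0 \<alpha> T \<theta>\<^sub>0 \<nu> :: real
    and J :: nat
    and R :: "'z::complex_hilbert \<Rightarrow> 'x antidual"
    and yd :: 'y
    and Uad :: "(real \<Rightarrow> 'z) set"
  assumes embedding: "bounded_clinear \<iota>" "inj \<iota>" "closure (range \<iota>) = UNIV"
    and A_bounded: "bounded_clinear A" "bounded_clinear As"
    and constants: "pi / 2 < \<omega>\<^sub>0" "\<omega>\<^sub>0 < pi" "c\<^sub>0 > 0" "c\<^sub>1 > 0" "M\<^sub>0 > 0"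
    and A_resolvent_set: "sector \<omega>\<^sub>0 \<union> {0} \<subseteq> resolvent_set \<iota> A"
      "sector \<omega>\<^sub>0 \<union> {0} \<subseteq> resolvent_set \<iota> As"
    and A_resolvent_bound:
      "\<And>z. z \<in> sector \<omega>\<^sub>0 \<Longrightarrow> onorm (resolvent \<iota> A z) \<le> M\<^sub>0 / (1 + cmod z)"
      "\<And>z. z \<in> sector \<omega>\<^sub>0 \<Longrightarrow> onorm (resolvent \<iota> As z) \<le> M\<^sub>0 / (1 + cmod z)"
    and A_adjoint: "\<And>v w. cinner (A v) (\<iota> w) = cinner (\<iota> v) (As w)"
    and A_norm: "\<And>v. c\<^sub>0 * norm v \<le> norm (A v) \<and> norm (A v) \<le> c\<^sub>1 * norm v"
      "\<And>v. c\<^sub>0 * norm v \<le> norm (As v) \<and> norm (As v) \<le> c\<^sub>1 * norm v"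
    and A_dissipative: "\<And>v. Re (cinner (A v) (\<iota> v)) \<le> 0"
    and Uad: "Uad \<subseteq> Linf T" "Uad \<subseteq> L2 T" "Uad \<noteq> {}" "fun_convex Uad"
      "L2_bounded T Uad" "L2_closed T Uad"
    and params: "0 < \<alpha>" "\<alpha> \<le> 1" "0 < T" "J > 1" "0 < \<theta>\<^sub>0" "\<theta>\<^sub>0 \<le> 1" "\<nu> > 0"
    and R: "bounded_clinear_into_interp \<iota> \<theta>\<^sub>0 R"
  shows "\<exists>U\<in>Uad.
      (\<forall>V\<in>Uad. cost \<iota> As \<alpha> T J R yd \<nu> U \<le> cost \<iota> As \<alpha> T J R yd \<nu> V) \<and>
      (\<forall>U'\<in>Uad. (\<forall>V\<in>Uad. cost \<iota> As \<alpha> T J R yd \<nu> U' \<le> cost \<iota> As \<alpha> T J R yd \<nu> V) \<longrightarrow>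
         (AE t in time T. U' t = U t)) \<and>
      (let Y\<^sub>\<tau> = sol \<iota> As \<alpha> T J (\<lambda>t. R (U t));
           P = adj_sol \<iota> A \<alpha> T J (\<lambda>t. dual_op \<iota> (delta_hat T J t *\<^sub>R (lim_left Y\<^sub>\<tau> T - yd)))
       in \<forall>V\<in>Uad.
            Re (LINT t|time T. cinner (interp_adjoint \<iota> \<theta>\<^sub>0 R (P t) + \<nu> *\<^sub>R U t) (V t - U t)) \<ge> 0)"

proof -
  have "\<omega>\<^sub>0 > 0" using constants(1) pi_gt_zero by linarith
  interpret fwd: dense_positive_resolvent \<iota> As c\<^sub>0 c\<^sub>1 M\<^sub>0
    by (rule dense_positive_resolventI[OF embedding(1,3) A_bounded(2) \<open>\<omega>\<^sub>0 > 0\<close> constants(3-5)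
        A_resolvent_set(2) A_resolvent_bound(2) A_norm(2)])
  interpret adj: dense_positive_resolvent \<iota> A c\<^sub>0 c\<^sub>1 M\<^sub>0
    by (rule dense_positive_resolventI[OF embedding(1,3) A_bounded(1) \<open>\<omega>\<^sub>0 > 0\<close> constants(3-5)
        A_resolvent_set(1) A_resolvent_bound(1) A_norm(1)])
  interpret control_problem \<iota> As A c\<^sub>0 c\<^sub>1 M\<^sub>0 \<alpha> T \<theta>\<^sub>0 \<nu> J R yd
    by unfold_locales (use A_adjoint params R in auto)
  obtain U where U: "U \<in> Uad" "\<And>V. V \<in> Uad \<Longrightarrow> J_cost U \<le> J_cost V"
    "\<And>U'. U' \<in> Uad \<Longrightarrow> (\<And>V. V \<in> Uad \<Longrightarrow> J_cost U' \<le> J_cost V) \<Longrightarrow> AE t in time T. U' t = U t"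
    "\<And>V. V \<in> Uad \<Longrightarrow> variation U V \<ge> 0"
    using optimal_control[OF Uad(1-4,6)] by blast
  have adm: "admissible V" if "V \<in> Uad" for V using that Uad(1,2) by (auto simp: admissible_def)
  show ?thesis
    unfolding Let_def
  proof (intro bexI[OF _ U(1)] conjI ballI impI)
    show "J_cost U \<le> J_cost V" if "V \<in> Uad" for V by (rule U(2)[OF that])
    show "AE t in time T. U' t = U t" if "U' \<in> Uad" "\<forall>V\<in>Uad. J_cost U' \<le> J_cost V" for U'
      using U(3)[OF that(1)] that(2) by blast
    show "0 \<le> Re (LINT t|time T. cinner (interp_adjoint \<iota> \<theta>\<^sub>0 R (adj_sol \<iota> A \<alpha> T J
        (\<lambda>t. dual_op \<iota> (delta_hat T J t *\<^sub>R (lim_left (sol \<iota> As \<alpha> T J (\<lambda>t. R (U t))) T - yd))) t)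
        + \<nu> *\<^sub>R U t) (V t - U t))" if V: "V \<in> Uad" for V
      unfolding state(3)[OF adm[OF U(1)]] variation_adjoint[OF adm[OF U(1)] adm[OF V]]
      by (rule U(4)[OF V])
  qed
qed

end
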